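(* Let $n\ge 1$. The orbit structure (the multiset of orbit sizes) of the rowmotion operator $\mathrm{Row}\colon\pi_\downarrow(S_{n+1})\to\pi_\downarrow(S_{n+1})$ is the same as that of rowmotion $\mathrm{Row}\colon\mathcal J([n]\times[n])\to\mathcal J([n]\times[n])$.
   Context: $S_{n+1}$ is the group of permutations of $[n+1]=\{1,\dots,n+1\}$, written in one-line notation. An inversion of $w$ is a pair $(i,j)$ with $i<j$ and $w^{-1}(i)>w^{-1}(j)$; the weak order is $w\le w'$ iff every inversion of $w$ is an inversion of $w'$. The $c$-biCambrian congruence (for the bipartite Coxeter element $c=c_+c_-$, $c_+=\prod_{i\in[n]\text{ even}}s_i$, $c_-=\prod_{i\in[n]\text{ odd}}s_i$, $s_i=(i\ i{+}1)$). If two numbers $a<b$ are adjacent in the one-line notation of a permutation $v$ and there are integers $k,m$ of different parities with $a<k<m<b$ that both appear on the same side of $a$ and $b$ in $v$, then exchanging $a$ and $b$ in $v$ is called a valid swap. Write $v\equiv v'$ if $v$ can be transformed into $v'$ by a sequence of valid swaps. This equivalence relation $\equiv$ is a lattice congruence of the weak order (the $c$-biCambrian congruence), so each class is an interval. $\pi_\downarrow(w)$ is the minimum element of the class of $w$, and $\pi_\downarrow(S_{n+1})$, ordered by the weak order, is a finite semidistributive lattice isomorphic to the quotient lattice (the $c$-biCambrian lattice). Rowmotion on a finite semidistributive lattice $L$. An element $j$ is join-irreducible if it covers exactly one element, denoted $j_*$; for such $j$, the set $\{z\in L:z\wedge j=j_*\}$ has a maximum, denoted $\kappa(j)$. For each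 cover relation $x\lessdot y$ there is a unique join-irreducible $j_{xy}$ with $j_{xy}\le y$ and $\kappa(j_{xy})\ge x$. Put $\mathcal D(z)=\{j_{xz}:x\lessdot z\}$ and $\mathcal U(z)=\{j_{zy}:z\lessdot y\}$. For each $x\in L$ there is a unique $\mathrm{Row}(x)\in L$ with $\mathcal U(\mathrm{Row}(x))=\mathcal D(x)$; $\mathrm{Row}\colon L\to L$ is a bijection. $[n]\times[n]$ is the product of two $n$-element chains; $\mathcal J(P)$ is the set of order ideals of $P$ ordered by inclusion, and on it $\mathrm{Row}(I)=\{x\in P:x\not\ge y\text{ for all maximal elements }y\text{ of }I\}$. *)

theory Defs
  imports
    "HOL-Algebra.Lattice"
    "HOL-Combinatorics.Permutations"
    "HOL-Combinatorics.Orbits"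
    "HOL-Library.Multiset"
    "HOL-Library.Product_Order"
begin

section \<open>Rowmotion on a finite semidistributive lattice\<close>

text \<open>
  A lattice is a HOL-Algebra order structure whose \<^const>\<open>eq\<close> is equality. The definite
  descriptions below denote objects that exist and are unique in a finite semidistributive
  lattice; in other structures their values are unspecified.
\<close>

definition covers :: "('a, 'b) gorder_scheme \<Rightarrow> 'a \<Rightarrow> 'a \<Rightarrow> bool" where
  \<comment> \<open>\<open>covers L x y\<close> means that \<open>y\<close> covers \<open>x\<close>\<close>
  "covers L x y \<longleftrightarrow> x \<in> carrier L \<and> y \<in> carrier L \<and> x \<sqsubset>\<^bsub>L\<^esub> y \<and>
     \<not> (\<exists>z\<in>carrier L. x \<sqsubset>\<^bsub>L\<^esub> z \<and> z \<sqsubset>\<^bsub>L\<^esub> y)"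

definition join_irreducible :: "('a, 'b) gorder_scheme \<Rightarrow> 'a \<Rightarrow> bool" where
  "join_irreducible L j \<longleftrightarrow> j \<in> carrier L \<and> (\<exists>!x. covers L x j)"

definition lower_cover :: "('a, 'b) gorder_scheme \<Rightarrow> 'a \<Rightarrow> 'a" where
  "lower_cover L j = (THE x. covers L x j)"

definition kappa :: "('a, 'b) gorder_scheme \<Rightarrow> 'a \<Rightarrow> 'a" where
  "kappa L j = (THE m. greatest L m {z \<in> carrier L. z \<sqinter>\<^bsub>L\<^esub> j = lower_cover L j})"

definition cover_label :: "('a, 'b) gorder_scheme \<Rightarrow> 'a \<Rightarrow> 'a \<Rightarrow> 'a" where
  "cover_label L x y = (THE j. join_irreducible L j \<and> j \<sqsubseteq>\<^bsub>L\<^esub> y \<and> x \<sqsubseteq>\<^bsub>L\<^esub> kappa L j)"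

definition down_labels :: "('a, 'b) gorder_scheme \<Rightarrow> 'a \<Rightarrow> 'a set" where
  "down_labels L z = {cover_label L x z | x. covers L x z}"

definition up_labels :: "('a, 'b) gorder_scheme \<Rightarrow> 'a \<Rightarrow> 'a set" where
  "up_labels L z = {cover_label L z y | y. covers L z y}"

definition lattice_row :: "('a, 'b) gorder_scheme \<Rightarrow> 'a \<Rightarrow> 'a" where
  "lattice_row L x = (THE y. y \<in> carrier L \<and> up_labels L y = down_labels L x)"

section \<open>The bipartite biCambrian lattice\<close>

text \<open>
  A permutation \<open>w\<close> of \<open>{1..n+1}\<close> is a function on \<^typ>\<open>nat\<close> that fixes every other number;
  its one-line notation is \<open>w 1, \<dots>, w (n+1)\<close>, so \<open>inv w i\<close> is the position of the value \<open>i\<close>.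
  Because of the fixed points, every inversion automatically has both entries in \<open>{1..n+1}\<close>.
\<close>

definition inversions :: "(nat \<Rightarrow> nat) \<Rightarrow> (nat \<times> nat) set" where
  "inversions w = {(i, j). i < j \<and> inv w i > inv w j}"

definition weak_order :: "nat \<Rightarrow> (nat \<Rightarrow> nat) gorder" where
  "weak_order n = \<lparr>carrier = {w. w permutes {1..n+1}}, eq = (=),
                   le = (\<lambda>w w'. inversions w \<subseteq> inversions w')\<rparr>"

definition valid_swap :: "nat \<Rightarrow> (nat \<Rightarrow> nat) \<Rightarrow> (nat \<Rightarrow> nat) \<Rightarrow> bool" where
  "valid_swap n v v' \<longleftrightarrow> v permutes {1..n+1} \<and>
     (\<exists>p a b k m. p \<in> {1..n} \<and> {v p, v (p + 1)} = {a, b} \<and>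
        a < k \<and> k < m \<and> m < b \<and> even k \<noteq> even m \<and>
        (inv v k < p \<and> inv v m < p \<or> inv v k > p + 1 \<and> inv v m > p + 1) \<and>
        v' = transpose a b \<circ> v)"

definition biCambrian_equiv :: "nat \<Rightarrow> (nat \<Rightarrow> nat) \<Rightarrow> (nat \<Rightarrow> nat) \<Rightarrow> bool" where
  \<comment> \<open>valid swaps are reversible, so this is an equivalence relation\<close>
  "biCambrian_equiv n = (valid_swap n)\<^sup>*\<^sup>*"

definition pi_down :: "nat \<Rightarrow> (nat \<Rightarrow> nat) \<Rightarrow> (nat \<Rightarrow> nat)" where
  "pi_down n w = (THE u. least (weak_order n) u {v. biCambrian_equiv n w v})"

definition biCambrian_lattice :: "nat \<Rightarrow> (nat \<Rightarrow> nat) gorder" where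
  "biCambrian_lattice n = \<lparr>carrier = pi_down n ` carrier (weak_order n), eq = (=),
                           le = le (weak_order n)\<rparr>"

section \<open>Rowmotion on order ideals\<close>

definition order_ideals :: "'a::order set \<Rightarrow> 'a set set" where
  "order_ideals P = {I. I \<subseteq> P \<and> (\<forall>x\<in>I. \<forall>y\<in>P. y \<le> x \<longrightarrow> y \<in> I)}"

definition maximal_elements :: "'a::order set \<Rightarrow> 'a set" where
  "maximal_elements I = {y \<in> I. \<not> (\<exists>z\<in>I. y < z)}"

definition ideal_row :: "'a::order set \<Rightarrow> 'a set \<Rightarrow> 'a set" where
  "ideal_row P I = {x \<in> P. \<forall>y\<in>maximal_elements I. \<not> x \<ge> y}"

definition square_poset :: "nat \<Rightarrow> (nat \<times> nat) set" where
  \<comment> \<open>with the componentwise order on pairs of \<open>HOL-Library.Product_Order\<close>\<close>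
  "square_poset n = {1..n} \<times> {1..n}"

section \<open>Orbit structure\<close>

definition orbit_structure :: "('a \<Rightarrow> 'a) \<Rightarrow> 'a set \<Rightarrow> nat multiset" where
  \<comment> \<open>the sizes of the orbits of \<open>f\<close> on \<open>A\<close>, for a map \<open>f\<close> that permutes the finite set \<open>A\<close>;
     each orbit contributes exactly one entry\<close>
  "orbit_structure f A = image_mset card (mset_set (orbit f ` A))"

end

theory Submission
  imports Defs
begin

text \<open>
  Both systems are conjugate to rotation of binary words of length \<open>2n\<close> with \<open>n\<close> ones.

  An order ideal of \<open>[n] \<times> [n]\<close> is encoded by its Stanley--Thomas word: the rows that contain a
  maximal element, followed by the columns that do not.

  A biCambrian class is encoded by the noncrossing arc diagram formed by the descents of its
  minimum. An arc \<open>(a, b)\<close> survives the congruence iff the even numbers between \<open>a\<close> and \<open>b\<close> lie on one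
  side and the odd ones on the other. Rowmotion takes the descents of the minimum of one class to the
  ascents of the maximum of another, and comparing descents and ascents within one class shows that
  each letter of the word of the diagram moves one step, up to negation.

  Bijectivity of both encodings comes from equivariance: since the first and last letters of a word can
  be swapped when they differ, the fibre size depends only on the number of ones, and it is evident for
  the words comparable to that of the bottom element.
\<close>

section \<open>Words and rotation\<close>

text \<open>Position functions are integer valued, so reversal is negation, and each statement about
  minima, descents and joins also yields one about maxima, ascents and meets. Neither the congruence
  property nor semidistributivity is presupposed. A class is handled through the arcs whose
  join-irreducible lies below it and those whose meet-irreducible lies above it: both sets are
  invariant under valid swaps, and the first one recovers the class minimum. The heart is the
  comparison of minimum and maximum of one class at two neighbouring gaps. An arc that passes two
  consecutive numbers has them on different sides, which makes most cases local; only a number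
  standing before both its neighbours requires concatenating two arcs. Each rowmotion step exchanges
  touched and untouched while moving one gap, hence the alternating negation; it is consistent
  around the cycle because \<open>2 * n\<close> is even. The toggles of the outer letters come from
  the one object that governs exactly these two: the corner \<open>(1, n)\<close> of the square, and
  the arc \<open>(1, 2)\<close> of a diagram.\<close>

lemma image_orbit_conj:
  assumes "x \<in> A" "\<And>x. x \<in> A \<Longrightarrow> f x \<in> A" "\<And>x. x \<in> A \<Longrightarrow> h (f x) = g (h x)"
  shows "orbit f x \<subseteq> A" "h ` orbit f x = orbit g (h x)"
proof -
  show sub: "orbit f x \<subseteq> A"
  proof
    fix y assume "y \<in> orbit f x" then show "y \<in> A"
      by induction (use assms in auto)
  qed
  have "h y \<in> orbit g (h x)" if "y \<in> orbit f x" for y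
    using that
  proof induction
    case base then show ?case using assms by (simp add: orbit.base)
  next
    case (step y) then show ?case using assms sub by (auto simp: orbit.step)
  qed
  moreover have "z \<in> h ` orbit f x" if "z \<in> orbit g (h x)" for z
    using that
  proof induction
    case base then show ?case using assms by (metis image_eqI orbit.base)
  next
    case (step z)
    then obtain y where y: "y \<in> orbit f x" "z = h y" by auto
    then have "g z = h (f y)" using assms(3) sub by auto
    then show ?case using y by (auto intro: orbit.step)
  qed
  ultimately show "h ` orbit f x = orbit g (h x)" by auto
qed

text \<open>Orbits stay inside \<open>A\<close>, where \<open>h\<close> is injective, so taking
  images matches the orbits of the two maps one to one and keeps their sizes.\<close>

lemma orbit_structure_conj:
  assumes bij: "bij_betw h A B"
    and f: "\<And>x. x \<in> A \<Longrightarrow> f x \<in> A" and conj: "\<And>x. x \<in> A \<Longrightarrow> h (f x) = g (h x)"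
  shows "orbit_structure f A = orbit_structure g B"
proof -
  have inj: "inj_on h A" and B: "B = h ` A" using bij by (auto simp: bij_betw_def)
  note im = image_orbit_conj[where f = f and h = h and g = g, OF _ f conj]
  have inj2: "inj_on ((`) h) (orbit f ` A)"
  proof (rule inj_onI)
    fix S T assume "S \<in> orbit f ` A" "T \<in> orbit f ` A" "h ` S = h ` T"
    then show "S = T" using im(1) inj by (metis (no_types, lifting) imageE inj_on_image_eq_iff)
  qed
  have "orbit g ` B = (`) h ` (orbit f ` A)"
    unfolding B image_image using im(2) by (intro image_cong) auto
  then have "orbit_structure g B = image_mset card (image_mset ((`) h) (mset_set (orbit f ` A)))"
    using image_mset_mset_set[OF inj2] by (simp add: orbit_structure_def)
  also have "\<dots> = image_mset (\<lambda>S. card (h ` S)) (mset_set (orbit f ` A))"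
    by (simp add: image_mset.compositionality comp_def)
  also have "\<dots> = image_mset card (mset_set (orbit f ` A))"
  proof (rule image_mset_cong)
    fix S assume "S \<in># mset_set (orbit f ` A)"
    \<comment> \<open>\<open>mset_set\<close> of an infinite family is empty, so a member is a
      genuine orbit in either case.\<close>
    then have "S \<in> orbit f ` A" by (metis elem_mset_set empty_iff mset_set.infinite set_mset_empty)
    then have "S \<subseteq> A" using im(1) by blast
    then show "card (h ` S) = card S" using inj by (meson card_image inj_on_subset)
  qed
  finally show ?thesis by (simp add: orbit_structure_def)
qed

text \<open>A word is encoded by the positions of its ones; this is the cyclic shift to the
  left.\<close>

definition rot :: "nat \<Rightarrow> nat set \<Rightarrow> nat set" where
  "rot N A = {i. i < N \<and> Suc i mod N \<in> A}"

text \<open>When exactly one of two distinct positions is in \<open>A\<close>, flipping both letters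
  exchanges them; the unconditional flip is an involution.\<close>

definition flip2 :: "nat \<Rightarrow> nat \<Rightarrow> nat set \<Rightarrow> nat set" where
  "flip2 i j A = {k. (k \<in> A) \<noteq> (k = i \<or> k = j)}"

lemma rot_subset: "rot N A \<subseteq> {..<N}"
  by (auto simp: rot_def)

lemma mem_rot: "i < N \<Longrightarrow> i \<in> rot N A \<longleftrightarrow> (if Suc i = N then 0 \<in> A else Suc i \<in> A)"
  by (auto simp: rot_def)

lemma rot_inj:
  assumes "A \<subseteq> {..<N}" "B \<subseteq> {..<N}" "rot N A = rot N B"
  shows "A = B"
proof -
  have "i \<in> A \<longleftrightarrow> i \<in> B" if "i < N" for i
  proof (cases i)
    case 0
    with that have "N - 1 < N" "Suc (N - 1) = N" by auto
    then show ?thesis using 0 assms(3) mem_rot[of "N - 1" N] by auto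
  next
    case (Suc j)
    then show ?thesis using that assms(3) mem_rot[of j N] by auto
  qed
  then show ?thesis using assms by blast
qed

lemma card_flip2:
  assumes "finite A" "(i \<in> A) \<noteq> (j \<in> A)"
  shows "card (flip2 i j A) = card A"
proof -
  have *: "card (flip2 i j A) = card A" if "i \<in> A" "j \<notin> A" for i j
  proof -
    have "flip2 i j A = insert j (A - {i})" using that by (auto simp: flip2_def)
    then show ?thesis using assms that
      by (metis DiffD1 card_Suc_Diff1 card_insert_disjoint finite_Diff)
  qed
  have "flip2 i j A = flip2 j i A" by (auto simp: flip2_def)
  then show ?thesis using * assms by metis
qed

text \<open>Fibre sizes of \<open>wd\<close> are invariant under rotation and under swapping the first and last letters,
  hence under swapping any two neighbouring letters; so they only depend on the number of ones.\<close>
lemma bij_betw_words: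
  fixes wd :: "'a \<Rightarrow> nat set"
  assumes fin: "finite X" and f: "bij_betw f X X" and N: "N \<ge> 2"
    and wd: "\<And>x. x \<in> X \<Longrightarrow> wd x \<subseteq> {..<N}"
    and rot: "\<And>x. x \<in> X \<Longrightarrow> wd (f x) = rot N (wd x)"
    and tog: "\<And>x. x \<in> X \<Longrightarrow> (0 \<in> wd x) \<noteq> (N - 1 \<in> wd x) \<Longrightarrow>
        tg x \<in> X \<and> wd (tg x) = flip2 0 (N - 1) (wd x) \<and> tg (tg x) = x"
    and x0: "x0 \<in> X" "wd x0 = E" "\<And>x. x \<in> X \<Longrightarrow> wd x \<subseteq> E \<or> E \<subseteq> wd x \<Longrightarrow> x = x0"
  shows "bij_betw wd X {A. A \<subseteq> {..<N} \<and> card A = card E}"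
proof -
  define c where "c A = card {x \<in> X. wd x = A}" for A
  have E: "E \<subseteq> {..<N}" using wd x0 by blast
  have c_rot: "c (rot N A) = c A" if "A \<subseteq> {..<N}" for A
  proof -
    have "{x \<in> X. wd x = rot N A} = f ` {x \<in> X. wd x = A}"
    proof (intro subset_antisym subsetI)
      fix y assume y: "y \<in> {x \<in> X. wd x = rot N A}"
      then obtain x where x: "x \<in> X" "y = f x" using f by (auto simp: bij_betw_def)
      then have "wd x = A" using y rot[OF x(1)] wd[OF x(1)] that rot_inj by auto
      then show "y \<in> f ` {x \<in> X. wd x = A}" using x by auto
    qed (use f rot in \<open>auto simp: bij_betw_def\<close>)
    moreover have "inj_on f {x \<in> X. wd x = A}"
      using f by (auto simp: bij_betw_def intro: inj_on_subset)
    ultimately show ?thesis by (simp add: c_def card_image)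
  qed
  have flip_flip: "flip2 i j (flip2 i j A) = A" for i j and A :: "nat set"
    by (auto simp: flip2_def)
  have c_tog: "c (flip2 0 (N - 1) A) = c A" if "(0 \<in> A) \<noteq> (N - 1 \<in> A)" for A
  proof -
    have "bij_betw tg {x \<in> X. wd x = A} {x \<in> X. wd x = flip2 0 (N - 1) A}"
    proof (rule bij_betw_byWitness[where f' = tg])
      show "\<forall>x\<in>{x \<in> X. wd x = A}. tg (tg x) = x" using tog that by auto
      show "\<forall>x\<in>{x \<in> X. wd x = flip2 0 (N - 1) A}. tg (tg x) = x"
        using tog that by (auto simp: flip2_def)
      show "tg ` {x \<in> X. wd x = A} \<subseteq> {x \<in> X. wd x = flip2 0 (N - 1) A}"
        using tog that by auto
      have "tg x \<in> X \<and> wd (tg x) = A" if "x \<in> X" "wd x = flip2 0 (N - 1) A" for x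
      proof -
        have "(0 \<in> wd x) \<noteq> (N - 1 \<in> wd x)"
          using \<open>(0 \<in> A) \<noteq> (N - 1 \<in> A)\<close> that by (auto simp: flip2_def)
        then show ?thesis using tog[OF that(1)] that(2) flip_flip by metis
      qed
      then show "tg ` {x \<in> X. wd x = flip2 0 (N - 1) A} \<subseteq> {x \<in> X. wd x = A}" by auto
    qed
    then show ?thesis by (simp add: c_def bij_betw_same_card)
  qed
  have sub_flip: "flip2 i j A \<subseteq> {..<N}" if "A \<subseteq> {..<N}" "i < N" "j < N" for i j A
    using that by (auto simp: flip2_def)
  \<comment> \<open>Rotation moves the pair \<open>i, i + 1\<close> down by one and finally takes
    \<open>0, 1\<close> to \<open>N - 1, 0\<close>, where the toggle of the outer letters
    applies.\<close>
  have c_swap: "c (flip2 i (Suc i) A) = c A"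
    if "A \<subseteq> {..<N}" "Suc i < N" "(i \<in> A) \<noteq> (Suc i \<in> A)" for i A
    using that
  proof (induction i arbitrary: A)
    case 0
    have r: "rot N (flip2 0 (Suc 0) A) = flip2 0 (N - 1) (rot N A)"
    proof (rule Set.set_eqI)
      fix k show "k \<in> rot N (flip2 0 (Suc 0) A) \<longleftrightarrow> k \<in> flip2 0 (N - 1) (rot N A)"
        by (cases "k < N"; cases "Suc k = N")
          (use N in \<open>auto simp: mem_rot flip2_def dest: subsetD[OF rot_subset]\<close>)
    qed
    have "(0 \<in> rot N A) \<noteq> (N - 1 \<in> rot N A)"
      using 0 N by (auto simp: mem_rot)
    from c_tog[OF this] show ?case
      using r c_rot[OF 0(1)] c_rot[OF sub_flip[OF 0(1)], of 0 "Suc 0"] N by auto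
  next
    case (Suc i)
    have r: "rot N (flip2 (Suc i) (Suc (Suc i)) A) = flip2 i (Suc i) (rot N A)"
    proof (rule Set.set_eqI)
      fix k show "k \<in> rot N (flip2 (Suc i) (Suc (Suc i)) A) \<longleftrightarrow> k \<in> flip2 i (Suc i) (rot N A)"
        by (cases "k < N"; cases "Suc k = N")
          (use Suc.prems in \<open>auto simp: mem_rot flip2_def dest: subsetD[OF rot_subset]\<close>)
    qed
    have "(i \<in> rot N A) \<noteq> (Suc i \<in> rot N A)" using Suc.prems by (simp add: mem_rot)
    then have "c (flip2 i (Suc i) (rot N A)) = c (rot N A)"
      using Suc.prems by (intro Suc.IH) (auto simp: rot_subset)
    then show ?case
      using r c_rot[OF Suc.prems(1)] c_rot[OF sub_flip[OF Suc.prems(1)], of "Suc i" "Suc (Suc i)"]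
        Suc.prems(2) by simp
  qed
  \<comment> \<open>Bubble sort: moving a one to the left past a zero keeps the fibre size and
    lowers the sum of the positions, until the ones fill an initial segment.\<close>
  have c_initial: "c A = c {..<card A}" if "A \<subseteq> {..<N}" for A
    using that
  proof (induction "\<Sum>A" arbitrary: A rule: less_induct)
    case less
    have finA: "finite A" using less.prems finite_subset by blast
    show ?case
    proof (cases "\<exists>i. i \<notin> A \<and> Suc i \<in> A")
      case True
      then obtain i where i: "i \<notin> A" "Suc i \<in> A" by blast
      then have "Suc i < N" using less.prems by auto
      have fl: "flip2 i (Suc i) A = insert i (A - {Suc i})" using i by (auto simp: flip2_def)
      have "\<Sum>(flip2 i (Suc i) A) < \<Sum>A"
        unfolding fl using finA i by (simp add: sum.remove[of A "Suc i"])
      then have "c (flip2 i (Suc i) A) = c {..<card (flip2 i (Suc i) A)}"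
        using less.hyps sub_flip[OF less.prems] \<open>Suc i < N\<close> by simp
      then show ?thesis
        using c_swap[OF less.prems \<open>Suc i < N\<close>] i card_flip2[OF finA] by simp
    next
      case False
      have *: "i \<in> A" if "i \<le> j" "j \<in> A" for i j
        using that by (induction rule: inc_induct) (use False in auto)
      have "A = {..<card A}"
      proof (cases "A = {}")
        case False
        have "Max A \<in> A" using finA False by (rule Max_in)
        then have "{..Max A} \<subseteq> A" using * by (meson atMost_iff subsetI)
        moreover have "A \<subseteq> {..Max A}" using finA by (meson Max_ge atMost_iff subsetI)
        ultimately have "A = {..Max A}" by (rule subset_antisym[rotated])
        then show ?thesis by (metis card_atMost lessThan_Suc_atMost)
      qed simp
      then show ?thesis by simp
    qed
  qed
  have c_card: "c A = c B" if "A \<subseteq> {..<N}" "B \<subseteq> {..<N}" "card A = card B" for A B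
    using c_initial that by metis
  have c_pos: "x \<in> X \<Longrightarrow> c (wd x) > 0" for x
    using fin by (auto simp: c_def card_gt_0_iff)
  have c_E: "c E = 1"
  proof -
    have "{x \<in> X. wd x = E} = {x0}" using x0(1,2) x0(3)[OF _ disjI1[OF equalityD1]] by blast
    then show ?thesis by (simp add: c_def)
  qed
  have finN: "finite A" if "A \<subseteq> {..<N}" for A using that finite_subset by blast
  have cardE: "card (wd x) = card E" if x: "x \<in> X" for x
  proof -
    \<comment> \<open>Whatever the weight of \<open>wd x\<close>, some word of that weight is
      comparable with \<open>E\<close>. Its fibre is as large as that of \<open>wd x\<close>, hence
      nonempty, yet only \<open>x0\<close> has a word comparable with \<open>E\<close>.\<close>
    obtain A where A: "A \<subseteq> {..<N}" "A \<subseteq> E \<or> E \<subseteq> A" "card A = card (wd x)"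
    proof (cases "card (wd x) \<le> card E")
      case True
      then show ?thesis using that E by (meson obtain_subset_with_card_n order_trans)
    next
      case False
      then have "card E \<le> card (wd x)" "card (wd x) \<le> card {..<N}"
        using wd[OF x] by (auto simp del: card_lessThan intro: card_mono)
      then show ?thesis using that E exists_subset_between[of E "card (wd x)" "{..<N}"] by auto
    qed
    then have "c A > 0" using c_card[OF A(1) wd[OF x]] c_pos[OF x] by simp
    then obtain y where "y \<in> X" "wd y = A"
      by (auto simp: c_def card_gt_0_iff)
    then show ?thesis using x0 A by metis
  qed
  show ?thesis
    unfolding bij_betw_def
  proof
    show "inj_on wd X"
    proof (rule inj_onI)
      fix x y assume xy: "x \<in> X" "y \<in> X" "wd x = wd y"
      have "c (wd x) = 1" using c_card[OF wd[OF xy(1)] E cardE[OF xy(1)]] c_E by simp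
      then obtain z where "{u \<in> X. wd u = wd x} = {z}" by (auto simp: c_def card_1_singleton_iff)
      then have "x \<in> {z}" "y \<in> {z}" using xy by blast+
      then show "x = y" by simp
    qed
    show "wd ` X = {A. A \<subseteq> {..<N} \<and> card A = card E}"
    proof (intro subset_antisym subsetI)
      fix A assume A: "A \<in> {A. A \<subseteq> {..<N} \<and> card A = card E}"
      then have "c A > 0" using c_card[of A E] E c_E by simp
      then show "A \<in> wd ` X" by (auto simp: c_def card_gt_0_iff)
    qed (use wd cardE in auto)
  qed
qed

section \<open>Order ideals of the square\<close>

definition ideal_of :: "'a::order set \<Rightarrow> 'a set \<Rightarrow> 'a set" where
  "ideal_of P A = {x \<in> P. \<exists>y\<in>A. x \<le> y}"

definition is_antichain :: "'a::order set \<Rightarrow> bool" where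
  "is_antichain A \<longleftrightarrow> (\<forall>x\<in>A. \<forall>y\<in>A. x \<le> y \<longrightarrow> x = y)"

lemma is_antichain_maximal_elements: "is_antichain (maximal_elements I)"
  by (auto simp: is_antichain_def maximal_elements_def)

lemma maximal_elements_ideal_of:
  assumes "is_antichain A" "A \<subseteq> P"
  shows "maximal_elements (ideal_of P A) = A"
proof (intro subset_antisym subsetI)
  fix x assume "x \<in> maximal_elements (ideal_of P A)"
  then obtain y where y: "x \<in> P" "y \<in> A" "x \<le> y" "\<not> (\<exists>z\<in>ideal_of P A. x < z)"
    by (auto simp: maximal_elements_def ideal_of_def)
  then have "y \<in> ideal_of P A" using assms by (auto simp: ideal_of_def)
  then show "x \<in> A" using y by (metis order_le_less)
next
  fix x assume x: "x \<in> A"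
  have False if "y \<in> A" "z \<le> y" "x < z" for y z
    using that x assms(1) unfolding is_antichain_def by (metis leD less_le_trans order_less_imp_le)
  then show "x \<in> maximal_elements (ideal_of P A)"
    using x assms(2) by (auto simp: maximal_elements_def ideal_of_def)
qed

lemma exists_maximal_above:
  fixes P :: "'a::order set"
  assumes "finite I" "x \<in> I"
  shows "\<exists>y\<in>maximal_elements I. x \<le> y"
proof -
  obtain y where "y \<in> I" "x \<le> y" "\<forall>z\<in>I. y \<le> z \<longrightarrow> y = z"
    using finite_has_maximal2[OF assms] by metis
  then show ?thesis by (intro bexI[of _ y]) (auto simp: maximal_elements_def)
qed

lemma ideal_of_maximal_elements:
  assumes "finite P" "I \<in> order_ideals P"
  shows "ideal_of P (maximal_elements I) = I"
proof (intro subset_antisym subsetI)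
  fix x assume "x \<in> I"
  moreover have "finite I" using assms by (auto simp: order_ideals_def intro: finite_subset)
  ultimately show "x \<in> ideal_of P (maximal_elements I)"
    using assms exists_maximal_above[of I x] by (auto simp: ideal_of_def order_ideals_def)
qed (use assms in \<open>auto simp: ideal_of_def order_ideals_def maximal_elements_def\<close>)

lemma ideal_of_in_order_ideals: "ideal_of P A \<in> order_ideals P"
  by (auto simp: ideal_of_def order_ideals_def intro: order_trans)

lemma ideal_row_in_order_ideals: "ideal_row P I \<in> order_ideals P"
  by (auto simp: ideal_row_def order_ideals_def intro: order_trans)

lemma maximal_elements_subset: "I \<in> order_ideals P \<Longrightarrow> maximal_elements I \<subseteq> P"
  by (auto simp: order_ideals_def maximal_elements_def)

text \<open>The maximal elements of \<open>I\<close> are the minimal elements of the complement of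
  its image, so the image determines them.\<close>

lemma inj_on_ideal_row:
  assumes "finite P"
  shows "inj_on (ideal_row P) (order_ideals P)"
proof (rule inj_onI)
  fix I J assume IJ: "I \<in> order_ideals P" "J \<in> order_ideals P" "ideal_row P I = ideal_row P J"
  have sub: "maximal_elements I \<subseteq> maximal_elements J"
    if IJ: "I \<in> order_ideals P" "J \<in> order_ideals P" "ideal_row P I = ideal_row P J" for I J
  proof
    fix x assume x: "x \<in> maximal_elements I"
    have "x \<notin> ideal_row P J" using x IJ(3) by (auto simp: ideal_row_def)
    then obtain y where y: "y \<in> maximal_elements J" "y \<le> x"
      using x maximal_elements_subset[OF IJ(1)] by (auto simp: ideal_row_def)
    then have "y \<notin> ideal_row P I" using IJ(3) by (auto simp: ideal_row_def)
    then obtain z where z: "z \<in> maximal_elements I" "z \<le> y"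
      using y maximal_elements_subset[OF IJ(2)] by (auto simp: ideal_row_def)
    have "z = x" using is_antichain_maximal_elements[of I] x y z
      by (meson is_antichain_def order_trans)
    then show "x \<in> maximal_elements J" using y z by auto
  qed
  have "maximal_elements I = maximal_elements J"
    using sub IJ by (intro subset_antisym) simp_all
  then show "I = J" using ideal_of_maximal_elements[OF assms] IJ by metis
qed

text \<open>Rows and columns count from \<open>1\<close>, letters from \<open>0\<close>: row
  \<open>i\<close> is letter \<open>i - 1\<close> and column \<open>j\<close> is letter
  \<open>n + j - 1\<close>.\<close>

definition ideal_word :: "nat \<Rightarrow> (nat \<times> nat) set \<Rightarrow> nat set" where
  "ideal_word n I = {k. k < n \<and> Suc k \<in> fst ` maximal_elements I} \<union>
     {k. n \<le> k \<and> k < 2 * n \<and> Suc (k - n) \<notin> snd ` maximal_elements I}"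

lemma finite_square_poset: "finite (square_poset n)"
  by (simp add: square_poset_def)

text \<open>Some maximal element lies above \<open>(i, j)\<close>, and the last hypothesis keeps it
  in row \<open>i\<close>.\<close>

lemma maximal_in_row:
  assumes I: "I \<in> order_ideals (square_poset n)" and "(i, j) \<in> I"
    and above: "\<And>i' j'. i < i' \<Longrightarrow> j \<le> j' \<Longrightarrow> (i', j') \<notin> I"
  shows "i \<in> fst ` maximal_elements I"
proof -
  have "finite I" using I finite_square_poset by (auto simp: order_ideals_def intro: finite_subset)
  then obtain y where y: "y \<in> maximal_elements I" "(i, j) \<le> y"
    using exists_maximal_above assms(2) by blast
  then have "\<not> i < fst y" "i \<le> fst y"
    using above[of "fst y" "snd y"] by (auto simp: maximal_elements_def less_eq_prod_def)
  then have "fst y = i" by simp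
  then show ?thesis using y by force
qed

lemma maximal_in_col:
  assumes I: "I \<in> order_ideals (square_poset n)" and "(i, j) \<in> I"
    and above: "\<And>i' j'. i \<le> i' \<Longrightarrow> j < j' \<Longrightarrow> (i', j') \<notin> I"
  shows "j \<in> snd ` maximal_elements I"
proof -
  have "finite I" using I finite_square_poset by (auto simp: order_ideals_def intro: finite_subset)
  then obtain y where y: "y \<in> maximal_elements I" "(i, j) \<le> y"
    using exists_maximal_above assms(2) by blast
  then have "\<not> j < snd y" "j \<le> snd y"
    using above[of "fst y" "snd y"] by (auto simp: maximal_elements_def less_eq_prod_def)
  then have "snd y = j" by simp
  then show ?thesis using y by force
qed

text \<open>The complement of the new ideal is generated by the old maximal elements. A new maximal
  \<open>(i, j)\<close> with \<open>i < n\<close> is blocked at \<open>(i + 1, j)\<close> by an old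
  one, which must lie in row \<open>i + 1\<close>; conversely \<open>(i, c)\<close> is free below an
  old \<open>(i + 1, c)\<close>. Row \<open>n\<close> meets the new ideal iff \<open>(n, 1)\<close>
  belongs to it, that is, iff column \<open>1\<close> has no old maximal element.\<close>

lemma rows_ideal_row:
  assumes I: "I \<in> order_ideals (square_poset n)" and i: "1 \<le> i" "i \<le> n"
  shows "i \<in> fst ` maximal_elements (ideal_row (square_poset n) I) \<longleftrightarrow>
    (if i < n then Suc i \<in> fst ` maximal_elements I else 1 \<notin> snd ` maximal_elements I)"
proof -
  let ?G = "ideal_row (square_poset n) I" and ?A = "maximal_elements I"
  note G = ideal_row_in_order_ideals[of "square_poset n" I]
  have A: "?A \<subseteq> {1..n} \<times> {1..n}"
    using maximal_elements_subset[OF I] by (simp add: square_poset_def)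
  have anti: "a \<le> c \<Longrightarrow> b \<le> d \<Longrightarrow> (a, b) = (c, d)" if "(a, b) \<in> ?A" "(c, d) \<in> ?A" for a b c d
    using is_antichain_maximal_elements[of I] that unfolding is_antichain_def by fastforce
  have memG: "(a, b) \<in> ?G \<longleftrightarrow> 1 \<le> a \<and> a \<le> n \<and> 1 \<le> b \<and> b \<le> n \<and> (\<forall>r c. (r, c) \<in> ?A \<longrightarrow> r \<le> a \<longrightarrow> \<not> c \<le> b)" for a b
    by (auto simp: ideal_row_def square_poset_def)
  show ?thesis
  proof (cases "i < n")
    case True
    have "Suc i \<in> fst ` ?A" if "(i, j) \<in> maximal_elements ?G" for j
    proof -
      have ij: "(i, j) \<in> ?G" using that by (auto simp: maximal_elements_def)
      have "(i, j) < (Suc i, j)" by (simp add: less_prod_def)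
      then have "(Suc i, j) \<notin> ?G" using that unfolding maximal_elements_def by blast
      then obtain r c where "(r, c) \<in> ?A" "r \<le> Suc i" "c \<le> j"
        using ij True unfolding memG by auto
      moreover have "\<not> r \<le> i" using ij calculation unfolding memG by auto
      ultimately show ?thesis by (metis fst_conv image_eqI le_Suc_eq)
    qed
    moreover have "i \<in> fst ` maximal_elements ?G" if "(Suc i, c) \<in> ?A" for c
    proof (rule maximal_in_row[OF G])
      have "\<not> c' \<le> c" if "(r, c') \<in> ?A" "r \<le> i" for r c'
        using anti[OF that(1) \<open>(Suc i, c) \<in> ?A\<close>] that by auto
      then show "(i, c) \<in> ?G" using i True that A unfolding memG by auto
      show "(i', j') \<notin> ?G" if "i < i'" "c \<le> j'" for i' j'
        using that \<open>(Suc i, c) \<in> ?A\<close> unfolding memG by (metis Suc_leI less_imp_le)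
    qed
    ultimately show ?thesis using True by auto
  next
    case False
    then have "i = n" using i by simp
    have "1 \<notin> snd ` ?A" if "(n, j) \<in> maximal_elements ?G" for j
    proof
      assume "1 \<in> snd ` ?A"
      then obtain r where "(r, 1) \<in> ?A" by force
      moreover have "(n, j) \<in> ?G" using that by (auto simp: maximal_elements_def)
      ultimately show False using A unfolding memG by fastforce
    qed
    moreover have "n \<in> fst ` maximal_elements ?G" if "1 \<notin> snd ` ?A"
    proof (rule maximal_in_row[OF G])
      have "c \<noteq> 1" "1 \<le> c" if "(r, c) \<in> ?A" for r c
        using \<open>1 \<notin> snd ` ?A\<close> A that by force+
      then show "(n, 1) \<in> ?G" using i unfolding memG by force
      show "(i', j') \<notin> ?G" if "n < i'" "1 \<le> j'" for i' j' using that unfolding memG by auto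
    qed
    ultimately show ?thesis using False \<open>i = n\<close> by (metis imageE prod.collapse)
  qed
qed

text \<open>The same argument transposed. Row \<open>n\<close> is decided by column \<open>1\<close>
  and column \<open>n\<close> by row \<open>1\<close>, both negated; storing the columns negated
  turns both boundary cases into a plain shift.\<close>

lemma cols_ideal_row:
  assumes I: "I \<in> order_ideals (square_poset n)" and i: "1 \<le> j" "j \<le> n"
  shows "j \<in> snd ` maximal_elements (ideal_row (square_poset n) I) \<longleftrightarrow>
    (if j < n then Suc j \<in> snd ` maximal_elements I else 1 \<notin> fst ` maximal_elements I)"
proof -
  let ?G = "ideal_row (square_poset n) I" and ?A = "maximal_elements I"
  note G = ideal_row_in_order_ideals[of "square_poset n" I]
  have A: "?A \<subseteq> {1..n} \<times> {1..n}"
    using maximal_elements_subset[OF I] by (simp add: square_poset_def)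
  have anti: "a \<le> c \<Longrightarrow> b \<le> d \<Longrightarrow> (a, b) = (c, d)" if "(a, b) \<in> ?A" "(c, d) \<in> ?A" for a b c d
    using is_antichain_maximal_elements[of I] that unfolding is_antichain_def by fastforce
  have memG: "(a, b) \<in> ?G \<longleftrightarrow> 1 \<le> a \<and> a \<le> n \<and> 1 \<le> b \<and> b \<le> n \<and> (\<forall>r c. (r, c) \<in> ?A \<longrightarrow> r \<le> a \<longrightarrow> \<not> c \<le> b)" for a b
    by (auto simp: ideal_row_def square_poset_def)
  show ?thesis
  proof (cases "j < n")
    case True
    have "Suc j \<in> snd ` ?A" if "(i, j) \<in> maximal_elements ?G" for i
    proof -
      have ij: "(i, j) \<in> ?G" using that by (auto simp: maximal_elements_def)
      have "(i, j) < (i, Suc j)" by (simp add: less_prod_def)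
      then have "(i, Suc j) \<notin> ?G" using that unfolding maximal_elements_def by blast
      then obtain r c where "(r, c) \<in> ?A" "r \<le> i" "c \<le> Suc j"
        using ij True unfolding memG by auto
      moreover have "\<not> c \<le> j" using ij calculation unfolding memG by auto
      ultimately show ?thesis by (metis snd_conv image_eqI le_Suc_eq)
    qed
    moreover have "j \<in> snd ` maximal_elements ?G" if "(r, Suc j) \<in> ?A" for r
    proof (rule maximal_in_col[OF G])
      have "\<not> r' \<le> r" if "(r', c) \<in> ?A" "c \<le> j" for r' c
        using anti[OF that(1) \<open>(r, Suc j) \<in> ?A\<close>] that by auto
      then show "(r, j) \<in> ?G" using i True that A unfolding memG by auto
      show "(i', j') \<notin> ?G" if "r \<le> i'" "j < j'" for i' j'
        using that \<open>(r, Suc j) \<in> ?A\<close> unfolding memG by (metis Suc_leI less_imp_le)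
    qed
    ultimately show ?thesis using True by auto
  next
    case False
    then have "j = n" using i by simp
    have "1 \<notin> fst ` ?A" if "(i, n) \<in> maximal_elements ?G" for i
    proof
      assume "1 \<in> fst ` ?A"
      then obtain c where "(1, c) \<in> ?A" by force
      moreover have "(i, n) \<in> ?G" using that by (auto simp: maximal_elements_def)
      ultimately show False using A unfolding memG by fastforce
    qed
    moreover have "n \<in> snd ` maximal_elements ?G" if "1 \<notin> fst ` ?A"
    proof (rule maximal_in_col[OF G])
      have "r \<noteq> 1" "1 \<le> r" if "(r, c) \<in> ?A" for r c
        using \<open>1 \<notin> fst ` ?A\<close> A that by force+
      then show "(1, n) \<in> ?G" using i unfolding memG by force
      show "(i', j') \<notin> ?G" if "1 \<le> i'" "n < j'" for i' j' using that unfolding memG by auto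
    qed
    ultimately show ?thesis using False \<open>j = n\<close> by (metis imageE prod.collapse)
  qed
qed

text \<open>The corner \<open>(1, n)\<close> carries the first letter (row \<open>1\<close>) and the
  last one (column \<open>n\<close>) at once.\<close>

definition toggle_corner :: "nat \<Rightarrow> (nat \<times> nat) set \<Rightarrow> (nat \<times> nat) set" where
  "toggle_corner n I = ideal_of (square_poset n)
     (if (1, n) \<in> maximal_elements I then maximal_elements I - {(1, n)} else insert (1, n) (maximal_elements I))"

lemma bij_betw_ideal_word:
  assumes "n \<ge> 1"
  shows "bij_betw (ideal_word n) (order_ideals (square_poset n)) {A. A \<subseteq> {..<2 * n} \<and> card A = n}"
    and "I \<in> order_ideals (square_poset n) \<Longrightarrow>
      ideal_word n (ideal_row (square_poset n) I) = rot (2 * n) (ideal_word n I)"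
proof -
  let ?P = "square_poset n"
  let ?f = "ideal_row ?P"
  have fin: "finite (order_ideals ?P)"
    by (rule finite_subset[of _ "Pow ?P"]) (auto simp: order_ideals_def finite_square_poset)
  have bij: "bij_betw ?f (order_ideals ?P) (order_ideals ?P)"
    using inj_on_ideal_row[OF finite_square_poset] ideal_row_in_order_ideals fin
    by (metis (no_types, lifting) bij_betw_def endo_inj_surj image_subsetI)
  have sub: "ideal_word n I \<subseteq> {..<2 * n}" for I by (auto simp: ideal_word_def)
  have rot: "ideal_word n (?f I) = rot (2 * n) (ideal_word n I)" if I: "I \<in> order_ideals ?P" for I
  proof (rule Set.set_eqI)
    fix k
    consider "k \<ge> 2 * n" | "Suc k < n" | "Suc k = n" | "n \<le> k" "Suc k < 2 * n" | "n \<le> k" "Suc k = 2 * n"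
      by linarith
    then show "k \<in> ideal_word n (?f I) \<longleftrightarrow> k \<in> rot (2 * n) (ideal_word n I)"
    proof cases
      case 1
      then show ?thesis using sub rot_subset by (meson lessThan_iff linorder_not_le subset_iff)
    next
      case 2
      then show ?thesis using rows_ideal_row[OF I, of "Suc k"] by (simp add: mem_rot ideal_word_def)
    next
      case 3
      then show ?thesis using rows_ideal_row[OF I, of "Suc k"] by (simp add: mem_rot ideal_word_def)
    next
      case 4
      then have "Suc (k - n) < n" by linarith
      then show ?thesis using 4 cols_ideal_row[OF I, of "Suc (k - n)"]
        by (simp add: mem_rot ideal_word_def Suc_diff_le)
    next
      case 5
      then have "Suc (k - n) = n" by linarith
      then show ?thesis using 5 cols_ideal_row[OF I, of "Suc (k - n)"]
        by (simp add: mem_rot ideal_word_def)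
    qed
  qed
  then show "I \<in> order_ideals ?P \<Longrightarrow> ideal_word n (?f I) = rot (2 * n) (ideal_word n I)" for I .
  have x0: "{} \<in> order_ideals ?P" "ideal_word n {} = {n..<2 * n}"
    by (auto simp: order_ideals_def ideal_word_def maximal_elements_def)
  \<comment> \<open>A maximal element \<open>(i, j)\<close> puts a one at \<open>i - 1\<close> and a
    zero at \<open>n + j - 1\<close>, so the word is incomparable with that of the empty
    ideal.\<close>
  have base: "I = {}" if I: "I \<in> order_ideals ?P" and "ideal_word n I \<subseteq> {n..<2 * n} \<or> {n..<2 * n} \<subseteq> ideal_word n I" for I
  proof -
    have "maximal_elements I = {}"
    proof (rule ccontr)
      assume "maximal_elements I \<noteq> {}"
      then obtain i j where ij: "(i, j) \<in> maximal_elements I" by auto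
      then have bounds: "1 \<le> i" "i \<le> n" "1 \<le> j" "j \<le> n"
        using maximal_elements_subset[OF I] by (auto simp: square_poset_def)
      have "i - 1 \<in> ideal_word n I" using ij bounds by (force simp: ideal_word_def)
      moreover have "i - 1 \<notin> {n..<2 * n}" using bounds by simp
      moreover have "n + j - 1 \<notin> ideal_word n I" using ij bounds by (force simp: ideal_word_def)
      moreover have "n + j - 1 \<in> {n..<2 * n}"
        using bounds unfolding atLeastLessThan_iff by linarith
      ultimately show False using that(2) by blast
    qed
    then show ?thesis using ideal_of_maximal_elements[OF finite_square_poset I] by (simp add: ideal_of_def)
  qed
  have tog: "toggle_corner n I \<in> order_ideals ?P \<and> ideal_word n (toggle_corner n I) = flip2 0 (2 * n - 1) (ideal_word n I) \<and>
      toggle_corner n (toggle_corner n I) = I"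
    if I: "I \<in> order_ideals ?P" and ne: "(0 \<in> ideal_word n I) \<noteq> (2 * n - 1 \<in> ideal_word n I)" for I
  proof -
    let ?A = "maximal_elements I"
    define B where "B = (if (1, n) \<in> ?A then ?A - {(1, n)} else insert (1, n) ?A)"
    have A: "?A \<subseteq> {1..n} \<times> {1..n}"
      using maximal_elements_subset[OF I] by (simp add: square_poset_def)
    have anti: "a \<le> c \<Longrightarrow> b \<le> d \<Longrightarrow> (a, b) = (c, d)" if "(a, b) \<in> ?A" "(c, d) \<in> ?A" for a b c d
      using is_antichain_maximal_elements[of I] that unfolding is_antichain_def by fastforce
    have "Suc (2 * n - 1 - n) = n" "\<not> 2 * n - 1 < n" "n \<le> 2 * n - 1" using assms by simp_all
    \<comment> \<open>Columns are stored negated, so differing outer letters mean that row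
      \<open>1\<close> and column \<open>n\<close> are both occupied or both free.\<close>
    then have ne': "(1 \<in> fst ` ?A) = (n \<in> snd ` ?A)"
      using ne assms by (simp add: ideal_word_def)
    \<comment> \<open>In the square \<open>(1, c) \<le> (d, n)\<close> always holds, so in an
      antichain two such elements coincide and are the corner.\<close>
    have corner: "a = 1 \<or> b = n \<Longrightarrow> (1, n) \<in> ?A" if "(a, b) \<in> ?A" for a b
    proof -
      assume "a = 1 \<or> b = n"
      then have "1 \<in> fst ` ?A \<or> n \<in> snd ` ?A" using that by force
      then obtain c d where cd: "(1, c) \<in> ?A" "(d, n) \<in> ?A" using ne' by force
      then have "1 \<le> d" "c \<le> n" using A by auto
      then show ?thesis using anti[OF cd] cd by auto
    qed
    have only: "(a, b) \<in> ?A \<Longrightarrow> a = 1 \<or> b = n \<Longrightarrow> (a, b) = (1, n)" for a b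
    proof -
      assume ab: "(a, b) \<in> ?A" "a = 1 \<or> b = n"
      then have *: "(1, n) \<in> ?A" using corner by blast
      have "1 \<le> a" "b \<le> n" using ab A by auto
      then show ?thesis using anti[OF ab(1) *] anti[OF * ab(1)] ab(2) by auto
    qed
    have B_sub: "B \<subseteq> ?P" using A assms by (auto simp: B_def square_poset_def)
    \<comment> \<open>Anything comparable with the corner lies in row \<open>1\<close> or column
      \<open>n\<close>, so it is the corner itself.\<close>
    have B_anti: "is_antichain B"
    proof -
      have "(a, b) = (1, n)" if "(a, b) \<in> ?A" "(1, n) \<le> (a, b) \<or> (a, b) \<le> (1, n)" for a b
      proof -
        have "1 \<le> a" "b \<le> n" using that A by auto
        then have "a = 1 \<or> b = n" using that by auto
        then show ?thesis using only[OF that(1)] by metis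
      qed
      then have "p = (1, n)" if "p \<in> ?A" "(1, n) \<le> p \<or> p \<le> (1, n)" for p
        using that by (metis surj_pair)
      then show ?thesis
        using is_antichain_maximal_elements[of I] unfolding is_antichain_def B_def
        by (cases "(1, n) \<in> ?A") (simp_all only: if_True if_False simp_thms, blast+)
    qed
    have max_B: "maximal_elements (toggle_corner n I) = B"
      using maximal_elements_ideal_of[OF B_anti B_sub] by (simp add: toggle_corner_def B_def)
    have "toggle_corner n (toggle_corner n I) = ideal_of ?P (if (1, n) \<in> B then B - {(1, n)} else insert (1, n) B)"
      by (simp add: toggle_corner_def[of n "toggle_corner n I"] max_B)
    also have "(if (1, n) \<in> B then B - {(1, n)} else insert (1, n) B) = ?A"
      by (auto simp: B_def)
    finally have inv: "toggle_corner n (toggle_corner n I) = I"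
      using ideal_of_maximal_elements[OF finite_square_poset I] by simp
    have only1: "\<And>b. (1, b) \<in> ?A \<Longrightarrow> b = n" and only2: "\<And>a. (a, n) \<in> ?A \<Longrightarrow> a = 1"
      using only by blast+
    have fst_iff: "\<And>i. i \<in> fst ` S \<longleftrightarrow> (\<exists>b. (i, b) \<in> S)"
      and snd_iff: "\<And>i. i \<in> snd ` S \<longleftrightarrow> (\<exists>a. (a, i) \<in> S)" for S :: "(nat \<times> nat) set"
      by force+
    have fstB: "i \<in> fst ` B \<longleftrightarrow> (i \<in> fst ` ?A) \<noteq> (i = 1)" for i
    proof (cases "i = 1")
      case True
      then show ?thesis unfolding fst_iff B_def
        by (cases "(1, n) \<in> ?A") (simp_all only: if_True if_False, use only1 in blast, use only1 in blast)
    qed (auto simp: fst_iff B_def)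
    have sndB: "i \<in> snd ` B \<longleftrightarrow> (i \<in> snd ` ?A) \<noteq> (i = n)" for i
    proof (cases "i = n")
      case True
      then show ?thesis unfolding snd_iff B_def
        by (cases "(1, n) \<in> ?A") (simp_all only: if_True if_False, use only2 in blast, use only2 in blast)
    qed (auto simp: snd_iff B_def)
    have "ideal_word n (toggle_corner n I) = flip2 0 (2 * n - 1) (ideal_word n I)"
    proof (rule Set.set_eqI)
      fix k
      consider "k < n" | "n \<le> k" "k < 2 * n" | "k \<ge> 2 * n" by linarith
      then show "k \<in> ideal_word n (toggle_corner n I) \<longleftrightarrow> k \<in> flip2 0 (2 * n - 1) (ideal_word n I)"
      proof cases
        case 1
        then have "k \<noteq> 2 * n - 1" by simp
        then show ?thesis using 1 by (simp add: ideal_word_def max_B flip2_def fstB)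
      next
        case 2
        then have "Suc (k - n) = n \<longleftrightarrow> k = 2 * n - 1" by auto
        then show ?thesis using 2 assms by (auto simp add: ideal_word_def max_B flip2_def sndB)
      next
        case 3
        then show ?thesis using assms by (simp add: ideal_word_def flip2_def)
      qed
    qed
    then show ?thesis using inv by (simp add: toggle_corner_def ideal_of_in_order_ideals)
  qed
  have "bij_betw (ideal_word n) (order_ideals ?P) {A. A \<subseteq> {..<2 * n} \<and> card A = card {n..<2 * n}}"
    by (rule bij_betw_words[OF fin bij _ sub rot tog x0 base]) (use assms in auto)
  then show "bij_betw (ideal_word n) (order_ideals ?P) {A. A \<subseteq> {..<2 * n} \<and> card A = n}"
    by simp
qed

section \<open>Position functions and arcs\<close>

text \<open>
  A permutation is represented by the map \<open>s\<close> from values to positions, up to order; \<open>neg s\<close> is the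
  reversed permutation, which swaps the roles of joins and meets. The arc \<open>(a, b, e)\<close> leaves a
  number \<open>c\<close> with \<open>a < c < b\<close> on its left iff \<open>even c = e\<close>; when \<open>b = a + 1\<close> both values of \<open>e\<close>
  describe the same arc. \<open>above_arc s a b e\<close> says that \<open>s\<close> lies above the join-irreducible of the arc, and
  \<open>above_arc (neg s) a b (\<not> e)\<close> that it lies below the meet-irreducible.
\<close>
definition neg :: "(nat \<Rightarrow> int) \<Rightarrow> nat \<Rightarrow> int" where
  "neg s = (\<lambda>x. - s x)"

definition adj :: "nat \<Rightarrow> (nat \<Rightarrow> int) \<Rightarrow> nat \<Rightarrow> nat \<Rightarrow> bool" where
  "adj n s x y \<longleftrightarrow> x \<in> {1..n+1} \<and> y \<in> {1..n+1} \<and> s x < s y \<and>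
     (\<forall>z\<in>{1..n+1}. \<not> (s x < s z \<and> s z < s y))"

definition weak_le :: "nat \<Rightarrow> (nat \<Rightarrow> int) \<Rightarrow> (nat \<Rightarrow> int) \<Rightarrow> bool" where
  "weak_le n s t \<longleftrightarrow> (\<forall>i\<in>{1..n+1}. \<forall>j\<in>{1..n+1}. i < j \<longrightarrow> s j < s i \<longrightarrow> t j < t i)"

definition above_arc :: "(nat \<Rightarrow> int) \<Rightarrow> nat \<Rightarrow> nat \<Rightarrow> bool \<Rightarrow> bool" where
  "above_arc s a b e \<longleftrightarrow> (\<forall>x y. a \<le> x \<and> x < y \<and> y \<le> b \<and> (x = a \<or> even x \<noteq> e) \<and> (y = b \<or> even y = e)
     \<longrightarrow> s y < s x)"

definition desc :: "nat \<Rightarrow> (nat \<Rightarrow> int) \<Rightarrow> nat \<Rightarrow> nat \<Rightarrow> bool \<Rightarrow> bool" where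
  "desc n s a b e \<longleftrightarrow> a < b \<and> adj n s b a \<and> (\<forall>c. a < c \<and> c < b \<longrightarrow> (s c < s b \<longleftrightarrow> even c = e))"

text \<open>Every descent runs along an arc that survives the congruence. These functions describe
  the class minima, and those with \<open>good n (neg s)\<close> serve as class maxima.\<close>

definition good :: "nat \<Rightarrow> (nat \<Rightarrow> int) \<Rightarrow> bool" where
  "good n s \<longleftrightarrow> (\<forall>a b. a < b \<and> adj n s b a \<longrightarrow> (\<exists>e. desc n s a b e))"

lemma neg_neg [simp]: "neg (neg s) = s"
  by (simp add: neg_def)

lemma neg_apply: "neg s x = - s x"
  by (simp add: neg_def)

lemma inj_on_neg [simp]: "inj_on (neg s) A \<longleftrightarrow> inj_on s A"
  by (simp add: neg_def inj_on_def)

lemma adj_neg: "adj n (neg s) x y \<longleftrightarrow> adj n s y x"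
  by (auto simp: adj_def neg_def)

lemma weak_le_neg:
  assumes "inj_on s {1..n+1}" "inj_on t {1..n+1}"
  shows "weak_le n (neg s) (neg t) \<longleftrightarrow> weak_le n t s"
proof -
  have ne: "s i \<noteq> s j" "t i \<noteq> t j" if "i \<in> {1..n+1}" "j \<in> {1..n+1}" "i < j" for i j
    using assms that unfolding inj_on_def by (metis less_irrefl)+
  show ?thesis unfolding weak_le_def neg_def
    by (smt (verit) ne)
qed

lemma weak_le_trans: "weak_le n s t \<Longrightarrow> weak_le n t u \<Longrightarrow> weak_le n s u"
  by (simp add: weak_le_def)

lemma above_arc_mono:
  assumes "weak_le n s t" "1 \<le> a" "b \<le> n + 1" "above_arc s a b e"
  shows "above_arc t a b e"
  unfolding above_arc_def
proof (intro allI impI)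
  fix x y assume *: "a \<le> x \<and> x < y \<and> y \<le> b \<and> (x = a \<or> even x \<noteq> e) \<and> (y = b \<or> even y = e)"
  then have "s y < s x" using assms(4) by (simp add: above_arc_def)
  moreover have "x \<in> {1..n+1}" "y \<in> {1..n+1}" using * assms by auto
  ultimately show "t y < t x" using assms(1) * by (simp add: weak_le_def)
qed

lemma above_arcD:
  "above_arc s a b e \<Longrightarrow> a \<le> x \<Longrightarrow> x < y \<Longrightarrow> y \<le> b \<Longrightarrow> x = a \<or> even x \<noteq> e \<Longrightarrow> y = b \<or> even y = e \<Longrightarrow> s y < s x"
  by (simp add: above_arc_def)

lemma desc_bounds: "desc n s a b e \<Longrightarrow> 1 \<le> a \<and> a < b \<and> b \<le> n + 1"
  by (auto simp: desc_def adj_def)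

lemma adjD:
  assumes "adj n s x y" "inj_on s {1..n+1}" "z \<in> {1..n+1}" "z \<noteq> x" "z \<noteq> y"
  shows "s z < s x \<or> s y < s z"
proof -
  have "s z \<noteq> s x" "s z \<noteq> s y" using assms by (auto simp: adj_def inj_on_def)
  then show ?thesis using assms(1,3) unfolding adj_def by (metis linorder_less_linear)
qed

lemma desc_right:
  assumes "desc n s a b e" "inj_on s {1..n+1}" "a < c" "c < b" "even c \<noteq> e"
  shows "s a < s c"
proof -
  have "\<not> s c < s b" using assms by (simp add: desc_def)
  moreover have "c \<in> {1..n+1}" using desc_bounds[OF assms(1)] assms by auto
  ultimately show ?thesis
    using adjD[of n s b a c] assms by (simp add: desc_def)
qed

lemma desc_left:
  assumes "desc n s a b e" "a < c" "c < b" "even c = e"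
  shows "s c < s b"
  using assms by (simp add: desc_def)

text \<open>Numbers left of the arc stand before \<open>b\<close>, those right of it after
  \<open>a\<close>, and \<open>b\<close> stands before \<open>a\<close>.\<close>

lemma desc_above_arc:
  assumes "desc n s a b e" "inj_on s {1..n+1}"
  shows "above_arc s a b e"
  unfolding above_arc_def
proof (intro allI impI)
  fix x y assume *: "a \<le> x \<and> x < y \<and> y \<le> b \<and> (x = a \<or> even x \<noteq> e) \<and> (y = b \<or> even y = e)"
  have "s y \<le> s b"
    using * desc_left[OF assms(1), of y] by (cases "y = b") auto
  moreover have "s b < s a" using assms(1) by (simp add: desc_def adj_def)
  moreover have "s a \<le> s x"
    using * desc_right[OF assms, of x] by (cases "x = a") auto
  ultimately show "s y < s x" by linarith
qed

text \<open>Reading by position from \<open>y\<close> to \<open>x\<close>, take for \<open>b\<close>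
  the last value before \<open>x\<close> with property \<open>P\<close> and for \<open>a\<close> its
  immediate successor.\<close>

lemma last_crossing:
  assumes inj: "inj_on s {1..n+1}" and "x \<in> {1..n+1}" "y \<in> {1..n+1}" "s y < s x" "P y" "\<not> P x"
  shows "\<exists>b a. adj n s b a \<and> P b \<and> \<not> P a \<and> s y \<le> s b \<and> s a \<le> s x \<and>
    (\<forall>z\<in>{1..n+1}. s b < s z \<and> s z \<le> s x \<longrightarrow> \<not> P z)"
proof -
  let ?B = "{z \<in> {1..n+1}. P z \<and> s y \<le> s z \<and> s z < s x}"
  have "finite ?B" "y \<in> ?B" using assms by auto
  then obtain b where b: "b \<in> ?B" "\<And>z. z \<in> ?B \<Longrightarrow> s z \<le> s b"
    using ex_is_arg_min_if_finite[of ?B "\<lambda>z. - s z"] unfolding is_arg_min_linorder by auto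
  let ?A = "{z \<in> {1..n+1}. s b < s z \<and> s z \<le> s x}"
  have "finite ?A" "x \<in> ?A" using assms b by auto
  then obtain a where a: "a \<in> ?A" "\<And>z. z \<in> ?A \<Longrightarrow> s a \<le> s z"
    using ex_is_arg_min_if_finite[of ?A s] unfolding is_arg_min_linorder by auto
  have nP: "\<not> P z" if "z \<in> {1..n+1}" "s b < s z" "s z \<le> s x" for z
  proof
    assume "P z"
    then have "z \<noteq> x" using assms by auto
    then have "s z < s x" using that inj assms(2) by (metis inj_on_def order_le_less)
    then have "z \<in> ?B" using that \<open>P z\<close> b by auto
    then show False using b(2) that by fastforce
  qed
  have "adj n s b a"
    using a b unfolding adj_def by force
  then show ?thesis using a b nP by blast
qed

lemma first_crossing:
  assumes inj: "inj_on s {1..n+1}" and "x \<in> {1..n+1}" "y \<in> {1..n+1}" "s y < s x" "P y" "\<not> P x"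
  shows "\<exists>b a. adj n s b a \<and> P b \<and> \<not> P a \<and> s y \<le> s b \<and> s a \<le> s x \<and>
    (\<forall>z\<in>{1..n+1}. s y \<le> s z \<and> s z < s a \<longrightarrow> P z)"
  using last_crossing[of "neg s" n y x "\<lambda>z. \<not> P z"] assms
  by (auto simp: adj_neg neg_apply)

lemma less_of_adj_less:
  assumes inj: "inj_on s {1..n+1}" and adj: "\<And>x y. adj n s x y \<Longrightarrow> t x < t y"
  shows "x \<in> {1..n+1} \<Longrightarrow> y \<in> {1..n+1} \<Longrightarrow> s x < s y \<Longrightarrow> (t x :: int) < t y"
proof (induction "nat (s y - s x)" arbitrary: x y rule: less_induct)
  case less
  show ?case
  proof (cases "adj n s x y")
    case False
    then obtain z where z: "z \<in> {1..n+1}" "s x < s z" "s z < s y"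
      using less.prems by (auto simp: adj_def)
    then have "t x < t z" "t z < t y" using less by simp_all
    then show ?thesis by simp
  qed (use adj in blast)
qed

text \<open>A good element is the join of the join-irreducibles of its descents.\<close>
lemma good_weak_le:
  assumes good: "good n s" and inj: "inj_on s {1..n+1}"
    and J: "\<And>a b e. desc n s a b e \<Longrightarrow> above_arc t a b e"
  shows "weak_le n s t"
  unfolding weak_le_def
proof (intro ballI impI)
  fix x y assume "x \<in> {1..n+1}" "y \<in> {1..n+1}" "x < y" "s y < s x"
  then show "t y < t x"
  proof (induction "nat (s x - s y)" arbitrary: x y rule: less_induct)
    case less
    show ?case
    proof (cases "\<exists>z. x < z \<and> z < y \<and> s y < s z \<and> s z < s x")
      case True
      then obtain z where z: "x < z" "z < y" "s y < s z" "s z < s x" by blast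
      then have "z \<in> {1..n+1}" using less.prems by auto
      then have "t y < t z" "t z < t x" using less z by simp_all
      then show ?thesis by simp
    next
      case False
      \<comment> \<open>No value between \<open>x\<close> and \<open>y\<close> stands between them,
        so the crossing of the threshold \<open>y\<close> goes from some \<open>b \<ge> y\<close> to
        some \<open>a \<le> x\<close>: both numbers lie within \<open>(a, b)\<close>.\<close>
      obtain b a where ba: "adj n s b a" "y \<le> b" "\<not> y \<le> a" "s y \<le> s b" "s a \<le> s x"
        using last_crossing[OF inj less.prems(1,2,4), of "\<lambda>z. y \<le> z"] less.prems by auto
      have "s b < s a" "a \<in> {1..n+1}" "b \<in> {1..n+1}" using ba by (auto simp: adj_def)
      have "a \<le> x"
      proof (rule ccontr)
        assume "\<not> a \<le> x"
        then have "s a \<noteq> s x" using inj \<open>a \<in> _\<close> less.prems(1) \<open>\<not> a \<le> x\<close>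
          by (metis inj_onD order_refl)
        then have "s a < s x" "x < a" "a < y" "s y < s a"
          using ba \<open>s b < s a\<close> \<open>\<not> a \<le> x\<close> by auto
        then show False using False by blast
      qed
      then obtain e where e: "desc n s a b e"
        using good ba less.prems unfolding good_def by (metis le_less_trans less_le_trans)
      \<comment> \<open>\<open>y\<close> stands at or before \<open>b\<close>, hence is
        \<open>b\<close> or left of the arc; \<open>x\<close> stands at or after \<open>a\<close>,
        hence is \<open>a\<close> or right of it. So \<open>(x, y)\<close> is an inversion forced by
        the arc.\<close>
      have "y = b \<or> even y = e"
      proof (cases "y = b")
        case False
        then have "s y < s b" using ba inj \<open>b \<in> _\<close> less.prems by (metis inj_on_def order_le_less)
        then show ?thesis using e ba False by (simp add: desc_def)
      qed simp
      moreover have "x = a \<or> even x \<noteq> e"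
      proof (cases "x = a")
        case False
        then show ?thesis using desc_left[OF e, of x] \<open>a \<le> x\<close> ba less.prems \<open>s b < s a\<close> by fastforce
      qed simp
      ultimately show ?thesis
        using above_arcD[OF J[OF e] \<open>a \<le> x\<close> less.prems(3) ba(2)] by blast
    qed
  qed
qed

section \<open>Exchanging two adjacent values\<close>

lemma swap_less:
  assumes "adj n s u v" "inj_on s {1..n+1}" "x \<in> {1..n+1}" "y \<in> {1..n+1}" "{x, y} \<noteq> {u, v}"
  shows "s (transpose u v x) < s (transpose u v y) \<longleftrightarrow> s x < s y"
proof -
  have uv: "s u < s v" using assms by (simp add: adj_def)
  have *: "s z < s u \<and> s z < s v \<or> s u < s z \<and> s v < s z" if "z \<in> {1..n+1}" "z \<noteq> u" "z \<noteq> v" for z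
    using adjD[OF assms(1,2) that] uv by auto
  consider "x = y" | "x = u" "y \<noteq> u" "y \<noteq> v" | "x = v" "y \<noteq> u" "y \<noteq> v" | "y = u" "x \<noteq> u" "x \<noteq> v"
    | "y = v" "x \<noteq> u" "x \<noteq> v" | "x \<noteq> u" "x \<noteq> v" "y \<noteq> u" "y \<noteq> v"
    using assms(5) by (metis doubleton_eq_iff)
  then show ?thesis
    by cases (use *[OF assms(3)] *[OF assms(4)] uv in auto)
qed

lemma inj_on_swap:
  assumes "u \<in> {1..n+1}" "v \<in> {1..n+1}" "inj_on s {1..n+1}"
  shows "inj_on (s \<circ> transpose u v) {1..n+1}"
proof -
  have "transpose u v ` {1..n+1} = {1..n+1}" using assms by (simp add: transpose_image_eq)
  then show ?thesis using assms(3) by (simp add: comp_inj_on)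
qed

lemma adj_swap:
  assumes "adj n s u v" "inj_on s {1..n+1}"
  shows "adj n (s \<circ> transpose u v) v u"
  using assms unfolding adj_def by (auto simp: transpose_def)

lemma weak_le_swap_same: "adj n s b a \<Longrightarrow> a < b \<Longrightarrow> inj_on s {1..n+1} \<Longrightarrow> weak_le n (s \<circ> transpose b a) s"
  unfolding weak_le_def
proof (intro ballI impI)
  fix i j assume *: "adj n s b a" "a < b" "inj_on s {1..n+1}" "i \<in> {1..n+1}" "j \<in> {1..n+1}" "i < j"
    "(s \<circ> transpose b a) j < (s \<circ> transpose b a) i"
  show "s j < s i"
  proof (cases "{j, i} = {b, a}")
    case True
    then have "j = b" "i = a" using * by (auto simp: doubleton_eq_iff)
    then show ?thesis using * by (simp add: adj_def)
  qed (use * swap_less[of n s b a j i] in simp)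
qed

text \<open>The exchange removes only the inversion \<open>(a, b)\<close>, which \<open>t\<close>
  does not have.\<close>

lemma weak_le_swap:
  assumes "weak_le n t s" "adj n s b a" "inj_on s {1..n+1}" "t a < t b"
  shows "weak_le n t (s \<circ> transpose b a)"
  unfolding weak_le_def
proof (intro ballI impI)
  fix i j assume *: "i \<in> {1..n+1}" "j \<in> {1..n+1}" "i < j" "t j < t i"
  then have "s j < s i" using assms(1) by (simp add: weak_le_def)
  show "(s \<circ> transpose b a) j < (s \<circ> transpose b a) i"
  proof (cases "{j, i} = {b, a}")
    case True
    then show ?thesis using * assms \<open>s j < s i\<close> by (auto simp: doubleton_eq_iff adj_def)
  qed (use * \<open>s j < s i\<close> swap_less[OF assms(2,3), of j i] in simp)
qed

text \<open>Otherwise all pairs adjacent in \<open>s\<close> would be ordered alike in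
  \<open>t\<close>, and the two orders would agree.\<close>

lemma exists_descent:
  assumes "weak_le n t s" "\<not> weak_le n s t" "inj_on s {1..n+1}" "inj_on t {1..n+1}"
  shows "\<exists>a b. a < b \<and> adj n s b a \<and> t a < t b"
proof (rule ccontr)
  assume *: "\<not> (\<exists>a b. a < b \<and> adj n s b a \<and> t a < t b)"
  have "t x < t y" if xy: "adj n s x y" for x y
  proof -
    have V: "x \<in> {1..n+1}" "y \<in> {1..n+1}" "s x < s y" using xy by (auto simp: adj_def)
    then have ne: "x \<noteq> y" by auto
    then have tne: "t x \<noteq> t y" using V assms(4) by (auto simp: inj_on_def)
    show ?thesis
    proof (cases "y < x")
      case True
      then show ?thesis using * xy tne by force
    next
      case False
      then have "x < y" using ne by simp
      then have "\<not> t y < t x" using V assms(1) by (force simp: weak_le_def)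
      then show ?thesis using tne by simp
    qed
  qed
  then show False using less_of_adj_less[OF assms(3), of t] assms(2) unfolding weak_le_def by blast
qed

section \<open>Valid swaps and the arcs they preserve\<close>

definition vswap :: "nat \<Rightarrow> (nat \<Rightarrow> int) \<Rightarrow> (nat \<Rightarrow> int) \<Rightarrow> bool" where
  "vswap n s t \<longleftrightarrow> (\<exists>u v k m. adj n s u v \<and> min u v < k \<and> k < m \<and> m < max u v \<and> even k \<noteq> even m \<and>
     (s k < s u \<and> s m < s u \<or> s v < s k \<and> s v < s m) \<and> t = s \<circ> transpose u v)"

lemma vswap_inj: "vswap n s t \<Longrightarrow> inj_on s {1..n+1} \<Longrightarrow> inj_on t {1..n+1}"
  unfolding vswap_def adj_def using inj_on_swap by blast

lemma vswap_sym:
  assumes "vswap n s t" "inj_on s {1..n+1}"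
  shows "vswap n t s"
proof -
  obtain u v k m where *: "adj n s u v" "min u v < k" "k < m" "m < max u v" "even k \<noteq> even m"
     "s k < s u \<and> s m < s u \<or> s v < s k \<and> s v < s m" "t = s \<circ> transpose u v"
    using assms by (auto simp: vswap_def)
  have "k \<noteq> u" "k \<noteq> v" "m \<noteq> u" "m \<noteq> v" using * by auto
  then have "t k = s k" "t m = s m" "t u = s v" "t v = s u" "s = t \<circ> transpose v u"
    using * by (auto simp: fun_eq_iff transpose_def)
  then show ?thesis
    unfolding vswap_def using * adj_swap[OF *(1) assms(2)] by (metis max.commute min.commute)
qed

lemma vswap_neg: "vswap n s t \<Longrightarrow> vswap n (neg s) (neg t)"
  unfolding vswap_def
proof (elim exE conjE)
  fix u v k m assume *: "adj n s u v" "min u v < k" "k < m" "m < max u v" "even k \<noteq> even m"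
     "s k < s u \<and> s m < s u \<or> s v < s k \<and> s v < s m" "t = s \<circ> transpose u v"
  have "neg t = neg s \<circ> transpose v u"
    unfolding *(7) by (subst transpose_commute) (simp add: neg_def comp_def)
  moreover have "min v u < k" "m < max v u" using * by (simp_all add: min.commute max.commute)
  moreover have "neg s k < neg s v \<and> neg s m < neg s v \<or> neg s u < neg s k \<and> neg s u < neg s m"
    using *(6) by (auto simp: neg_def)
  ultimately show "\<exists>u v k m. adj n (neg s) u v \<and> min u v < k \<and> k < m \<and> m < max u v \<and> even k \<noteq> even m \<and>
     (neg s k < neg s u \<and> neg s m < neg s u \<or> neg s v < neg s k \<and> neg s v < neg s m) \<and>
     neg t = neg s \<circ> transpose u v"
    using *(1,3,5) adj_neg by blast
qed

text \<open>Only the exchange of a forced inversion \<open>(x, y)\<close> could do harm. Of the two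
  witnesses strictly between \<open>x\<close> and \<open>y\<close>, the one of parity
  \<open>e\<close> is forced to stand before \<open>x\<close> and the other one after
  \<open>y\<close>; as \<open>y\<close> and \<open>x\<close> are adjacent, they are on different
  sides, so the swap is not valid.\<close>

lemma vswap_above_arc1:
  assumes "vswap n s t" "inj_on s {1..n+1}" "above_arc s a b e" "1 \<le> a" "b \<le> n + 1"
  shows "above_arc t a b e"
proof -
  obtain u v k m where *: "adj n s u v" "min u v < k" "k < m" "m < max u v" "even k \<noteq> even m"
     "s k < s u \<and> s m < s u \<or> s v < s k \<and> s v < s m" "t = s \<circ> transpose u v"
    using assms by (auto simp: vswap_def)
  have uv: "s u < s v" using * by (simp add: adj_def)
  show ?thesis
    unfolding above_arc_def
  proof (intro allI impI)
    fix x y assume xy: "a \<le> x \<and> x < y \<and> y \<le> b \<and> (x = a \<or> even x \<noteq> e) \<and> (y = b \<or> even y = e)"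
    then have "s y < s x" using assms(3) by (simp add: above_arc_def)
    have V: "x \<in> {1..n+1}" "y \<in> {1..n+1}" using xy assms by auto
    show "t y < t x"
    proof (cases "{y, x} = {u, v}")
      case True
      then have minmax: "min u v = x" "max u v = y" using xy by (auto simp: doubleton_eq_iff)
      obtain p q where pq: "x < p" "p < y" "even p = e" "x < q" "q < y" "even q \<noteq> e" "{p, q} = {k, m}"
      proof (cases "even k = e")
        case True
        then show ?thesis using that[of k m] * minmax by auto
      next
        case False
        then show ?thesis using that[of m k] * minmax by auto
      qed
      have "s p < s x" using above_arcD[OF assms(3), of x p] xy pq by auto
      moreover have "s y < s q" using above_arcD[OF assms(3), of q y] xy pq by auto
      ultimately have False
        using *(6) pq(7) True uv by (auto simp: doubleton_eq_iff)
      then show ?thesis ..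
    next
      case False
      then show ?thesis
        using swap_less[OF *(1) assms(2), of y x] V \<open>s y < s x\<close> *(7) by simp
    qed
  qed
qed

lemma vswaps_above_arc:
  assumes "(vswap n)\<^sup>*\<^sup>* s t" "inj_on s {1..n+1}" "1 \<le> a" "b \<le> n + 1"
  shows "inj_on t {1..n+1} \<and> (above_arc t a b e \<longleftrightarrow> above_arc s a b e)"
  using assms(1)
proof induction
  case (step t u)
  then show ?case using vswap_above_arc1 vswap_sym vswap_inj assms(3,4) by metis
qed (use assms in simp)

section \<open>Inversion sets, removable descents and joins\<close>

definition inv_set :: "nat \<Rightarrow> (nat \<Rightarrow> int) \<Rightarrow> (nat \<times> nat) set" where
  "inv_set n s = {(i, j). i \<in> {1..n+1} \<and> j \<in> {1..n+1} \<and> i < j \<and> s j < s i}"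

lemma finite_inv_set: "finite (inv_set n s)"
  by (rule finite_subset[of _ "{1..n+1} \<times> {1..n+1}"]) (auto simp: inv_set_def)

lemma weak_le_inv_set: "weak_le n s t \<longleftrightarrow> inv_set n s \<subseteq> inv_set n t"
  unfolding weak_le_def inv_set_def by blast

text \<open>A descent along no surviving arc has two numbers of different parity on one side, so a
  valid swap undoes it.\<close>

lemma bad_descent:
  assumes "a < b" "adj n s b a" "\<And>e. \<not> desc n s a b e" "inj_on s {1..n+1}"
  shows "vswap n s (s \<circ> transpose b a)"
proof -
  have V: "c \<in> {1..n+1}" if "a < c" "c < b" for c using assms that by (auto simp: adj_def)
  have side: "s c < s b \<longleftrightarrow> \<not> s a < s c" if "a < c" "c < b" for c
    using adjD[OF assms(2,4) V[OF that]] that assms(2) by (auto simp: adj_def)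
  \<comment> \<open>With this parity \<open>a + 1\<close> obeys the rule, so a violation
    \<open>c\<close> occurs further up.\<close>
  define e where "e = (even (Suc a) = (s (Suc a) < s b))"
  obtain c where c: "a < c" "c < b" "(s c < s b) \<noteq> (even c = e)"
    using assms(1,2) assms(3)[of e] by (auto simp: desc_def)
  have "c \<noteq> Suc a" using c by (auto simp: e_def)
  have "\<exists>k m. a < k \<and> k < m \<and> m < b \<and> even k \<noteq> even m \<and> (s k < s b \<longleftrightarrow> s m < s b)"
  proof (cases "even c = even (Suc a)")
    case False
    then show ?thesis
      using c \<open>c \<noteq> Suc a\<close> by (intro exI[of _ "Suc a"] exI[of _ c]) (auto simp: e_def)
  next
    \<comment> \<open>Now \<open>c\<close> and \<open>a + 1\<close> have equal parity and different
      sides; \<open>a + 2\<close> has the other parity and shares a side with one of them.\<close>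
    case True
    then have "Suc (Suc a) < c" using c \<open>c \<noteq> Suc a\<close> by (metis Suc_lessI even_Suc)
    show ?thesis
    proof (cases "s (Suc a) < s b \<longleftrightarrow> s (Suc (Suc a)) < s b")
      case True
      then show ?thesis
        using c \<open>Suc (Suc a) < c\<close> by (intro exI[of _ "Suc a"] exI[of _ "Suc (Suc a)"]) auto
    next
      case False
      then show ?thesis using c True \<open>Suc (Suc a) < c\<close>
        by (intro exI[of _ "Suc (Suc a)"] exI[of _ c]) (auto simp: e_def)
    qed
  qed
  then obtain k m where km: "a < k" "k < m" "m < b" "even k \<noteq> even m" "s k < s b \<longleftrightarrow> s m < s b"
    by blast
  then have "s k < s b \<and> s m < s b \<or> s a < s k \<and> s a < s m"
    using side[of k] side[of m] by auto
  then show ?thesis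
    unfolding vswap_def using km assms(1,2) 
    by (intro exI[of _ b] exI[of _ a] exI[of _ k] exI[of _ m]) (auto simp: min_def max_def)
qed

text \<open>Undoing descents along no surviving arc lowers the number of inversions, so the process
  stops.\<close>

lemma exists_good:
  assumes "inj_on s {1..n+1}"
  shows "\<exists>t. (vswap n)\<^sup>*\<^sup>* s t \<and> good n t"
  using assms
proof (induction "card (inv_set n s)" arbitrary: s rule: less_induct)
  case less
  show ?case
  proof (cases "good n s")
    case False
    then obtain a b where ab: "a < b" "adj n s b a" "\<And>e. \<not> desc n s a b e" by (auto simp: good_def)
    let ?t = "s \<circ> transpose b a"
    have sw: "vswap n s ?t" using bad_descent[OF ab less.prems] .
    have "inv_set n ?t \<subseteq> inv_set n s"
      using weak_le_swap_same[OF ab(2,1) less.prems] by (simp add: weak_le_inv_set)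
    moreover have "(a, b) \<in> inv_set n s" "(a, b) \<notin> inv_set n ?t"
      using ab by (auto simp: inv_set_def adj_def)
    ultimately have "card (inv_set n ?t) < card (inv_set n s)"
      by (metis finite_inv_set psubset_card_mono psubsetI)
    from less.hyps[OF this vswap_inj[OF sw less.prems]]
    show ?thesis using sw by (meson converse_rtranclp_into_rtranclp)
  qed blast
qed

text \<open>A transitive and cotransitive set of pairs is the inversion set of a linear order.
  \<open>bef\<close> is that order and \<open>t\<close> counts predecessors.\<close>

lemma biclosed_realizable:
  fixes I :: "(nat \<times> nat) set"
  assumes tr: "\<And>i j k. (i, j) \<in> I \<Longrightarrow> (j, k) \<in> I \<Longrightarrow> (i, k) \<in> I"
    and co: "\<And>i j k. i < j \<Longrightarrow> j < k \<Longrightarrow> (i, k) \<in> I \<Longrightarrow> (i, j) \<in> I \<or> (j, k) \<in> I"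
  shows "\<exists>t. inj_on t {1..n+1} \<and> (\<forall>i\<in>{1..n+1}. \<forall>j\<in>{1..n+1}. i < j \<longrightarrow> (t j < (t i :: int) \<longleftrightarrow> (i, j) \<in> I))"
proof -
  define bef where "bef k i \<longleftrightarrow> (k < i \<and> (k, i) \<notin> I) \<or> (i < k \<and> (i, k) \<in> I)" for k i
  define t where "t i = int (card {k \<in> {1..n+1}. bef k i})" for i
  have bef_trans: "bef i j \<Longrightarrow> bef j k \<Longrightarrow> bef i k" for i j k
  proof -
    assume "bef i j" "bef j k"
    then consider "i < j" "j < k" "(i, j) \<notin> I" "(j, k) \<notin> I" | "i < j" "k < j" "(i, j) \<notin> I" "(k, j) \<in> I"
      | "j < i" "j < k" "(j, i) \<in> I" "(j, k) \<notin> I" | "j < i" "k < j" "(j, i) \<in> I" "(k, j) \<in> I"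
      unfolding bef_def by blast
    then show "bef i k"
    proof cases
      case 1 then show ?thesis using co unfolding bef_def by (meson less_trans)
    next
      case 2
      then have "i \<noteq> k" by auto
      then show ?thesis using 2 co[of k i j] tr[of i k j] unfolding bef_def by (metis linorder_neqE_nat)
    next
      case 3
      then have "i \<noteq> k" by auto
      then show ?thesis using 3 co[of j k i] tr[of j i k] unfolding bef_def by (metis linorder_neqE_nat)
    next
      case 4 then show ?thesis using tr unfolding bef_def by (meson less_trans)
    qed
  qed
  have mono: "t i < t j" if "bef i j" "i \<in> {1..n+1}" for i j
  proof -
    have "{k \<in> {1..n+1}. bef k i} \<subset> {k \<in> {1..n+1}. bef k j}"
      using that bef_trans by (auto simp: bef_def)
    then show ?thesis unfolding t_def by (simp add: psubset_card_mono)
  qed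
  have tot: "bef i j \<or> bef j i" if "i < j" for i j using that by (auto simp: bef_def)
  have iff: "t j < t i \<longleftrightarrow> (i, j) \<in> I" if "i \<in> {1..n+1}" "j \<in> {1..n+1}" "i < j" for i j
  proof (cases "(i, j) \<in> I")
    case True
    then show ?thesis using mono[of j i] that by (simp add: bef_def)
  next
    case False
    then show ?thesis using mono[of i j] that by (simp add: bef_def)
  qed
  have "inj_on t {1..n+1}"
  proof (rule linorder_inj_onI)
    fix i j assume "i < j" "i \<in> {1..n+1}" "j \<in> {1..n+1}"
    then show "t i \<noteq> t j" using mono tot by (metis less_irrefl)
  qed auto
  then show ?thesis using iff by blast
qed

definition is_join :: "nat \<Rightarrow> (nat \<Rightarrow> int) set \<Rightarrow> (nat \<Rightarrow> int) \<Rightarrow> bool" where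
  "is_join n F t \<longleftrightarrow> inj_on t {1..n+1} \<and> (\<forall>s\<in>F. weak_le n s t) \<and>
     (\<forall>u. inj_on u {1..n+1} \<longrightarrow> (\<forall>s\<in>F. weak_le n s u) \<longrightarrow> weak_le n t u)"

lemma is_joinD:
  assumes "is_join n F t"
  shows "inj_on t {1..n+1}" "\<And>s. s \<in> F \<Longrightarrow> weak_le n s t"
    "\<And>u. inj_on u {1..n+1} \<Longrightarrow> (\<And>s. s \<in> F \<Longrightarrow> weak_le n s u) \<Longrightarrow> weak_le n t u"
  using assms unfolding is_join_def by blast+

text \<open>The inversion set of the join is the transitive closure of the union. Cotransitivity
  survives the closure by induction along a path: \<open>j\<close> lies before, at or beyond the
  last vertex but one.\<close>

lemma exists_join:
  assumes inj: "\<And>s. s \<in> F \<Longrightarrow> inj_on s {1..n+1}"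
  shows "\<exists>t. is_join n F t"
proof -
  let ?U = "\<Union>s\<in>F. inv_set n s"
  have lt: "i < j \<and> i \<in> {1..n+1} \<and> j \<in> {1..n+1}" if "(i, j) \<in> ?U\<^sup>+" for i j
    using that by induction (auto simp: inv_set_def)
  have co: "(i, j) \<in> ?U\<^sup>+ \<or> (j, k) \<in> ?U\<^sup>+" if "(i, k) \<in> ?U\<^sup>+" "i < j" "j < k" for i j k
    using that
  proof (induction arbitrary: j)
    case (base k)
    then obtain s where s: "s \<in> F" "(i, k) \<in> inv_set n s" by auto
    then have "(i, j) \<in> inv_set n s \<or> (j, k) \<in> inv_set n s"
      using base by (auto simp: inv_set_def)
    then show ?case using s by blast
  next
    case (step y z)
    then obtain s where s: "s \<in> F" "(y, z) \<in> inv_set n s" by auto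
    consider "j < y" | "j = y" | "y < j" by linarith
    then show ?case
    proof cases
      case 1
      then show ?thesis using step by (meson trancl.trancl_into_trancl)
    next
      case 2
      then show ?thesis using step by blast
    next
      case 3
      then have "(y, j) \<in> inv_set n s \<or> (j, z) \<in> inv_set n s"
        using s step by (auto simp: inv_set_def)
      then show ?thesis using s step(1) by (meson UN_I r_into_trancl trancl.trancl_into_trancl)
    qed
  qed
  have "\<exists>t :: nat \<Rightarrow> int. inj_on t {1..n+1} \<and>
      (\<forall>i\<in>{1..n+1}. \<forall>j\<in>{1..n+1}. i < j \<longrightarrow> (t j < t i \<longleftrightarrow> (i, j) \<in> ?U\<^sup>+))"
    by (rule biclosed_realizable) (erule (1) trancl_trans, erule (2) co[rotated -1])
  then obtain t :: "nat \<Rightarrow> int" where t: "inj_on t {1..n+1}"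
    "\<And>i j. i \<in> {1..n+1} \<Longrightarrow> j \<in> {1..n+1} \<Longrightarrow> i < j \<Longrightarrow> t j < t i \<longleftrightarrow> (i, j) \<in> ?U\<^sup>+"
    by blast
  have "(i, j) \<in> inv_set n t \<longleftrightarrow> (i, j) \<in> ?U\<^sup>+" for i j
    unfolding inv_set_def[of n t] using t(2)[of i j] lt[of i j] by blast
  then have inv_t: "inv_set n t = ?U\<^sup>+" by (simp add: set_eq_iff)
  have "weak_le n t u" if u: "inj_on u {1..n+1}" "\<And>s. s \<in> F \<Longrightarrow> weak_le n s u" for u
  proof -
    have "(i, j) \<in> inv_set n u" if "(i, j) \<in> ?U\<^sup>+" for i j
      using that
    proof induction
      case (base j) then show ?case using u(2) unfolding weak_le_inv_set by blast
    next
      case (step j k)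
      then have "(j, k) \<in> inv_set n u" using u(2) unfolding weak_le_inv_set by blast
      then show ?case using step by (auto simp: inv_set_def)
    qed
    then show ?thesis by (auto simp: weak_le_inv_set inv_t)
  qed
  moreover have "weak_le n s t" if "s \<in> F" for s using that by (auto simp: weak_le_inv_set inv_t)
  ultimately show ?thesis using t(1) unfolding is_join_def by blast
qed

section \<open>The irreducible elements of an arc\<close>

text \<open>The position functions of the join-irreducible with descent \<open>(a, b, e)\<close> and of the
  meet-irreducible with ascent \<open>(a, b, e)\<close>; the offset \<open>n + 2\<close> puts the numbers on the right of the
  arc behind those on its left.\<close>
definition jrep :: "nat \<Rightarrow> nat \<Rightarrow> nat \<Rightarrow> bool \<Rightarrow> nat \<Rightarrow> int" where
  "jrep n a b e c = (if c < a \<or> c = b then int c else if b < c then int c + 2 * (int n + 2)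
     else if c \<noteq> a \<and> even c = e then int c else int c + (int n + 2))"

definition mrep :: "nat \<Rightarrow> nat \<Rightarrow> nat \<Rightarrow> bool \<Rightarrow> nat \<Rightarrow> int" where
  "mrep n a b e = neg (jrep n a b (\<not> e))"

text \<open>These are exactly the pairs tested by \<open>above_arc\<close>, which is why that
  predicate describes the up-set of the join-irreducible.\<close>

lemma jrep_inversion:
  assumes "1 \<le> i" "i < j" "j \<le> n + 1" "a < b"
  shows "jrep n a b e j < jrep n a b e i \<longleftrightarrow>
    a \<le> i \<and> j \<le> b \<and> (i = a \<or> even i \<noteq> e) \<and> (j = b \<or> even j = e)"
  using assms by (auto simp: jrep_def)

lemma inj_on_jrep: "a < b \<Longrightarrow> inj_on (jrep n a b e) {1..n+1}"
  by (rule linorder_inj_onI) (auto simp: jrep_def split: if_splits)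

lemma inj_on_mrep: "a < b \<Longrightarrow> inj_on (mrep n a b e) {1..n+1}"
  unfolding mrep_def inj_on_neg by (rule inj_on_jrep)

lemma jrep_weak_le:
  assumes "1 \<le> a" "a < b" "b \<le> n + 1"
  shows "weak_le n (jrep n a b e) s \<longleftrightarrow> above_arc s a b e"
proof
  assume le: "weak_le n (jrep n a b e) s"
  show "above_arc s a b e"
    unfolding above_arc_def
  proof (intro allI impI)
    fix x y assume *: "a \<le> x \<and> x < y \<and> y \<le> b \<and> (x = a \<or> even x \<noteq> e) \<and> (y = b \<or> even y = e)"
    then have "1 \<le> x" "y \<le> n + 1" using assms by auto
    then show "s y < s x"
      using le jrep_inversion[of x y n a b e] * assms unfolding weak_le_def by auto
  qed
next
  assume "above_arc s a b e"
  then show "weak_le n (jrep n a b e) s"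
    unfolding weak_le_def using assms(2) by (auto simp: jrep_inversion above_arcD)
qed

lemma weak_le_mrep:
  assumes "1 \<le> a" "a < b" "b \<le> n + 1" "inj_on s {1..n+1}"
  shows "weak_le n s (mrep n a b e) \<longleftrightarrow> above_arc (neg s) a b (\<not> e)"
proof -
  have "inj_on (neg s) {1..n+1}" using assms(4) by (simp only: inj_on_neg)
  from weak_le_neg[OF this inj_on_jrep[OF assms(2)]] jrep_weak_le[OF assms(1-3)]
  show ?thesis by (simp only: mrep_def neg_neg)
qed

section \<open>Descents and ascents within one class\<close>

text \<open>An arc touches the gap between \<open>g\<close> and \<open>g + 1\<close> if it starts at \<open>g\<close> or ends at \<open>g + 1\<close>; the side is
  that of the other number relative to the arc. An arc \<open>(g, g + 1)\<close> touches on both sides.\<close>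
definition touches_right :: "(nat \<Rightarrow> nat \<Rightarrow> bool \<Rightarrow> bool) \<Rightarrow> nat \<Rightarrow> bool" where
  "touches_right D g \<longleftrightarrow> (\<exists>a b e. D a b e \<and> (a = g \<and> even (Suc g) \<noteq> e \<or> b = Suc g \<and> even g \<noteq> e))"

definition touches_left :: "(nat \<Rightarrow> nat \<Rightarrow> bool \<Rightarrow> bool) \<Rightarrow> nat \<Rightarrow> bool" where
  "touches_left D g \<longleftrightarrow> (\<exists>a b e. D a b e \<and> (a = g \<and> even (Suc g) = e \<or> b = Suc g \<and> even g = e))"

lemma inj_ne: "inj_on s A \<Longrightarrow> x \<in> A \<Longrightarrow> y \<in> A \<Longrightarrow> x \<noteq> y \<Longrightarrow> s x \<noteq> s y"
  by (meson inj_onD)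

lemma good_desc: "good n s \<Longrightarrow> adj n s b a \<Longrightarrow> a < b \<Longrightarrow> \<exists>e. desc n s a b e"
  by (simp add: good_def)

lemma desc_short: "adj n s (Suc a) a \<Longrightarrow> desc n s a (Suc a) e"
  by (auto simp: desc_def)

text \<open>The order of \<open>g\<close> and \<open>g + 1\<close> decides on which side of an arc
  the neighbour of its end stands. If \<open>g + 1\<close> comes first, only arcs ending at
  \<open>g + 1\<close> touch the gap on the right, otherwise only those starting at
  \<open>g\<close>. Goodness makes every adjacent descent an arc.\<close>

lemma touches_right_desc:
  assumes good: "good n s" and inj: "inj_on s {1..n+1}" and g: "1 \<le> g" "g \<le> n"
  shows "touches_right (desc n s) g \<longleftrightarrow>
    (if s (Suc g) < s g then \<exists>a. a < Suc g \<and> adj n s (Suc g) a else \<exists>b. g < b \<and> adj n s b g)"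
proof -
  have ne: "s (Suc g) \<noteq> s g" using g by (intro inj_ne[OF inj]) auto
  show ?thesis
  proof (cases "s (Suc g) < s g")
    case True
    have "\<exists>a. a < Suc g \<and> adj n s (Suc g) a" if "touches_right (desc n s) g"
    proof -
      obtain a b e where abe: "desc n s a b e" "a = g \<and> even (Suc g) \<noteq> e \<or> b = Suc g \<and> even g \<noteq> e"
        using \<open>touches_right (desc n s) g\<close> unfolding touches_right_def by blast
      have "b = Suc g"
      proof (rule ccontr)
        assume b: "b \<noteq> Suc g"
        then have "a = g" "even (Suc g) \<noteq> e" using abe by auto
        moreover have "Suc g < b" using b desc_bounds[OF abe(1)] calculation by auto
        ultimately have "s g < s (Suc g)" using desc_right[OF abe(1) inj, of "Suc g"] by auto
        then show False using True by simp
      qed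
      then show ?thesis using abe by (auto simp: desc_def)
    qed
    moreover have "touches_right (desc n s) g" if "a < Suc g" "adj n s (Suc g) a" for a
    proof (cases "a = g")
      case True
      then have "desc n s g (Suc g) (even g)" using that desc_short by blast
      then show ?thesis unfolding touches_right_def by (intro exI[of _ g] exI[of _ "Suc g"] exI[of _ "even g"]) auto
    next
      case False
      then obtain e where e: "desc n s a (Suc g) e"
        using good \<open>a < Suc g\<close> \<open>adj n s (Suc g) a\<close> by (auto simp: good_def)
      have "even g \<noteq> e" using desc_left[OF e, of g] False that True by auto
      then show ?thesis using e unfolding touches_right_def by blast
    qed
    ultimately show ?thesis using True by auto
  next
    case F: False
    then have lt: "s g < s (Suc g)" using ne by simp
    have "\<exists>b. g < b \<and> adj n s b g" if "touches_right (desc n s) g"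
    proof -
      obtain a b e where abe: "desc n s a b e" "a = g \<and> even (Suc g) \<noteq> e \<or> b = Suc g \<and> even g \<noteq> e"
        using \<open>touches_right (desc n s) g\<close> unfolding touches_right_def by blast
      have ba: "s b < s a" "a < b" using abe by (auto simp: desc_def adj_def)
      have "a = g"
      proof (rule ccontr)
        assume a: "a \<noteq> g"
        then have "b = Suc g" "even g \<noteq> e" using abe by auto
        moreover have "a < g" using a ba calculation by auto
        ultimately have "s a < s g" using desc_right[OF abe(1) inj, of g] by auto
        then show False using lt ba \<open>b = Suc g\<close> by simp
      qed
      then show ?thesis using abe by (auto simp: desc_def)
    qed
    moreover have "touches_right (desc n s) g" if "g < b" "adj n s b g" for b
    proof -
      obtain e where e: "desc n s g b e"
        using good \<open>g < b\<close> \<open>adj n s b g\<close> by (auto simp: good_def)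
      have "s b < s g" using that by (simp add: adj_def)
      then have "b \<noteq> Suc g" using lt by auto
      then have "even (Suc g) \<noteq> e" using desc_left[OF e, of "Suc g"] that lt \<open>s b < s g\<close> by auto
      then show ?thesis using e unfolding touches_right_def by blast
    qed
    ultimately show ?thesis using F by auto
  qed
qed

text \<open>The analysis of the right side with the two kinds of arcs exchanged.\<close>

lemma touches_left_desc:
  assumes good: "good n s" and inj: "inj_on s {1..n+1}" and g: "1 \<le> g" "g \<le> n"
  shows "touches_left (desc n s) g \<longleftrightarrow>
    (if s (Suc g) < s g then \<exists>b. g < b \<and> adj n s b g else \<exists>a. a < Suc g \<and> adj n s (Suc g) a)"
proof -
  have ne: "s (Suc g) \<noteq> s g" using g by (intro inj_ne[OF inj]) auto
  have V: "g \<in> {1..n+1}" "Suc g \<in> {1..n+1}" using g by auto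
  show ?thesis
  proof (cases "s (Suc g) < s g")
    case True
    have "\<exists>b. g < b \<and> adj n s b g" if "touches_left (desc n s) g"
    proof -
      obtain a b e where abe: "desc n s a b e" "a = g \<and> even (Suc g) = e \<or> b = Suc g \<and> even g = e"
        using \<open>touches_left (desc n s) g\<close> unfolding touches_left_def by blast
      have "a = g"
      proof (rule ccontr)
        assume b: "a \<noteq> g"
        then have "b = Suc g" "even g = e" using abe by auto
        moreover have "a < g" using b desc_bounds[OF abe(1)] calculation by auto
        ultimately have "s g < s (Suc g)" using desc_left[OF abe(1), of "g"] by auto
        then show False using True by simp
      qed
      then show ?thesis using abe by (auto simp: desc_def)
    qed
    moreover have "touches_left (desc n s) g" if "g < b" "adj n s b g" for b
    proof (cases "b = Suc g")
      case True
      then have "desc n s g (Suc g) (even (Suc g))" using that desc_short by blast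
      then show ?thesis unfolding touches_left_def by (intro exI[of _ g] exI[of _ "Suc g"] exI[of _ "even (Suc g)"]) auto
    next
      case False
      obtain e where e: "desc n s g b e"
        using good \<open>g < b\<close> \<open>adj n s b g\<close> by (auto simp: good_def)
      have "s (Suc g) < s b" using adjD[OF that(2) inj V(2)] False True by auto
      then have "even (Suc g) = e" using e that False unfolding desc_def by (metis Suc_lessI lessI)
      then show ?thesis using e unfolding touches_left_def by blast
    qed
    ultimately show ?thesis using True by auto
  next
    case F: False
    then have lt: "s g < s (Suc g)" using ne by simp
    have "\<exists>a. a < Suc g \<and> adj n s (Suc g) a" if "touches_left (desc n s) g"
    proof -
      obtain a b e where abe: "desc n s a b e" "a = g \<and> even (Suc g) = e \<or> b = Suc g \<and> even g = e"
        using \<open>touches_left (desc n s) g\<close> unfolding touches_left_def by blast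
      have ba: "s b < s a" "a < b" using abe by (auto simp: desc_def adj_def)
      have "b = Suc g"
      proof (rule ccontr)
        assume b: "b \<noteq> Suc g"
        then have "a = g" "even (Suc g) = e" using abe by auto
        moreover have "Suc g < b" using b ba calculation by auto
        ultimately have "s (Suc g) < s b" using desc_left[OF abe(1), of "Suc g"] by auto
        then show False using lt ba \<open>a = g\<close> by simp
      qed
      then show ?thesis using abe by (auto simp: desc_def)
    qed
    moreover have "touches_left (desc n s) g" if "a < Suc g" "adj n s (Suc g) a" for a
    proof -
      obtain e where e: "desc n s a (Suc g) e"
        using good \<open>a < Suc g\<close> \<open>adj n s (Suc g) a\<close> by (auto simp: good_def)
      have "s (Suc g) < s a" using that by (simp add: adj_def)
      then have "a \<noteq> g" using lt by auto
      then have "even g = e" using e that lt unfolding desc_def by (metis lessI less_antisym)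
      then show ?thesis using e unfolding touches_left_def by blast
    qed
    ultimately show ?thesis using F by auto
  qed
qed

text \<open>Consecutive numbers differ in parity, so an arc that passes both separates them; this
  keeps most arguments below local.\<close>

lemma desc_consecutive:
  "desc n s a b e \<Longrightarrow> a < c \<Longrightarrow> Suc c < b \<Longrightarrow> s c < s b \<longleftrightarrow> \<not> s (Suc c) < s b"
  by (auto simp: desc_def)

lemma above_arc_short: "above_arc s a (Suc a) e \<longleftrightarrow> s (Suc a) < s a"
proof
  assume "above_arc s a (Suc a) e"
  then show "s (Suc a) < s a" using above_arcD[of s a "Suc a" e a "Suc a"] by simp
next
  assume *: "s (Suc a) < s a"
  show "above_arc s a (Suc a) e"
    unfolding above_arc_def
  proof (intro allI impI)
    fix x y assume "a \<le> x \<and> x < y \<and> y \<le> Suc a \<and> (x = a \<or> even x \<noteq> e) \<and> (y = Suc a \<or> even y = e)"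
    then have "x = a" "y = Suc a" by auto
    then show "s y < s x" using * by simp
  qed
qed

lemma adj_unique: "adj n s x y \<Longrightarrow> adj n s x z \<Longrightarrow> s y = s z"
  unfolding adj_def by (meson linorder_neqE)

text \<open>Here \<open>s\<close> is the minimum and \<open>t\<close> the maximum of a class.\<close>
context
  fixes n :: nat and s t :: "nat \<Rightarrow> int"
  assumes good_s: "good n s" and good_t: "good n (neg t)"
    and inj_s: "inj_on s {1..n+1}" and inj_t: "inj_on t {1..n+1}"
    and J: "\<And>a b e. 1 \<le> a \<Longrightarrow> b \<le> n + 1 \<Longrightarrow> above_arc s a b e \<longleftrightarrow> above_arc t a b e"
    and M: "\<And>a b e. 1 \<le> a \<Longrightarrow> b \<le> n + 1 \<Longrightarrow> above_arc (neg s) a b e \<longleftrightarrow> above_arc (neg t) a b e"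
begin

lemma inj_nt: "inj_on (neg t) {1..n+1}"
  using inj_t by (simp only: inj_on_neg)

text \<open>The arcs \<open>(a, k)\<close> and \<open>(k, z)\<close> would concatenate to an arc \<open>(a, z)\<close> below \<open>t\<close> but not below \<open>s\<close>.\<close>
lemma class_successor1:
  assumes k: "s k < s (k - 1)" "t k < t (Suc k)" and "1 < k"
    and a: "a < k" "adj n s k a" and z: "k < z" "adj n t k z"
  shows False
proof -
  define e where "e = even k"
  have V: "1 \<le> a" "z \<le> n + 1" "k \<in> {1..n+1}" "a \<in> {1..n+1}" "z \<in> {1..n+1}"
    using a z by (auto simp: adj_def)
  \<comment> \<open>\<open>k - 1\<close> stands after \<open>k\<close>, hence right of a longer arc
    ending at \<open>k\<close>, so the left parity is that of \<open>k\<close>. In the same way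
    \<open>k + 1\<close> fixes the side of the arc \<open>(k, z)\<close>, and the two arcs fit
    together with one \<open>e\<close>.\<close>
  have D: "desc n s a k e"
  proof (cases "a = k - 1")
    case True
    then show ?thesis using desc_short[of n s a e] a by simp
  next
    case False
    obtain f where f: "desc n s a k f" using good_s a by (auto simp: good_def)
    have "even (k - 1) \<noteq> f" using desc_left[OF f, of "k - 1"] False a k by fastforce
    then show ?thesis using f \<open>1 < k\<close> by (simp add: e_def)
  qed
  have U: "desc n (neg t) k z (\<not> e)"
  proof (cases "z = Suc k")
    case True
    then show ?thesis using desc_short[of n "neg t" k] z by (simp add: adj_neg)
  next
    case False
    obtain f where f: "desc n (neg t) k z f" using good_t z by (auto simp: good_def adj_neg)
    have "t z < t (Suc k)"
      using adjD[OF z(2) inj_t, of "Suc k"] False k V z by auto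
    then have "even (Suc k) = f" using f z False by (auto simp: desc_def neg_def)
    then show ?thesis using f by (simp add: e_def)
  qed
  have Jt: "above_arc t a k e" using desc_above_arc[OF D inj_s] J V by auto
  have tkz: "t k < t z" using z by (simp add: adj_def)
  \<comment> \<open>For \<open>y < k\<close> the arc \<open>(a, k)\<close> applies. Otherwise
    \<open>z\<close> separates the two numbers in \<open>t\<close>: \<open>y\<close> is at or before
    it and \<open>x\<close> after it.\<close>
  have "above_arc t a z e"
    unfolding above_arc_def
  proof (intro allI impI)
    fix x y assume *: "a \<le> x \<and> x < y \<and> y \<le> z \<and> (x = a \<or> even x \<noteq> e) \<and> (y = z \<or> even y = e)"
    show "t y < t x"
    proof (cases "y < k")
      case True
      then show ?thesis using above_arcD[OF Jt, of x y] * z by auto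
    next
      case False
      have "t y \<le> t z"
      proof -
        consider "y = z" | "y = k" | "k < y" "y < z" "even y = e" using False * by fastforce
        then show ?thesis
        proof cases
          case 3
          then show ?thesis using desc_right[OF U inj_nt, of y] tkz by (auto simp: neg_def)
        qed (use tkz in auto)
      qed
      moreover have "t z < t x"
      proof -
        have "x \<noteq> k" using * a by (auto simp: e_def)
        then consider "x < k" | "k < x" "x < z" "even x \<noteq> e" using * a by fastforce
        then show ?thesis
        proof cases
          case 1
          then have "t k < t x" using above_arcD[OF Jt, of x k] * by (auto simp: e_def)
          moreover have "x \<in> {1..n+1}" using * V 1 by auto
          ultimately show ?thesis using adjD[OF z(2) inj_t, of x] 1 z by auto
        next
          case 2
          then show ?thesis using desc_left[OF U, of x] by (auto simp: neg_def)
        qed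
      qed
      ultimately show ?thesis by simp
    qed
  qed
  \<comment> \<open>Now \<open>z\<close> precedes \<open>a\<close> in \<open>s\<close>, while the
    arc \<open>(k, z)\<close> puts it after \<open>k\<close>, although \<open>k\<close> and
    \<open>a\<close> are adjacent.\<close>
  then have "above_arc s a z e" using J V by simp
  then have "s z < s a" using above_arcD[of s a z e a z] a z by auto
  moreover have "s k < s z"
  proof -
    have "above_arc (neg s) k z (\<not> e)" using desc_above_arc[OF U inj_nt] M V by auto
    then show ?thesis using above_arcD[of "neg s" k z _ k z] z by (auto simp: neg_def)
  qed
  ultimately show False using a V by (auto simp: adj_def)
qed

text \<open>The same contradiction, with \<open>(a, d)\<close> the first descent of \<open>s\<close> and \<open>(c, z)\<close> the first ascent of \<open>t\<close>
  that pass \<open>k\<close> on its right.\<close>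
lemma class_successor2:
  assumes k: "s k < s (k - 1)" "t k < t (Suc k)" and k1: "1 < k" "k \<le> n"
    and z0: "k < z0" "adj n s k z0" and a0: "a0 < k" "adj n t k a0"
  shows False
proof -
  define e where "e = even k"
  have V: "k \<in> {1..n+1}" "k - 1 \<in> {1..n+1}" "Suc k \<in> {1..n+1}" using k1 by auto
  have nk: "\<not> k \<le> k - 1" "\<not> Suc k \<le> k" using k1 by auto
  note nk' = nk(2) and nk = nk(1)
  obtain d a where da: "adj n s d a" "k \<le> d" "\<not> k \<le> a" "s k \<le> s d"
      and s_first: "\<And>w. w \<in> {1..n+1} \<Longrightarrow> s k \<le> s w \<Longrightarrow> s w < s a \<Longrightarrow> k \<le> w"
    using first_crossing[OF inj_s V(2,1) k(1), of "\<lambda>w. k \<le> w", OF order_refl nk] by blast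
  obtain c z where cz: "adj n t c z" "c \<le> k" "\<not> z \<le> k" "t k \<le> t c"
      and t_first: "\<And>w. w \<in> {1..n+1} \<Longrightarrow> t k \<le> t w \<Longrightarrow> t w < t z \<Longrightarrow> w \<le> k"
    using first_crossing[OF inj_t V(3,1) k(2), of "\<lambda>w. w \<le> k", OF order_refl] nk' by blast
  have W: "a \<in> {1..n+1}" "d \<in> {1..n+1}" "c \<in> {1..n+1}" "z \<in> {1..n+1}" "a0 \<in> {1..n+1}" "z0 \<in> {1..n+1}"
    using da cz z0 a0 by (auto simp: adj_def)
  \<comment> \<open>The successor of \<open>k\<close> in \<open>s\<close> is larger than
    \<open>k\<close>, so a descent passing to smaller numbers cannot start at \<open>k\<close>;
    dually for \<open>c\<close> in \<open>t\<close>.\<close>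
  have "d \<noteq> k"
  proof
    assume "d = k"
    then have "s a = s z0" using adj_unique da z0 by blast
    then have "a = z0" using inj_onD[OF inj_s] W by blast
    then show False using da z0 by simp
  qed
  have "c \<noteq> k"
  proof
    assume "c = k"
    then have "t z = t a0" using adj_unique cz a0 by blast
    then have "z = a0" using inj_onD[OF inj_t] W by blast
    then show False using cz a0 by simp
  qed
  have lts: "a < k" "k < d" "c < k" "k < z" using da cz \<open>d \<noteq> k\<close> \<open>c \<noteq> k\<close> by auto
  have "s d \<noteq> s k" "t c \<noteq> t k" using inj_ne[OF inj_s W(2) V(1)] inj_ne[OF inj_t W(3) V(1)] \<open>d \<noteq> k\<close> \<open>c \<noteq> k\<close> by blast+
  then have ineq: "s k < s d" "s d < s a" "t k < t c" "t c < t z"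
    using da cz by (auto simp: adj_def)
  obtain f where f: "desc n s a d f" using good_s da lts unfolding good_def by (meson less_trans)
  have "even k = f" using f lts ineq by (auto simp: desc_def)
  then have D: "desc n s a d e" using f by (simp add: e_def)
  obtain f' where f': "desc n (neg t) c z f'"
    using good_t cz lts unfolding good_def by (meson less_trans adj_neg)
  have "even k \<noteq> f'" using desc_left[OF f', of k] lts ineq by (auto simp: neg_def)
  then have U: "desc n (neg t) c z (\<not> e)" using f' by (auto simp: e_def)
  have Jt: "above_arc t a d e" using desc_above_arc[OF D inj_s] J W by auto
  have Ms: "above_arc (neg s) c z (\<not> e)" using desc_above_arc[OF U inj_nt] M W by auto
  \<comment> \<open>\<open>s\<close> lies below the meet-irreducible of the piece
    \<open>(k, d)\<close>. By invariance \<open>k\<close> precedes \<open>d\<close> in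
    \<open>t\<close> as well, and the choice of \<open>z\<close> as first puts \<open>d\<close> at
    or after \<open>z\<close>.\<close>
  have "above_arc (neg s) k d (\<not> e)"
    unfolding above_arc_def
  proof (intro allI impI)
    fix x y assume *: "k \<le> x \<and> x < y \<and> y \<le> d \<and> (x = k \<or> even x \<noteq> (\<not> e)) \<and> (y = d \<or> even y = (\<not> e))"
    have "s x < s d" using * desc_left[OF D, of x] lts ineq by (cases "x = k") auto
    moreover have "s d \<le> s y"
      using * desc_right[OF D inj_s, of y] lts ineq by (cases "y = d") auto
    ultimately show "neg s y < neg s x" by (simp add: neg_def)
  qed
  then have "above_arc (neg t) k d (\<not> e)" using M W V by auto
  then have "t k < t d" using above_arcD[of "neg t" k d _ k d] lts by (auto simp: neg_def)
  then have tzd: "t z \<le> t d" using t_first[of d] W lts by fastforce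
  \<comment> \<open>Dually, the piece \<open>(c, k)\<close> passes from \<open>t\<close> to
    \<open>s\<close> and puts \<open>c\<close> at or after \<open>a\<close> there, hence
    \<open>z\<close> after \<open>a\<close>.\<close>
  have "above_arc t c k e"
    unfolding above_arc_def
  proof (intro allI impI)
    fix x y assume *: "c \<le> x \<and> x < y \<and> y \<le> k \<and> (x = c \<or> even x \<noteq> e) \<and> (y = k \<or> even y = e)"
    have "t y < t c" using * desc_right[OF U inj_nt, of y] lts ineq by (cases "y = k") (auto simp: neg_def)
    moreover have "t c \<le> t x"
      using * desc_left[OF U, of x] lts ineq by (cases "x = c") (auto simp: neg_def)
    ultimately show "t y < t x" by simp
  qed
  then have "above_arc s c k e" using J W V by auto
  then have "s k < s c" using above_arcD[of s c k _ c k] lts by auto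
  then have "s a \<le> s c" using s_first[of c] W lts by fastforce
  moreover have "s c < s z" using above_arcD[OF Ms, of c z] lts by (auto simp: neg_def)
  ultimately have saz: "s a < s z" by simp
  have tda: "t d < t a" using above_arcD[OF Jt, of a d] lts by auto
  have "above_arc t a z e"
    unfolding above_arc_def
  proof (intro allI impI)
    fix x y assume *: "a \<le> x \<and> x < y \<and> y \<le> z \<and> (x = a \<or> even x \<noteq> e) \<and> (y = z \<or> even y = e)"
    show "t y < t x"
    proof (cases "y < k")
      case True
      then show ?thesis using above_arcD[OF Jt, of x y] * lts by auto
    next
      case False
      have "t y \<le> t z"
      proof -
        consider "y = z" | "y = k" | "k < y" "y < z" "even y = e" using False * by fastforce
        then show ?thesis
        proof cases
          case 3
          then show ?thesis using desc_right[OF U inj_nt, of y] lts ineq by (auto simp: neg_def)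
        qed (use ineq in auto)
      qed
      moreover have "t z < t x"
      proof -
        have "x \<noteq> k" using * lts by (auto simp: e_def)
        then consider "x = a" | "a < x" "x < k" "even x \<noteq> e" | "k < x" "x < z" "even x \<noteq> e"
          using * lts by fastforce
        then show ?thesis
        proof cases
          case 1
          then show ?thesis using tzd tda by simp
        next
          case 2
          then have "t d < t x" using above_arcD[OF Jt, of x d] lts by auto
          then show ?thesis using tzd by simp
        next
          case 3
          then show ?thesis using desc_left[OF U, of x] lts by (auto simp: neg_def)
        qed
      qed
      ultimately show ?thesis by simp
    qed
  qed
  then have "above_arc s a z e" using J W by auto
  then have "s z < s a" using above_arcD[of s a z e a z] lts by auto
  then show False using saz by simp
qed

text \<open>With \<open>k = p + 1\<close> and \<open>q = k + 1\<close>, both sides ask for adjacent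
  values at \<open>p\<close>, \<open>k\<close> or \<open>q\<close>, and the orders of
  \<open>p, k\<close> and of \<open>k, q\<close> are the same in \<open>s\<close> and
  \<open>t\<close>. If \<open>k\<close> stands between \<open>p\<close> and \<open>q\<close>, the
  answers are forced; if it stands after both, they amount to the order of \<open>p\<close> and
  \<open>q\<close>; if it stands before both, they compare the successors of \<open>k\<close> in
  minimum and maximum.\<close>

lemma class_touch:
  assumes p: "1 \<le> p" "Suc p \<le> n"
  shows "touches_right (desc n s) p \<longleftrightarrow> \<not> touches_left (desc n (neg t)) (Suc p)"
proof -
  define k where "k = Suc p"
  define q where "q = Suc k"
  let ?N = "neg t"
  have V: "p \<in> {1..n+1}" "k \<in> {1..n+1}" "q \<in> {1..n+1}" using p by (auto simp: k_def q_def)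
  have ord: "p < k" "k < q" "Suc p = k" "Suc k = q" by (auto simp: k_def q_def)
  have ne: "s p \<noteq> s k" "s k \<noteq> s q" "s p \<noteq> s q" "t p \<noteq> t k" "t k \<noteq> t q" "t p \<noteq> t q"
    using V ord by (simp_all add: inj_ne[OF inj_s] inj_ne[OF inj_t] del: atLeastAtMost_iff)
  have pk: "s k < s p \<longleftrightarrow> t k < t p" and kq: "s q < s k \<longleftrightarrow> t q < t k"
    using J[of p k True] J[of k q True] p above_arc_short[of _ p] above_arc_short[of _ k]
    by (auto simp: k_def q_def)
  have L: "touches_right (desc n s) p \<longleftrightarrow>
    (if s k < s p then \<exists>a. a < k \<and> adj n s k a else \<exists>b. p < b \<and> adj n s b p)"
    using touches_right_desc[OF good_s inj_s p(1)] p by (simp add: k_def)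
  have R: "touches_left (desc n ?N) k \<longleftrightarrow>
    (if t k < t q then \<exists>b. k < b \<and> adj n ?N b k else \<exists>a. a < q \<and> adj n ?N q a)"
    using touches_left_desc[OF good_t inj_nt, of k] p by (simp add: k_def q_def neg_def)
  consider (A) "s k < s p" "s k < s q" | (B) "s p < s k" "s q < s k" | (C) "s p < s k" "s k < s q" | (D) "s k < s p" "s q < s k"
    using ne by linarith
  then have "touches_right (desc n s) p \<longleftrightarrow> \<not> touches_left (desc n ?N) k"
  proof cases
    case A
    then have At: "t k < t p" "t k < t q" using pk kq ne by auto
    obtain x where x: "adj n s k x"
      using first_crossing[OF inj_s V(1,2) A(1), of "\<lambda>z. z = k"] ord by auto
    obtain y where y: "adj n t k y"
      using first_crossing[OF inj_t V(3,2) At(2), of "\<lambda>z. z = k"] ord by auto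
    have "x \<noteq> k" "y \<noteq> k" using x y by (auto simp: adj_def)
    have eqs: "k - 1 = p" "1 < k" "k \<le> n" using p by (auto simp: k_def)
    have iff: "x < k \<longleftrightarrow> y < k"
    proof (rule ccontr)
      assume "\<not> ?thesis"
      then consider "x < k" "k < y" | "k < x" "y < k" using \<open>x \<noteq> k\<close> \<open>y \<noteq> k\<close> by linarith
      then show False
        using class_successor1[of k x y] class_successor2[of k x y] A At eqs ord x y by cases auto
    qed
    have ux: "x' = x" if "adj n s k x'" for x'
    proof -
      have "s x' = s x" using adj_unique that x by blast
      then show ?thesis using inj_s that x unfolding adj_def inj_on_def by blast
    qed
    have uy: "y' = y" if "adj n t k y'" for y'
    proof -
      have "t y' = t y" using adj_unique that y by blast
      then show ?thesis using inj_t that y unfolding adj_def inj_on_def by blast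
    qed
    have "(\<exists>a. a < k \<and> adj n s k a) \<longleftrightarrow> x < k" using x ux by blast
    then have "touches_right (desc n s) p \<longleftrightarrow> x < k" unfolding L by (simp only: A if_True)
    moreover have "(\<exists>b. k < b \<and> adj n t k b) \<longleftrightarrow> k < y" using y uy by blast
    then have "touches_left (desc n ?N) k \<longleftrightarrow> k < y" unfolding R adj_neg by (simp only: At if_True)
    ultimately show ?thesis using iff \<open>y \<noteq> k\<close> by auto
  next
    case B
    then have Bt: "t p < t k" "t q < t k" using pk kq ne by auto
    \<comment> \<open>With \<open>k\<close> on the right of the arc and \<open>q\<close> before
      \<open>k\<close>, only the pair \<open>(p, q)\<close> remains to be tested; so the order of
      \<open>p\<close> and \<open>q\<close> is a class invariant here.\<close>
    have "above_arc u p q (\<not> even k) \<longleftrightarrow> u q < u p" if "u q < u k" for u :: "nat \<Rightarrow> int"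
    proof
      assume "above_arc u p q (\<not> even k)"
      then show "u q < u p" using above_arcD[of u p q _ p q] ord by auto
    next
      assume *: "u q < u p"
      show "above_arc u p q (\<not> even k)"
        unfolding above_arc_def
      proof (intro allI impI)
        fix x y assume **: "p \<le> x \<and> x < y \<and> y \<le> q \<and> (x = p \<or> even x \<noteq> (\<not> even k)) \<and> (y = q \<or> even y = (\<not> even k))"
        then have "y \<noteq> k" using ord by auto
        then have "y = q" "x = p \<or> x = k" using ** ord by auto
        then show "u y < u x" using * that by auto
      qed
    qed
    then have pq: "s q < s p \<longleftrightarrow> t q < t p"
      using J[of p q "\<not> even k"] B Bt V by auto
    \<comment> \<open>A longer arc from \<open>p\<close> has \<open>k\<close> on its right, hence
      \<open>q\<close> on its left and before \<open>p\<close>. Conversely the last descent across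
      the gap above \<open>p\<close> lands on \<open>p\<close>, as one passing \<open>p\<close> and
      \<open>k\<close> would have both on its right.\<close>
    have 1: "(\<exists>b. p < b \<and> adj n s b p) \<longleftrightarrow> s q < s p"
    proof
      assume "\<exists>b. p < b \<and> adj n s b p"
      then obtain b where b: "p < b" "adj n s b p" by blast
      then obtain e where e: "desc n s p b e" using good_s by (auto simp: good_def)
      have sb: "s b < s p" using b by (simp add: adj_def)
      then have "b \<noteq> k" using B by auto
      show "s q < s p"
      proof (cases "b = q")
        case False
        then have "q < b" using b ord \<open>b \<noteq> k\<close> by auto
        then show ?thesis using desc_consecutive[OF e, of k] ord B sb by auto
      qed (use sb in simp)
    next
      assume "s q < s p"
      then obtain b a where ba: "adj n s b a" "p < b" "\<not> p < a" "s a \<le> s p"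
        using last_crossing[OF inj_s V(1,3), of "\<lambda>z. p < z"] ord by auto
      have "a = p"
      proof (rule ccontr)
        assume "a \<noteq> p"
        then have "a < p" using ba by simp
        then have "a < b" using ba by simp
        then obtain e where e: "desc n s a b e" using good_desc[OF good_s ba(1)] by blast
        have "s b < s a" using ba by (simp add: adj_def)
        then have "b \<noteq> k" using ba B by auto
        then have "k < b" using ba ord by auto
        then show False
          using desc_consecutive[OF e, of p] \<open>a < p\<close> ord ba B \<open>s b < s a\<close> by auto
      qed
      then show "\<exists>b. p < b \<and> adj n s b p" using ba by blast
    qed
    have 2: "(\<exists>a. a < q \<and> adj n ?N q a) \<longleftrightarrow> t p < t q"
    proof
      assume "\<exists>a. a < q \<and> adj n ?N q a"
      then obtain a where a: "a < q" "adj n ?N q a" by blast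
      then obtain e where e: "desc n ?N a q e" using good_t by (auto simp: good_def)
      have ta: "t a < t q" using a by (simp add: adj_def neg_def)
      then have "a \<noteq> k" using Bt by auto
      show "t p < t q"
      proof (cases "a = p")
        case False
        then have "a < p" using a ord \<open>a \<noteq> k\<close> by auto
        then have "\<not> ?N p < ?N q" using desc_consecutive[OF e, of p] ord Bt by (auto simp: neg_def)
        then show ?thesis using ne by (auto simp: neg_def)
      qed (use ta in simp)
    next
      assume "t p < t q"
      then have "?N q < ?N p" by (simp add: neg_def)
      then obtain b a where ba: "adj n ?N b a" "q \<le> b" "\<not> q \<le> a" "?N q \<le> ?N b"
        using first_crossing[OF inj_nt V(1,3), of "\<lambda>z. q \<le> z"] ord by auto
      have Nba: "?N b < ?N a" using ba by (simp add: adj_def)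
      have "b = q"
      proof (rule ccontr)
        assume "b \<noteq> q"
        then have "q < b" using ba by simp
        then have "a < b" using ba by simp
        then obtain e where e: "desc n ?N a b e" using good_desc[OF good_t ba(1)] by blast
        have "a \<noteq> k" using ba Bt Nba by (auto simp: neg_def)
        then have "a < k" using ba ord by auto
        have "?N q \<noteq> ?N b"
          using inj_nt V ba \<open>b \<noteq> q\<close> unfolding inj_on_def adj_def by metis
        then show False
          using desc_consecutive[OF e, of k] \<open>a < k\<close> \<open>q < b\<close> ord ba Bt by (auto simp: neg_def)
      qed
      then show "\<exists>a. a < q \<and> adj n ?N q a" using ba by (auto simp: not_le)
    qed
    show ?thesis unfolding L R using 1 2 pq B Bt ne by auto
  next
    case C
    then have Ct: "t p < t k" "t k < t q" using pk kq ne by auto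
    \<comment> \<open>Such an arc would pass \<open>k\<close> and \<open>q\<close> with both on its
      right.\<close>
    have "\<not> (p < b \<and> adj n s b p)" for b
    proof
      assume b: "p < b \<and> adj n s b p"
      then obtain e where e: "desc n s p b e" using good_s by (auto simp: good_def)
      have "s b < s p" using b by (simp add: adj_def)
      then have "b \<noteq> k" "b \<noteq> q" using C by auto
      then have "q < b" using b ord by auto
      then show False using desc_consecutive[OF e, of k] ord C \<open>s b < s p\<close> by auto
    qed
    moreover have "\<exists>b. k < b \<and> adj n ?N b k"
    proof -
      have "?N q < ?N k" using Ct by (simp add: neg_def)
      then obtain b a where ba: "adj n ?N b a" "k < b" "\<not> k < a" "?N a \<le> ?N k"
        using last_crossing[OF inj_nt V(2,3), of "\<lambda>z. k < z"] ord by auto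
      have Nba: "?N b < ?N a" using ba by (simp add: adj_def)
      have "a = k"
      proof (rule ccontr)
        assume "a \<noteq> k"
        then have "a < k" using ba by simp
        then have "a < b" using ba by simp
        then obtain e where e: "desc n ?N a b e" using good_desc[OF good_t ba(1)] by blast
        have "a \<noteq> p" using ba Ct by (auto simp: neg_def)
        then have "a < p" using \<open>a < k\<close> ord by auto
        then show False
          using desc_consecutive[OF e, of p] ord ba Ct Nba by (auto simp: neg_def)
      qed
      then show ?thesis using ba by blast
    qed
    ultimately show ?thesis unfolding L R using C Ct by auto
  next
    case D
    then have Dt: "t k < t p" "t q < t k" using pk kq ne by auto
    have "\<exists>a. a < k \<and> adj n s k a"
    proof -
      obtain b a where ba: "adj n s b a" "k \<le> b" "\<not> k \<le> a" "s k \<le> s b"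
        using first_crossing[OF inj_s V(1,2) D(1), of "\<lambda>z. k \<le> z"] ord by auto
      have "b = k"
      proof (rule ccontr)
        assume "b \<noteq> k"
        then have "k < b" using ba by simp
        then have "a < b" using ba by simp
        then obtain e where e: "desc n s a b e" using good_desc[OF good_s ba(1)] by blast
        have "b \<noteq> q" using ba D by auto
        then have "q < b" using \<open>k < b\<close> ord by auto
        moreover have "s k \<noteq> s b" using inj_s V ba \<open>b \<noteq> k\<close> unfolding inj_on_def adj_def by metis
        ultimately show False
          using desc_consecutive[OF e, of k] ord ba D by auto
      qed
      then show ?thesis using ba by (auto simp: not_le)
    qed
    moreover have "\<not> (a < q \<and> adj n ?N q a)" for a
    proof
      assume a: "a < q \<and> adj n ?N q a"
      then obtain e where e: "desc n ?N a q e" using good_t by (auto simp: good_def)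
      have "t a < t q" using a by (simp add: adj_def neg_def)
      then have "a \<noteq> k" "a \<noteq> p" using Dt by auto
      then have "a < p" using a ord by auto
      then show False using desc_consecutive[OF e, of p] ord Dt by (auto simp: neg_def)
    qed
    ultimately show ?thesis unfolding L R using D Dt by auto
  qed
  then show ?thesis by (simp add: k_def)
qed

end

section \<open>Arc diagrams\<close>

text \<open>An undone descent is an ascent along the same arc; the parity is negated because
  reversal exchanges the sides.\<close>

lemma desc_swap_neg:
  assumes d: "desc n s a b e" and inj: "inj_on s {1..n+1}"
  shows "desc n (neg (s \<circ> transpose b a)) a b (\<not> e)"
proof -
  have ba: "adj n s b a" "a < b" using d by (auto simp: desc_def)
  have "adj n (neg (s \<circ> transpose b a)) b a"
    unfolding adj_neg using adj_swap[OF ba(1) inj] .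
  moreover have "neg (s \<circ> transpose b a) c < neg (s \<circ> transpose b a) b \<longleftrightarrow> even c = (\<not> e)"
    if c: "a < c" "c < b" for c
  proof -
    have "(s \<circ> transpose b a) c = s c" "(s \<circ> transpose b a) b = s a" using c by auto
    moreover have "s a < s c \<longleftrightarrow> \<not> s c < s b"
      using desc_right[OF d inj c] c d ba by (auto simp: desc_def adj_def)
    ultimately show ?thesis using c d by (auto simp: desc_def neg_def)
  qed
  ultimately show ?thesis using ba by (simp add: desc_def)
qed

text \<open>The exchange loses only the inversion \<open>(c, d)\<close>. If the arc forced it,
  \<open>d\<close> would stand at or before \<open>b\<close> and \<open>c\<close> at or after
  \<open>a\<close>, and adjacency of \<open>d\<close> and \<open>c\<close> would make the two arcs
  equal.\<close>

lemma above_arc_swap_other: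
  assumes d: "desc n s a b e" and cd: "adj n s d c" "c < d" and ne: "(a, b) \<noteq> (c, d)"
    and inj: "inj_on s {1..n+1}"
  shows "above_arc (s \<circ> transpose d c) a b e"
proof -
  have ab: "1 \<le> a" "a < b" "b \<le> n + 1" using desc_bounds[OF d] by auto
  have V: "c \<in> {1..n+1}" "d \<in> {1..n+1}" "a \<in> {1..n+1}" "b \<in> {1..n+1}" using cd ab by (auto simp: adj_def)
  have "\<not> jrep n a b e d < jrep n a b e c"
  proof
    assume "jrep n a b e d < jrep n a b e c"
    then have *: "a \<le> c" "d \<le> b" "c = a \<or> even c \<noteq> e" "d = b \<or> even d = e"
      using jrep_inversion[of c d n a b e] V cd ab by auto
    have 1: "s d \<le> s b" using * desc_left[OF d, of d] cd by (cases "d = b") auto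
    have 2: "s a \<le> s c" using * desc_right[OF d inj, of c] cd by (cases "c = a") auto
    have 3: "s b < s a" using d by (simp add: desc_def adj_def)
    have "s d = s b"
      using adjD[OF cd(1) inj V(4)] 1 2 3 by force
    moreover have "s a = s c"
      using adjD[OF cd(1) inj V(3)] 1 2 3 by force
    ultimately show False using ne inj V by (auto dest: inj_onD simp del: atLeastAtMost_iff)
  qed
  moreover have "jrep n a b e c \<noteq> jrep n a b e d"
    using inj_ne[OF inj_on_jrep[OF ab(2)] V(1,2)] cd by auto
  ultimately have "jrep n a b e c < jrep n a b e d" by simp
  then have "weak_le n (jrep n a b e) (s \<circ> transpose d c)"
    using weak_le_swap[OF _ cd(1) inj] jrep_weak_le[OF ab] desc_above_arc[OF d inj] by blast
  then show ?thesis using jrep_weak_le[OF ab] by blast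
qed

text \<open>The last clause stands in for noncrossing: each join-irreducible of the diagram lies
  below the meet-irreducible of every other arc. The second clause keeps both encodings of a unit
  arc, so that diagrams can be compared as relations.\<close>

definition arc_diagram :: "nat \<Rightarrow> (nat \<Rightarrow> nat \<Rightarrow> bool \<Rightarrow> bool) \<Rightarrow> bool" where
  "arc_diagram n D \<longleftrightarrow> (\<forall>a b e. D a b e \<longrightarrow> 1 \<le> a \<and> a < b \<and> b \<le> n + 1) \<and>
     (\<forall>a e f. D a (Suc a) e \<longrightarrow> D a (Suc a) f) \<and>
     (\<forall>a b e f. D a b e \<longrightarrow> D a b f \<longrightarrow> b = Suc a \<or> e = f) \<and>
     (\<forall>a b e c d f. D a b e \<longrightarrow> D c d f \<longrightarrow> (a, b) \<noteq> (c, d) \<longrightarrow> weak_le n (jrep n a b e) (mrep n c d f))"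

lemma arc_diagram_bounds: "arc_diagram n D \<Longrightarrow> D a b e \<Longrightarrow> 1 \<le> a \<and> a < b \<and> b \<le> n + 1"
  unfolding arc_diagram_def by (elim conjE) blast

lemma desc_parity_unique: "desc n s a b e \<Longrightarrow> desc n s a b f \<Longrightarrow> b = Suc a \<or> e = f"
proof (rule ccontr)
  assume *: "desc n s a b e" "desc n s a b f" "\<not> (b = Suc a \<or> e = f)"
  then have "a < Suc a" "Suc a < b" by (auto simp: desc_def)
  then show False using * unfolding desc_def by blast
qed

text \<open>Undoing the descent \<open>(c, d)\<close> gives an element between the two
  irreducibles.\<close>

lemma weak_le_jrep_mrep:
  assumes "desc n s a b e" "desc n s c d f" "(a, b) \<noteq> (c, d)" "inj_on s {1..n+1}"
  shows "weak_le n (jrep n a b e) (mrep n c d f)"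
proof -
  have cd: "adj n s d c" "c < d" using assms by (auto simp: desc_def)
  have b1: "1 \<le> a" "a < b" "b \<le> n + 1" and b2: "1 \<le> c" "c < d" "d \<le> n + 1"
    using desc_bounds assms by auto
  let ?s = "s \<circ> transpose d c"
  have inj: "inj_on ?s {1..n+1}" using inj_on_swap[of d n c s] assms(4) b2 by auto
  have "weak_le n (jrep n a b e) ?s"
    using above_arc_swap_other[OF assms(1) cd assms(3,4)] jrep_weak_le[OF b1] by blast
  moreover have "inj_on (neg ?s) {1..n+1}" using inj by (simp only: inj_on_neg)
  then have "above_arc (neg ?s) c d (\<not> f)"
    using desc_above_arc[OF desc_swap_neg[OF assms(2,4)]] by blast
  then have "weak_le n ?s (mrep n c d f)" using weak_le_mrep[OF b2 inj] by blast
  ultimately show ?thesis by (rule weak_le_trans)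
qed

lemma arc_diagram_desc:
  assumes "inj_on s {1..n+1}"
  shows "arc_diagram n (desc n s)"
  unfolding arc_diagram_def
proof (intro conjI)
  show "\<forall>a e f. desc n s a (Suc a) e \<longrightarrow> desc n s a (Suc a) f"
    using desc_short unfolding desc_def by blast
  show "\<forall>a b e. desc n s a b e \<longrightarrow> 1 \<le> a \<and> a < b \<and> b \<le> n + 1"
    using desc_bounds by blast
  show "\<forall>a b e f. desc n s a b e \<longrightarrow> desc n s a b f \<longrightarrow> b = Suc a \<or> e = f"
    using desc_parity_unique by blast
  show "\<forall>a b e c d f. desc n s a b e \<longrightarrow> desc n s c d f \<longrightarrow> (a, b) \<noteq> (c, d) \<longrightarrow>
      weak_le n (jrep n a b e) (mrep n c d f)"
    using weak_le_jrep_mrep assms by blast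
qed

text \<open>Reversal carries the compatibility of two arcs to their mirror images with the roles of
  the two arcs exchanged, and the condition ranges over both orders.\<close>

lemma arc_diagram_mirror:
  assumes "arc_diagram n D"
  shows "arc_diagram n (\<lambda>a b e. D a b (\<not> e))"
proof -
  have "weak_le n (jrep n a b e) (mrep n c d f)"
    if "D a b (\<not> e)" "D c d (\<not> f)" "(a, b) \<noteq> (c, d)" for a b c d e f
  proof -
    have lt: "a < b" "c < d" using assms that by (auto simp: arc_diagram_def)
    have "weak_le n (jrep n c d (\<not> f)) (mrep n a b (\<not> e))"
      using assms that unfolding arc_diagram_def by blast
    then have "weak_le n (jrep n c d (\<not> f)) (neg (jrep n a b e))" by (simp add: mrep_def)
    then have "weak_le n (neg (neg (jrep n a b e))) (neg (jrep n c d (\<not> f)))"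
      using weak_le_neg[of "neg (jrep n a b e)" n "jrep n c d (\<not> f)"] inj_on_jrep lt inj_on_neg by blast
    then show ?thesis by (simp only: mrep_def neg_neg)
  qed
  then show ?thesis using assms unfolding arc_diagram_def by blast
qed

lemma desc_jrep:
  assumes "1 \<le> a" "a < b" "b \<le> n + 1"
  shows "desc n (jrep n a b e) a b e"
  using assms by (auto simp: desc_def adj_def jrep_def)

lemma adj_jrep:
  assumes "1 \<le> a" "a < b" "b \<le> n + 1" "adj n (jrep n a b e) d c" "c < d"
  shows "c = a \<and> d = b"
proof -
  let ?j = "jrep n a b e"
  have V: "1 \<le> c" "c < d" "d \<le> n + 1" "?j d < ?j c" using assms by (auto simp: adj_def)
  then have *: "a \<le> c" "d \<le> b" "c = a \<or> even c \<noteq> e" "d = b \<or> even d = e"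
    using jrep_inversion[of c d n a b e] assms by auto
  note adjd = adjD[OF assms(4) inj_on_jrep[OF assms(2)]]
  have "d = b"
  proof (rule ccontr)
    assume "d \<noteq> b"
    moreover have "b \<in> {1..n+1}" "b \<noteq> c" using assms * V by auto
    ultimately show False using adjd[of b] * V assms by (auto simp: jrep_def split: if_splits)
  qed
  moreover have "c = a"
  proof (rule ccontr)
    assume "c \<noteq> a"
    moreover have "a \<in> {1..n+1}" "a \<noteq> d" using assms * V by auto
    ultimately show False using adjd[of a] * V assms by (auto simp: jrep_def split: if_splits)
  qed
  ultimately show ?thesis by simp
qed

lemma desc_jrep_iff:
  assumes "1 \<le> a" "a < b" "b \<le> n + 1"
  shows "desc n (jrep n a b e) c d f \<longleftrightarrow> c = a \<and> d = b \<and> (b = Suc a \<or> e = f)"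
proof
  assume *: "desc n (jrep n a b e) c d f"
  then have "c = a \<and> d = b" using adj_jrep[OF assms] by (auto simp: desc_def)
  then show "c = a \<and> d = b \<and> (b = Suc a \<or> e = f)"
    using desc_parity_unique[OF desc_jrep[OF assms]] * by blast
next
  assume "c = a \<and> d = b \<and> (b = Suc a \<or> e = f)"
  then show "desc n (jrep n a b e) c d f"
    using desc_jrep[OF assms] desc_short unfolding desc_def by blast
qed

lemma good_jrep: "1 \<le> a \<Longrightarrow> a < b \<Longrightarrow> b \<le> n + 1 \<Longrightarrow> good n (jrep n a b e)"
  unfolding good_def using adj_jrep desc_jrep by blast

text \<open>The only inversion that the join-irreducible loses when its descent is undone is
  \<open>(a, b)\<close>.\<close>

lemma jrep_swap_weak_le:
  assumes "1 \<le> a" "a < b" "b \<le> n + 1"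
    and "\<And>i j. a \<le> i \<Longrightarrow> i < j \<Longrightarrow> j \<le> b \<Longrightarrow> i = a \<or> even i \<noteq> e \<Longrightarrow> j = b \<or> even j = e \<Longrightarrow>
      (i, j) \<noteq> (a, b) \<Longrightarrow> s j < s i"
  shows "weak_le n (jrep n a b e \<circ> transpose b a) s"
  unfolding weak_le_def
proof (intro ballI impI)
  let ?j = "jrep n a b e"
  have ad: "adj n ?j b a" using desc_jrep[OF assms(1-3)] by (simp add: desc_def)
  fix i j assume *: "i \<in> {1..n+1}" "j \<in> {1..n+1}" "i < j" "(?j \<circ> transpose b a) j < (?j \<circ> transpose b a) i"
  have "(i, j) \<noteq> (a, b)" using * ad by (auto simp: adj_def)
  moreover have "?j j < ?j i"
    using weak_le_swap_same[OF ad assms(2) inj_on_jrep[OF assms(2)]] * unfolding weak_le_def by blast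
  ultimately show "s j < s i"
    using assms(4)[of i j] jrep_inversion[of i j n a b e] * assms(2) by auto
qed

text \<open>The permutation is the join of the join-irreducibles of the diagram. Replacing one of them by
  its lower cover yields a strictly smaller join (it lies below the corresponding meet-irreducible),
  which forces the arc to be a descent.\<close>
lemma exists_desc_eq:
  assumes D: "arc_diagram n D"
  shows "\<exists>s. inj_on s {1..n+1} \<and> good n s \<and> desc n s = D"
proof -
  have bd: "1 \<le> a" "a < b" "b \<le> n + 1" if "D a b e" for a b e using D that by (auto simp: arc_diagram_def)
  have twin: "D a (Suc a) f" if "D a (Suc a) e" for a e f using D that unfolding arc_diagram_def by blast
  have uniq: "b = Suc a \<or> e = f" if "D a b e" "D a b f" for a b e f using D that unfolding arc_diagram_def by blast
  have compat: "weak_le n (jrep n a b e) (mrep n c d f)" if "D a b e" "D c d f" "(a, b) \<noteq> (c, d)" for a b e c d f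
    using D that unfolding arc_diagram_def by blast
  have same: "above_arc s a b f" if "D a b e" "D a b f" "above_arc s a b e" for s a b e f
    using uniq[OF that(1,2)] that(3) above_arc_short by blast
  let ?F = "{jrep n a b e | a b e. D a b e}"
  have injF: "inj_on s {1..n+1}" if "s \<in> ?F" for s using that bd inj_on_jrep by blast
  obtain x where "is_join n ?F x" using exists_join[OF injF] by blast
  note x = is_joinD[OF this]
  have Jx: "above_arc x a b e" if "D a b e" for a b e
    using x(2) jrep_weak_le[OF bd[OF that]] that by blast
  have x_le: "weak_le n x u" if "inj_on u {1..n+1}" "\<And>a b e. D a b e \<Longrightarrow> above_arc u a b e" for u
    using x(3)[OF that(1)] that(2) jrep_weak_le bd by blast
  \<comment> \<open>\<open>x\<close> is the least upper bound, so after undoing any descent some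
    join-irreducible of the diagram no longer lies below.\<close>
  have not_le: "\<exists>c d g. D c d g \<and> \<not> above_arc (x \<circ> transpose b a) c d g" if ba: "adj n x b a" "a < b" for a b
  proof (rule ccontr)
    assume *: "\<not> ?thesis"
    have V: "a \<in> {1..n+1}" "b \<in> {1..n+1}" "x b < x a" using ba by (auto simp: adj_def)
    then have "inj_on (x \<circ> transpose b a) {1..n+1}" using inj_on_swap x(1) by blast
    then have "weak_le n x (x \<circ> transpose b a)" using x_le * by blast
    then have "(x \<circ> transpose b a) b < (x \<circ> transpose b a) a" using V ba(2) unfolding weak_le_def by blast
    then show False using V by simp
  qed
  have desc_D: "desc n x a b e" if ab: "D a b e" for a b e
  proof -
    note bd' = bd[OF ab]
    have V: "a \<in> {1..n+1}" "b \<in> {1..n+1}" using bd' by auto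
    have ad: "adj n (jrep n a b e) b a" using desc_jrep[OF bd'] by (simp add: desc_def)
    let ?j = "jrep n a b e \<circ> transpose b a"
    \<comment> \<open>The other generators are selected by their ends, so for a unit arc its second
      encoding is removed as well.\<close>
    let ?F' = "insert ?j {jrep n c d f | c d f. D c d f \<and> (c, d) \<noteq> (a, b)}"
    have inj_j: "inj_on ?j {1..n+1}" using inj_on_swap[OF V(2,1) inj_on_jrep[OF bd'(2)]] .
    have injF': "inj_on s {1..n+1}" if "s \<in> ?F'" for s using that inj_j injF by blast
    obtain x' where "is_join n ?F' x'" using exists_join[OF injF'] by blast
    note x' = is_joinD[OF this]
    have jx: "weak_le n (jrep n a b e) x" using Jx[OF ab] jrep_weak_le[OF bd'] by blast
    have "weak_le n ?j x"
      using weak_le_swap_same[OF ad bd'(2) inj_on_jrep[OF bd'(2)]] jx by (rule weak_le_trans)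
    then have x'x: "weak_le n x' x" using x'(3)[OF x(1)] x(2) by blast
    have "weak_le n ?j (mrep n a b e)"
    proof (rule jrep_swap_weak_le[OF bd'])
      fix i j assume *: "a \<le> i" "i < j" "j \<le> b" "i = a \<or> even i \<noteq> e" "j = b \<or> even j = e" "(i, j) \<noteq> (a, b)"
      then have ij: "i \<in> {1..n+1}" "j \<in> {1..n+1}" "1 \<le> i" "j \<le> n + 1" using bd' by auto
      have "\<not> jrep n a b (\<not> e) j < jrep n a b (\<not> e) i"
        using jrep_inversion[OF ij(3) *(2) ij(4) bd'(2)] * by auto
      moreover have "jrep n a b (\<not> e) i \<noteq> jrep n a b (\<not> e) j"
        using inj_ne[OF inj_on_jrep[OF bd'(2)] ij(1,2)] *(2) by blast
      ultimately show "mrep n a b e j < mrep n a b e i" by (simp add: mrep_def neg_def)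
    qed
    then have x'm: "weak_le n x' (mrep n a b e)"
      using x'(3)[OF inj_on_mrep[OF bd'(2)]] compat ab by blast
    \<comment> \<open>Otherwise the join-irreducible of the arc would lie below its own
      meet-irreducible, where \<open>a\<close> stands before \<open>b\<close>.\<close>
    have "\<not> weak_le n x x'"
    proof
      assume "weak_le n x x'"
      then have "weak_le n (jrep n a b e) (mrep n a b e)" using jx x'm weak_le_trans by blast
      then have "mrep n a b e b < mrep n a b e a"
        using V bd'(2) ad unfolding weak_le_def adj_def by blast
      then show False using bd' by (simp add: mrep_def neg_def jrep_def)
    qed
    then obtain a' b' where ab': "a' < b'" "adj n x b' a'" "x' a' < x' b'"
      using exists_descent[OF x'x _ x(1) x'(1)] by blast
    let ?s = "x \<circ> transpose b' a'"
    have x's: "weak_le n x' ?s" using weak_le_swap[OF x'x ab'(2) x(1) ab'(3)] .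
    have V': "a' \<in> {1..n+1}" "b' \<in> {1..n+1}" using ab' by (auto simp: adj_def)
    \<comment> \<open>\<open>?s\<close> is above \<open>x'\<close> and so keeps all other arcs;
      hence the arc lost by undoing \<open>(a', b')\<close> is \<open>(a, b)\<close>.\<close>
    have "\<not> above_arc ?s a b e"
    proof
      assume *: "above_arc ?s a b e"
      have "above_arc ?s c d f" if "D c d f" for c d f
      proof (cases "(c, d) = (a, b)")
        case True
        then show ?thesis using same[OF ab] that * by blast
      next
        case False
        then have "weak_le n (jrep n c d f) x'" using that x'(2) by blast
        then have "weak_le n (jrep n c d f) ?s" using x's weak_le_trans by blast
        then show ?thesis using jrep_weak_le[OF bd[OF that]] by blast
      qed
      then show False using not_le[OF ab'(2,1)] by blast
    qed
    then obtain i j where ij: "a \<le> i" "i < j" "j \<le> b" "i = a \<or> even i \<noteq> e" "j = b \<or> even j = e"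
        "\<not> ?s j < ?s i"
      unfolding above_arc_def by blast
    have Vij: "i \<in> {1..n+1}" "j \<in> {1..n+1}" "1 \<le> i" "j \<le> n + 1" using ij bd' by auto
    \<comment> \<open>The lowered generator is still below \<open>?s\<close>, so the lost inversion
      is the one that it lacks, \<open>(a, b)\<close>; and \<open>?s\<close> lacks no inversion of
      \<open>x\<close> except \<open>(a', b')\<close>.\<close>
    have "weak_le n ?j ?s" using x'(2)[of ?j] x's weak_le_trans by blast
    then have "\<not> ?j j < ?j i" using ij(2,6) Vij unfolding weak_le_def by blast
    moreover have jij: "jrep n a b e j < jrep n a b e i"
      using jrep_inversion[OF Vij(3) ij(2) Vij(4) bd'(2)] ij by blast
    ultimately have "{j, i} = {b, a}"
      using swap_less[OF ad inj_on_jrep[OF bd'(2)] Vij(2,1)] by auto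
    then have "i = a" "j = b" using ij(2) bd'(2) by (auto simp: doubleton_eq_iff)
    have "x b < x a" using Jx[OF ab] above_arcD[of x a b e a b] bd' by auto
    then have "{b, a} = {b', a'}"
      using swap_less[OF ab'(2) x(1) V(2,1)] ij(6) \<open>i = a\<close> \<open>j = b\<close> by auto
    then have "a' = a" "b' = b" using ab' bd' by (auto simp: doubleton_eq_iff)
    then have adx: "adj n x b a" using ab' by simp
    show ?thesis
      unfolding desc_def
    proof (intro conjI allI impI)
      fix c assume c: "a < c \<and> c < b"
      have Vc: "c \<in> {1..n+1}" using c bd' by auto
      have "x c < x a" if "even c = e" using above_arcD[OF Jx[OF ab], of a c] c that by auto
      moreover have "x b < x c" if "even c \<noteq> e" using above_arcD[OF Jx[OF ab], of c b] c that by auto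
      ultimately show "x c < x b \<longleftrightarrow> even c = e"
        using adjD[OF adx x(1) Vc] c \<open>x b < x a\<close> by force
    qed (use bd' adx in auto)
  qed
  \<comment> \<open>A descent outside the diagram could be undone while every arc is kept.\<close>
  have D_ex: "\<exists>e. D a b e" if ba: "adj n x b a" "a < b" for a b
  proof (rule ccontr)
    assume *: "\<not> ?thesis"
    have "above_arc (x \<circ> transpose b a) c d f" if "D c d f" for c d f
    proof -
      have "(c, d) \<noteq> (a, b)" using * that by auto
      then show ?thesis using above_arc_swap_other[OF desc_D[OF that] ba _ x(1)] by blast
    qed
    then show False using not_le[OF ba] by blast
  qed
  have "good n x" unfolding good_def using D_ex desc_D by blast
  moreover have "D a b e" if de: "desc n x a b e" for a b e
  proof -
    have ba: "adj n x b a" "a < b" using de by (auto simp: desc_def)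
    obtain f where "D a b f" using D_ex[OF ba] by blast
    then show ?thesis using desc_parity_unique[OF desc_D de] twin by blast
  qed
  then have "desc n x = D" using desc_D by (intro ext) blast
  ultimately show ?thesis using x(1) by blast
qed

lemma good_desc_eq_weak_le:
  assumes "good n s" "inj_on s {1..n+1}" "inj_on t {1..n+1}" "desc n s = desc n t"
  shows "weak_le n s t"
  using good_weak_le[OF assms(1,2)] desc_above_arc[OF _ assms(3)] assms(4) by metis

section \<open>Words of diagrams\<close>

text \<open>Reading the gaps \<open>1, \<dots>, n\<close> upwards on the right and then downwards on the left, and negating
  every other letter, turns rowmotion into rotation.\<close>
definition diagram_word :: "nat \<Rightarrow> (nat \<Rightarrow> nat \<Rightarrow> bool \<Rightarrow> bool) \<Rightarrow> nat set" where
  "diagram_word n D = {i. i < 2 * n \<and>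
     (if i < n then touches_right D (Suc i) else touches_left D (2 * n - i)) \<noteq> even i}"

lemma touches_mirror:
  "touches_right (\<lambda>a b e. D a b (\<not> e)) g \<longleftrightarrow> touches_left D g"
  "touches_left (\<lambda>a b e. D a b (\<not> e)) g \<longleftrightarrow> touches_right D g"
proof -
  have ex: "(\<exists>a b e. D a b (\<not> e) \<and> R a b (\<not> e)) \<longleftrightarrow> (\<exists>a b e. D a b e \<and> R a b e)" for R
  proof
    assume "\<exists>a b e. D a b e \<and> R a b e"
    then obtain a b e where "D a b e \<and> R a b e" by blast
    then show "\<exists>a b e. D a b (\<not> e) \<and> R a b (\<not> e)"
      by (intro exI[of _ a] exI[of _ b] exI[of _ "\<not> e"]) simp
  qed blast
  show "touches_right (\<lambda>a b e. D a b (\<not> e)) g \<longleftrightarrow> touches_left D g"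
    unfolding touches_right_def touches_left_def
    using ex[of "\<lambda>a b e. a = g \<and> even (Suc g) = e \<or> b = Suc g \<and> even g = e"] by auto
  show "touches_left (\<lambda>a b e. D a b (\<not> e)) g \<longleftrightarrow> touches_right D g"
    unfolding touches_right_def touches_left_def
    using ex[of "\<lambda>a b e. a = g \<and> even (Suc g) \<noteq> e \<or> b = Suc g \<and> even g \<noteq> e"] by auto
qed

text \<open>If \<open>n + 1\<close> precedes \<open>n\<close>, it has a successor, which is smaller;
  and a descent starting at \<open>n\<close> can only be the unit arc.\<close>

lemma touches_right_last:
  assumes "good n s" "inj_on s {1..n+1}" "n \<ge> 1"
  shows "touches_right (desc n s) n \<longleftrightarrow> s (Suc n) < s n"
proof (cases "s (Suc n) < s n")
  case True
  have V: "n \<in> {1..n+1}" "Suc n \<in> {1..n+1}" using assms by auto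
  obtain a where a: "adj n s (Suc n) a"
    using first_crossing[OF assms(2) V True, of "\<lambda>z. z = Suc n"] by auto
  then have "a < Suc n" by (auto simp: adj_def le_less)
  then show ?thesis using a True touches_right_desc[OF assms(1,2,3)] by auto
next
  case False
  have "\<not> adj n s b n" if "n < b" for b
  proof
    assume *: "adj n s b n"
    then have "b = Suc n" using that by (auto simp: adj_def)
    then show False using * False by (simp add: adj_def)
  qed
  then show ?thesis using False touches_right_desc[OF assms(1,2,3)] by auto
qed

lemma touches_left_first:
  assumes "good n s" "inj_on s {1..n+1}" "n \<ge> 1"
  shows "touches_left (desc n s) 1 \<longleftrightarrow> s (Suc 1) < s 1"
proof (cases "s (Suc 1) < s 1")
  case True
  have V: "1 \<in> {1..n+1}" "Suc 1 \<in> {1..n+1}" using assms by auto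
  obtain b where b: "adj n s b 1"
    using last_crossing[OF assms(2) V True, of "\<lambda>z. z \<noteq> 1"] by auto
  then have "1 < b" by (auto simp: adj_def le_less)
  then show ?thesis using b True touches_left_desc[OF assms(1,2) order_refl assms(3)] by auto
next
  case False
  have "\<not> adj n s (Suc 1) a" if "a < Suc 1" for a
  proof
    assume *: "adj n s (Suc 1) a"
    then have "a = 1" using that by (auto simp: adj_def)
    then show False using * False by (simp add: adj_def)
  qed
  then show ?thesis using False touches_left_desc[OF assms(1,2) order_refl assms(3)] by auto
qed

text \<open>\<open>D\<close> is the diagram before rowmotion, \<open>s\<close> and \<open>t\<close>
  are minimum and maximum of the class after it. Within each half of the word the shift is
  \<open>class_touch\<close>, applied to \<open>s\<close> and \<open>t\<close> on the right and to
  the reversed pair on the left. At the turns, gaps \<open>n\<close> and \<open>1\<close>, touching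
  is one order comparison, which is constant on the class and reversed by
  \<open>neg\<close>.\<close>

lemma diagram_word_rot:
  assumes n: "n \<ge> 1" and good: "good n s" "good n (neg t)"
    and inj: "inj_on s {1..n+1}" "inj_on t {1..n+1}"
    and J: "\<And>a b e. 1 \<le> a \<Longrightarrow> b \<le> n + 1 \<Longrightarrow> above_arc s a b e \<longleftrightarrow> above_arc t a b e"
    and M: "\<And>a b e. 1 \<le> a \<Longrightarrow> b \<le> n + 1 \<Longrightarrow> above_arc (neg s) a b e \<longleftrightarrow> above_arc (neg t) a b e"
    and D: "\<And>a b e. desc n (neg t) a b e \<longleftrightarrow> D a b (\<not> e)"
  shows "diagram_word n (desc n s) = rot (2 * n) (diagram_word n D)"
proof -
  have dt: "desc n (neg t) = (\<lambda>a b e. D a b (\<not> e))" using D by (intro ext) simp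
  have inj': "inj_on (neg t) {1..n+1}" "inj_on (neg s) {1..n+1}" using inj by (simp_all only: inj_on_neg)
  have right: "touches_right (desc n s) p \<longleftrightarrow> \<not> touches_right D (Suc p)" if "1 \<le> p" "Suc p \<le> n" for p
    using class_touch[OF good inj J M that] unfolding dt touches_mirror .
  have "touches_right (desc n (neg t)) p \<longleftrightarrow> \<not> touches_left (desc n (neg (neg s))) (Suc p)"
    if "1 \<le> p" "Suc p \<le> n" for p
    by (rule class_touch[OF good(2) _ inj'(1,2) _ _ that]) (simp_all add: good J M)
  then have left: "touches_left D p \<longleftrightarrow> \<not> touches_left (desc n s) (Suc p)" if "1 \<le> p" "Suc p \<le> n" for p
    using that unfolding dt touches_mirror neg_neg .
  have "s (Suc n) < s n \<longleftrightarrow> t (Suc n) < t n" "s (Suc 1) < s 1 \<longleftrightarrow> t (Suc 1) < t 1"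
    using J[of n "Suc n" True] J[of 1 "Suc 1" True] n above_arc_short by auto
  moreover have "t (Suc n) \<noteq> t n" "t (Suc 1) \<noteq> t 1"
    using n inj_ne[OF inj(2), of "Suc n" n] inj_ne[OF inj(2), of "Suc 1" 1] by auto
  moreover have "touches_right (desc n (neg t)) n \<longleftrightarrow> neg t (Suc n) < neg t n"
    "touches_left (desc n (neg t)) 1 \<longleftrightarrow> neg t (Suc 1) < neg t 1"
    using touches_right_last[OF good(2) inj'(1) n] touches_left_first[OF good(2) inj'(1) n] by auto
  moreover note touches_right_last[OF good(1) inj(1) n] touches_left_first[OF good(1) inj(1) n]
  ultimately have last: "touches_right (desc n s) n \<longleftrightarrow> \<not> touches_left D n"
    and first: "touches_left (desc n s) 1 \<longleftrightarrow> \<not> touches_right D 1"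
    unfolding dt touches_mirror by (auto simp: neg_def)
  show ?thesis
  proof (rule Set.set_eqI)
    fix i
    consider "i \<ge> 2 * n" | "Suc i < n" | "Suc i = n" | "n \<le> i" "Suc i < 2 * n" | "n \<le> i" "Suc i = 2 * n"
      by linarith
    then show "i \<in> diagram_word n (desc n s) \<longleftrightarrow> i \<in> rot (2 * n) (diagram_word n D)"
    proof cases
      case 1
      then show ?thesis by (simp add: diagram_word_def rot_def)
    next
      case 2
      then show ?thesis using right[of "Suc i"] by (auto simp: mem_rot diagram_word_def)
    next
      case 3
      then have "2 * n - Suc i = n" by simp
      then show ?thesis using 3 last n by (auto simp: mem_rot diagram_word_def)
    next
      case 4
      then have "Suc (2 * n - Suc i) = 2 * n - i" "1 \<le> 2 * n - Suc i" "2 * n - i \<le> n" by auto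
      then show ?thesis using 4 left[of "2 * n - Suc i"] by (auto simp: mem_rot diagram_word_def)
    next
      case 5
      then have "2 * n - i = 1" by simp
      then show ?thesis using 5 first n by (auto simp: mem_rot diagram_word_def)
    qed
  qed
qed

text \<open>Every arc touches one gap at an even and one at an odd position of the word.\<close>
lemma diagram_word_base:
  assumes D: "arc_diagram n D"
    and E: "diagram_word n D \<subseteq> {i. i < 2 * n \<and> even i} \<or> {i. i < 2 * n \<and> even i} \<subseteq> diagram_word n D"
  shows "\<not> D a b e"
proof
  assume ab: "D a b e"
  then have bd: "1 \<le> a" "a < b" "b \<le> n + 1" using D by (auto simp: arc_diagram_def)
  define z where "z i = (if i < n then touches_right D (Suc i) else touches_left D (2 * n - i))" for i
  have *: "(\<exists>i < 2 * n. even i = (\<not> e) \<and> z i) \<and> (\<exists>i < 2 * n. even i = e \<and> z i)"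
  proof
    show "\<exists>i < 2 * n. even i = (\<not> e) \<and> z i"
    proof (cases "even (Suc a) = e")
      case True
      then have "touches_left D a" using ab unfolding touches_left_def by blast
      then show ?thesis using True bd by (intro exI[of _ "2 * n - a"]) (auto simp: z_def)
    next
      case False
      then have "touches_right D a" using ab unfolding touches_right_def by blast
      then show ?thesis using False bd by (intro exI[of _ "a - 1"]) (auto simp: z_def)
    qed
    obtain g where g: "b = Suc g" using bd by (cases b) auto
    show "\<exists>i < 2 * n. even i = e \<and> z i"
    proof (cases "even g = e")
      case True
      then have "touches_left D g" using ab g unfolding touches_left_def by blast
      then show ?thesis using True bd g by (intro exI[of _ "2 * n - g"]) (auto simp: z_def)
    next
      case False
      then have "touches_right D g" using ab g unfolding touches_right_def by blast
      then show ?thesis using False bd g by (intro exI[of _ "g - 1"]) (auto simp: z_def)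
    qed
  qed
  then obtain i j where "i < 2 * n" "even i" "z i" "j < 2 * n" "odd j" "z j"
    by (metis (full_types))
  then have "i \<notin> diagram_word n D" "j \<in> diagram_word n D" by (auto simp: diagram_word_def z_def)
  then show False using E \<open>i < 2 * n\<close> \<open>even i\<close> \<open>odd j\<close> by blast
qed

text \<open>The arc \<open>(1, 2)\<close> touches only gap \<open>1\<close>, and that on both sides:
  letters \<open>0\<close> and \<open>2 * n - 1\<close>.\<close>

definition toggle_first :: "(nat \<Rightarrow> nat \<Rightarrow> bool \<Rightarrow> bool) \<Rightarrow> nat \<Rightarrow> nat \<Rightarrow> bool \<Rightarrow> bool" where
  "toggle_first D a b e \<longleftrightarrow> D a b e \<noteq> (a = 1 \<and> b = Suc 1)"

lemma toggle_first_toggle_first: "toggle_first (toggle_first D) = D"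
  by (auto simp: toggle_first_def fun_eq_iff)

lemma toggle_first:
  assumes n: "n \<ge> 1" and D: "arc_diagram n D"
    and ne: "(0 \<in> diagram_word n D) \<noteq> (2 * n - 1 \<in> diagram_word n D)"
  shows "arc_diagram n (toggle_first D)"
    and "diagram_word n (toggle_first D) = flip2 0 (2 * n - 1) (diagram_word n D)"
proof -
  obtain s where s: "inj_on s {1..n+1}" "good n s" "desc n s = D" using exists_desc_eq[OF D] by blast
  have "2 * n - (2 * n - 1) = 1" "\<not> 2 * n - 1 < n" "odd (2 * n - 1)" using n by auto
  \<comment> \<open>Positions \<open>0\<close> and \<open>2 * n - 1\<close> differ in parity, so
    differing letters mean that gap \<open>1\<close> is touched on both sides or on neither.\<close>
  then have tt: "touches_right D 1 \<longleftrightarrow> touches_left D 1"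
    using ne n by (auto simp: diagram_word_def)
  \<comment> \<open>An arc from \<open>1\<close> touches gap \<open>1\<close>, so both sides are
    touched. Hence \<open>2\<close> precedes \<open>1\<close>, and the touch on the right is an arc
    ending at \<open>2\<close>, which starts at \<open>1\<close>.\<close>
  have short: "D 1 (Suc 1) f" if "D 1 b e" for b e f
  proof -
    have "touches_right D 1 \<or> touches_left D 1"
      using that unfolding touches_right_def touches_left_def by blast
    then have r: "touches_right D 1" and l: "touches_left D 1" using tt by auto
    have "s (Suc 1) < s 1" using touches_left_first[OF s(2,1) n] l s(3) by simp
    then obtain a where "a < Suc 1" "adj n s (Suc 1) a"
      using touches_right_desc[OF s(2,1) order_refl n] r s(3) by auto
    moreover have "a = 1" using calculation by (auto simp: adj_def)
    ultimately show ?thesis using desc_short[of n s 1] s(3) by simp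
  qed
  have only: "b = Suc 1" if "D 1 b e" for b e
  proof -
    have "desc n s 1 (Suc 1) e" "desc n s 1 b e" using short[OF that] that s(3) by auto
    then have *: "adj n s (Suc 1) 1" "adj n s b 1" by (auto simp: desc_def)
    then have V: "Suc 1 \<in> {1..n+1}" "b \<in> {1..n+1}" "s (Suc 1) < s 1" "s b < s 1" by (auto simp: adj_def)
    show ?thesis
    proof (rule ccontr)
      assume "b \<noteq> Suc 1"
      then show False
        using adjD[OF *(1) s(1) V(2)] adjD[OF *(2) s(1) V(1)] V by auto
    qed
  qed
  show "arc_diagram n (toggle_first D)"
  proof -
    have bd: "1 \<le> a" "a < b" "b \<le> n + 1" if "D a b e" for a b e using D that by (auto simp: arc_diagram_def)
    have two: "(1 :: nat) \<le> 1" "1 < Suc 1" "Suc 1 \<le> n + 1" using n by auto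
    \<comment> \<open>An arc starting above \<open>1\<close> leaves \<open>1\<close> before
      \<open>2\<close> in its join-irreducible and \<open>2\<close> before \<open>1\<close> in its
      meet-irreducible, so it is compatible with the unit arc in both orders.\<close>
    have j1: "weak_le n (jrep n 1 (Suc 1) e) (mrep n c d f)" if "D c d f" "c \<noteq> 1" for c d e f
    proof -
      note bd' = bd[OF that(1)]
      have "1 < c" using bd' that by auto
      then have "jrep n c d (\<not> f) 1 < jrep n c d (\<not> f) (Suc 1)" using bd' by (auto simp: jrep_def)
      then have "above_arc (mrep n c d f) 1 (Suc 1) e"
        unfolding above_arc_short mrep_def neg_def by simp
      then show ?thesis using jrep_weak_le[OF two] by blast
    qed
    have j2: "weak_le n (jrep n c d f) (mrep n 1 (Suc 1) e)" if "D c d f" "c \<noteq> 1" for c d e f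
    proof -
      note bd' = bd[OF that(1)]
      have "1 < c" using bd' that by auto
      then have "jrep n c d f 1 < jrep n c d f (Suc 1)" using bd' by (auto simp: jrep_def)
      then have "above_arc (neg (jrep n c d f)) 1 (Suc 1) (\<not> e)"
        unfolding above_arc_short neg_def by simp
      then show ?thesis using weak_le_mrep[OF two inj_on_jrep[OF bd'(2)]] by blast
    qed
    have T: "toggle_first D a b e \<Longrightarrow> a = 1 \<and> b = Suc 1 \<or> D a b e \<and> a \<noteq> 1" for a b e
      using only by (auto simp: toggle_first_def)
    show ?thesis
      unfolding arc_diagram_def
    proof (intro conjI allI impI)
      fix a b e assume "toggle_first D a b e"
      then show "1 \<le> a" "a < b" "b \<le> n + 1" using T[of a b e] bd[of a b e] two by auto
    next
      fix a e f assume "toggle_first D a (Suc a) e"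
      moreover have "D a (Suc a) e \<longleftrightarrow> D a (Suc a) f" using D unfolding arc_diagram_def by blast
      ultimately show "toggle_first D a (Suc a) f" by (simp add: toggle_first_def)
    next
      fix a b e f assume "toggle_first D a b e" "toggle_first D a b f"
      then show "b = Suc a \<or> e = f" using T[of a b e] T[of a b f] D unfolding arc_diagram_def by blast
    next
      fix a b e c d f assume *: "toggle_first D a b e" "toggle_first D c d f" "(a, b) \<noteq> (c, d)"
      have compat: "D a b e \<Longrightarrow> D c d f \<Longrightarrow> weak_le n (jrep n a b e) (mrep n c d f)"
        using D *(3) unfolding arc_diagram_def by blast
      from T[OF *(1)] T[OF *(2)] show "weak_le n (jrep n a b e) (mrep n c d f)"
      proof (elim disjE conjE)
        assume "a = 1" "b = Suc 1" "c = 1" "d = Suc 1"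
        then show ?thesis using *(3) by simp
      qed (use j1 j2 compat in simp_all)
    qed
  qed
  have r: "touches_right (toggle_first D) g \<longleftrightarrow> touches_right D g \<noteq> (g = 1)"
    and l: "touches_left (toggle_first D) g \<longleftrightarrow> touches_left D g \<noteq> (g = 1)" if "1 \<le> g" for g
  proof -
    have off: "touches_right (toggle_first D) g \<longleftrightarrow> touches_right D g"
      "touches_left (toggle_first D) g \<longleftrightarrow> touches_left D g" if "g \<noteq> 1"
    proof -
      have "toggle_first D a b e \<longleftrightarrow> D a b e" if "a = g \<or> b = Suc g" for a b e
        using that \<open>g \<noteq> 1\<close> by (auto simp: toggle_first_def)
      then show "touches_right (toggle_first D) g \<longleftrightarrow> touches_right D g"
        "touches_left (toggle_first D) g \<longleftrightarrow> touches_left D g"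
        unfolding touches_right_def touches_left_def by blast+
    qed
    have on: "touches_right D 1 \<longleftrightarrow> \<not> touches_right (toggle_first D) 1"
      "touches_left D 1 \<longleftrightarrow> \<not> touches_left (toggle_first D) 1"
    proof -
      have a1: "a = 1" if "D a (Suc 1) e" for a e using D that unfolding arc_diagram_def by fastforce
      have 1: "touches_right D 1 \<longleftrightarrow> D 1 (Suc 1) True" "touches_left D 1 \<longleftrightarrow> D 1 (Suc 1) True"
        using short a1 unfolding touches_right_def touches_left_def by (metis (full_types))+
      have T: "toggle_first D a b e \<and> (a = 1 \<or> b = Suc 1) \<longleftrightarrow> a = 1 \<and> b = Suc 1 \<and> \<not> D 1 (Suc 1) True" for a b e
        using only short a1 unfolding toggle_first_def by (metis (full_types))
      have 2: "touches_right (toggle_first D) 1 \<longleftrightarrow> \<not> D 1 (Suc 1) True"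
        "touches_left (toggle_first D) 1 \<longleftrightarrow> \<not> D 1 (Suc 1) True"
        unfolding touches_right_def touches_left_def using T by (metis (full_types))+
      show "touches_right D 1 \<longleftrightarrow> \<not> touches_right (toggle_first D) 1"
        "touches_left D 1 \<longleftrightarrow> \<not> touches_left (toggle_first D) 1" using 1 2 by auto
    qed
    show "touches_right (toggle_first D) g \<longleftrightarrow> touches_right D g \<noteq> (g = 1)"
      "touches_left (toggle_first D) g \<longleftrightarrow> touches_left D g \<noteq> (g = 1)"
      using off on by (cases "g = 1"; simp)+
  qed
  show "diagram_word n (toggle_first D) = flip2 0 (2 * n - 1) (diagram_word n D)"
  proof (rule Set.set_eqI)
    fix i
    consider "i < n" | "n \<le> i" "i < 2 * n" | "2 * n \<le> i" by linarith
    then show "i \<in> diagram_word n (toggle_first D) \<longleftrightarrow> i \<in> flip2 0 (2 * n - 1) (diagram_word n D)"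
    proof cases
      case 1
      then have "i \<noteq> 2 * n - 1" by simp
      then show ?thesis using 1 r[of "Suc i"] by (auto simp: diagram_word_def flip2_def)
    next
      case 2
      then have "2 * n - i = 1 \<longleftrightarrow> i = 2 * n - 1" "1 \<le> 2 * n - i" "i \<noteq> 0" using n by auto
      then show ?thesis using 2 l[of "2 * n - i"] by (auto simp: diagram_word_def flip2_def)
    next
      case 3
      then show ?thesis using n by (auto simp: diagram_word_def flip2_def)
    qed
  qed
qed

section \<open>Permutations and their classes\<close>

definition pos :: "(nat \<Rightarrow> nat) \<Rightarrow> nat \<Rightarrow> int" where
  "pos w x = int (inv w x)"

lemma inj_on_pos:
  assumes "w permutes S" shows "inj_on (pos w) A"
proof -
  have "inj (inv w)" using permutes_inj[OF permutes_inv[OF assms]] .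
  then show ?thesis by (auto simp: pos_def inj_on_def)
qed

lemma pos_swap:
  assumes "w permutes S"
  shows "pos (transpose a b \<circ> w) = pos w \<circ> transpose a b"
proof -
  have "inv (transpose a b \<circ> w) = inv w \<circ> transpose a b"
    using o_inv_distrib[of "transpose a b" w] permutes_bij[OF assms] by simp
  then show ?thesis by (simp add: pos_def fun_eq_iff)
qed

definition same_order :: "nat \<Rightarrow> (nat \<Rightarrow> int) \<Rightarrow> (nat \<Rightarrow> int) \<Rightarrow> bool" where
  "same_order n s t \<longleftrightarrow> (\<forall>x\<in>{1..n+1}. \<forall>y\<in>{1..n+1}. s x < s y \<longleftrightarrow> t x < t y)"

lemma same_orderD: "same_order n s t \<Longrightarrow> x \<in> {1..n+1} \<Longrightarrow> y \<in> {1..n+1} \<Longrightarrow> s x < s y \<longleftrightarrow> t x < t y"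
  by (simp add: same_order_def)

lemma same_order_neg: "same_order n s t \<Longrightarrow> same_order n (neg s) (neg t)"
  by (simp add: same_order_def neg_def)

lemma adj_same_order: "same_order n s t \<Longrightarrow> adj n s x y \<longleftrightarrow> adj n t x y"
  unfolding adj_def same_order_def by metis

lemma desc_same_order:
  assumes "same_order n s t"
  shows "desc n s a b e \<longleftrightarrow> desc n t a b e"
proof (cases "a < b \<and> adj n s b a")
  case True
  then have V: "a \<in> {1..n+1}" "b \<in> {1..n+1}" by (auto simp: adj_def)
  then have "s c < s b \<longleftrightarrow> t c < t b" if "a < c \<and> c < b" for c
    using same_orderD[OF assms, of c b] that by auto
  then show ?thesis using True adj_same_order[OF assms] unfolding desc_def by auto
next
  case False
  then show ?thesis using adj_same_order[OF assms] unfolding desc_def by auto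
qed

lemma good_same_order: "same_order n s t \<Longrightarrow> good n s \<longleftrightarrow> good n t"
  by (simp add: good_def adj_same_order desc_same_order)

lemma weak_le_same_order:
  assumes "same_order n s t"
  shows "weak_le n s u \<longleftrightarrow> weak_le n t u" "weak_le n u s \<longleftrightarrow> weak_le n u t"
  using assms unfolding weak_le_def same_order_def by blast+

lemma same_order_weak_le:
  assumes "weak_le n s t" "weak_le n t s" "inj_on s {1..n+1}" "inj_on t {1..n+1}"
  shows "same_order n s t"
proof -
  have *: "s y < s x \<longleftrightarrow> t y < t x" if "x \<in> {1..n+1}" "y \<in> {1..n+1}" "x < y" for x y
    using assms(1,2) that unfolding weak_le_def by blast
  have ne: "s x \<noteq> s y" "t x \<noteq> t y" if "x \<in> {1..n+1}" "y \<in> {1..n+1}" "x < y" for x y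
    using inj_ne[OF assms(3) that(1,2)] inj_ne[OF assms(4) that(1,2)] that(3) by auto
  show ?thesis
    unfolding same_order_def
  proof (intro ballI)
    fix x y assume xy: "x \<in> {1..n+1}" "y \<in> {1..n+1}"
    consider "x = y" | "x < y" | "y < x" by linarith
    then show "s x < s y \<longleftrightarrow> t x < t y"
    proof cases
      case 2
      then show ?thesis using *[OF xy] ne[OF xy] by linarith
    next
      case 3
      then show ?thesis using *[OF xy(2,1)] by blast
    qed simp
  qed
qed

text \<open>Positions are ranks, so the relative order determines the permutation.\<close>

lemma card_positions:
  assumes "w permutes {1..n+1}" "x \<in> {1..n+1}"
  shows "card {z \<in> {1..n+1}. pos w z \<le> pos w x} = inv w x"
proof -
  note p = permutes_inv[OF assms(1)]
  have "inv w ` {z \<in> {1..n+1}. pos w z \<le> pos w x} = {1..inv w x}"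
  proof (intro subset_antisym subsetI)
    fix i assume "i \<in> inv w ` {z \<in> {1..n+1}. pos w z \<le> pos w x}"
    then show "i \<in> {1..inv w x}" using permutes_in_image[OF p] by (auto simp: pos_def)
  next
    fix i assume i: "i \<in> {1..inv w x}"
    moreover have "inv w x \<in> {1..n+1}" using permutes_in_image[OF p] assms(2) by blast
    ultimately have "w i \<in> {1..n+1}" using permutes_in_image[OF assms(1)] by auto
    moreover have "inv w (w i) = i" using permutes_inverses(2)[OF assms(1)] .
    ultimately show "i \<in> inv w ` {z \<in> {1..n+1}. pos w z \<le> pos w x}"
      using i by (intro image_eqI[of _ _ "w i"]) (auto simp: pos_def)
  qed
  moreover have "inj_on (inv w) {z \<in> {1..n+1}. pos w z \<le> pos w x}"
    using permutes_inj[OF p] by (rule inj_on_subset) simp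
  ultimately show ?thesis by (metis card_atLeastAtMost card_image diff_Suc_1)
qed

lemma permutes_eqI:
  assumes w: "w permutes {1..n+1}" and v: "v permutes {1..n+1}" and "same_order n (pos w) (pos v)"
  shows "w = v"
proof -
  have "inv w x = inv v x" for x
  proof (cases "x \<in> {1..n+1}")
    case True
    have "{z \<in> {1..n+1}. pos w z \<le> pos w x} = {z \<in> {1..n+1}. pos v z \<le> pos v x}"
      using same_orderD[OF assms(3) True] by (auto simp: not_less[symmetric] simp del: atLeastAtMost_iff)
    then show ?thesis using card_positions[OF w True] card_positions[OF v True] by simp
  next
    case False
    then show ?thesis using permutes_not_in[OF permutes_inv[OF w]] permutes_not_in[OF permutes_inv[OF v]] by simp
  qed
  then have "inv w = inv v" by (rule ext)
  then show ?thesis by (metis permutes_inv_inv[OF w] permutes_inv_inv[OF v])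
qed

text \<open>Standardisation: replacing positions by ranks gives the inverse of the permutation
  sought.\<close>

lemma exists_permutation:
  assumes inj: "inj_on s {1..n+1}"
  shows "\<exists>w. w permutes {1..n+1} \<and> same_order n (pos w) s"
proof -
  let ?V = "{1..n+1}"
  define p where "p x = (if x \<in> ?V then card {z \<in> ?V. s z \<le> s x} else x)" for x
  have mono: "p x < p y" if "x \<in> ?V" "y \<in> ?V" "s x < s y" for x y
  proof -
    have "{z \<in> ?V. s z \<le> s x} \<subseteq> {z \<in> ?V. s z \<le> s y}"
      using that(3) by force
    moreover have "y \<in> {z \<in> ?V. s z \<le> s y}" "y \<notin> {z \<in> ?V. s z \<le> s x}"
      using that(2,3) by simp_all
    ultimately have "{z \<in> ?V. s z \<le> s x} \<subset> {z \<in> ?V. s z \<le> s y}" by blast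
    then have "card {z \<in> ?V. s z \<le> s x} < card {z \<in> ?V. s z \<le> s y}" by (simp add: psubset_card_mono)
    then show ?thesis using that by (simp add: p_def del: atLeastAtMost_iff)
  qed
  have iff: "p x < p y \<longleftrightarrow> s x < s y" if "x \<in> ?V" "y \<in> ?V" for x y
  proof (cases "x = y")
    case False
    then have "s x \<noteq> s y" using inj_ne[OF inj that] by blast
    then show ?thesis using mono[OF that] mono[OF that(2,1)] by linarith
  qed simp
  have inj_p: "inj_on p ?V"
  proof (rule inj_onI)
    fix x y assume "x \<in> ?V" "y \<in> ?V" "p x = p y"
    then show "x = y" using iff[of x y] iff[of y x] inj by (metis inj_onD less_irrefl linorder_neqE)
  qed
  have "p ` ?V \<subseteq> ?V"
  proof
    fix i assume "i \<in> p ` ?V"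
    then obtain x where x: "x \<in> ?V" "i = card {z \<in> ?V. s z \<le> s x}" by (auto simp: p_def simp del: atLeastAtMost_iff)
    have "i \<le> card ?V" unfolding x(2) by (rule card_mono) auto
    moreover have "i > 0" unfolding x(2) using x(1) by (auto simp: card_gt_0_iff simp del: atLeastAtMost_iff)
    ultimately show "i \<in> ?V" by simp
  qed
  then have "p ` ?V = ?V" using inj_p endo_inj_surj by blast
  then have "p permutes ?V"
    using inj_p by (intro bij_imp_permutes) (simp_all add: bij_betw_def p_def del: atLeastAtMost_iff)
  then have "inv p permutes ?V" "inv (inv p) = p" by (simp_all add: permutes_inv permutes_inv_inv)
  then show ?thesis using iff by (intro exI[of _ "inv p"]) (simp add: same_order_def pos_def)
qed

definition perm_of :: "nat \<Rightarrow> (nat \<Rightarrow> int) \<Rightarrow> nat \<Rightarrow> nat" where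
  "perm_of n s = (SOME w. w permutes {1..n+1} \<and> same_order n (pos w) s)"

lemma perm_of:
  assumes "inj_on s {1..n+1}"
  shows "perm_of n s permutes {1..n+1}" "same_order n (pos (perm_of n s)) s"
  using someI_ex[OF exists_permutation[OF assms]] unfolding perm_of_def by blast+

lemma inversions_subset_iff:
  assumes w: "w permutes {1..n+1}"
  shows "inversions w \<subseteq> inversions v \<longleftrightarrow> weak_le n (pos w) (pos v)"
proof -
  have V: "i \<in> {1..n+1} \<and> j \<in> {1..n+1}" if "i < j" "inv w j < inv w i" for i j
  proof -
    note p = permutes_inv[OF w]
    have out: "inv w x = x" if "x \<notin> {1..n+1}" for x using permutes_not_in[OF p that] .
    have "x \<in> {1..n+1} \<Longrightarrow> inv w x \<in> {1..n+1}" for x using permutes_in_image[OF p] by blast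
    then have bd: "x \<in> {1..n+1} \<Longrightarrow> 1 \<le> inv w x \<and> inv w x \<le> n + 1" for x by auto
    show ?thesis
      using that out[of i] out[of j] bd[of i] bd[of j]
      by (cases "i \<in> {1..n+1}"; cases "j \<in> {1..n+1}") auto
  qed
  show ?thesis
  proof
    assume "inversions w \<subseteq> inversions v"
    then show "weak_le n (pos w) (pos v)" by (auto simp: inversions_def weak_le_def pos_def)
  next
    assume le: "weak_le n (pos w) (pos v)"
    show "inversions w \<subseteq> inversions v"
    proof (clarsimp simp: inversions_def)
      fix i j assume ij: "i < j" "inv w j < inv w i"
      from V[OF this] show "inv v j < inv v i" using le ij unfolding weak_le_def pos_def by auto
    qed
  qed
qed

section \<open>Valid swaps of permutations and class invariants\<close>

lemma valid_swap_vswap: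
  assumes "valid_swap n w v"
  shows "v permutes {1..n+1} \<and> vswap n (pos w) (pos v)"
proof -
  obtain p a b k m where *: "w permutes {1..n+1}" "p \<in> {1..n}" "{w p, w (p + 1)} = {a, b}" "a < k" "k < m" "m < b"
    "even k \<noteq> even m" "inv w k < p \<and> inv w m < p \<or> inv w k > p + 1 \<and> inv w m > p + 1" "v = transpose a b \<circ> w"
    using assms unfolding valid_swap_def by blast
  let ?x = "w p" and ?y = "w (p + 1)"
  have inv: "inv w ?x = p" "inv w ?y = p + 1" using permutes_inverses(2)[OF *(1)] by auto
  have V: "?x \<in> {1..n+1}" "?y \<in> {1..n+1}" using permutes_in_image[OF *(1)] *(2) by auto
  have mm: "min ?x ?y = a" "max ?x ?y = b" using *(3-6) by (auto simp: doubleton_eq_iff)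
  have ad: "adj n (pos w) ?x ?y" using V inv by (auto simp: adj_def pos_def)
  have "transpose a b = transpose ?x ?y" using *(3) by (metis doubleton_eq_iff transpose_commute)
  then have "pos v = pos w \<circ> transpose ?x ?y" using pos_swap[OF *(1)] *(9) by simp
  moreover have "pos w k < pos w ?x \<and> pos w m < pos w ?x \<or> pos w ?y < pos w k \<and> pos w ?y < pos w m"
    using *(8) inv by (auto simp: pos_def)
  ultimately have "vswap n (pos w) (pos v)"
    unfolding vswap_def using ad mm *(4-7) by blast
  moreover have "v permutes {1..n+1}"
    unfolding *(9) using *(1,3) V by (intro permutes_compose permutes_swap_id) (auto simp: doubleton_eq_iff)
  ultimately show ?thesis by simp
qed

lemma vswap_valid_swap:
  assumes w: "w permutes {1..n+1}" and "vswap n (pos w) t"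
  shows "\<exists>v. valid_swap n w v \<and> pos v = t"
proof -
  obtain u v k m where *: "adj n (pos w) u v" "min u v < k" "k < m" "m < max u v" "even k \<noteq> even m"
     "pos w k < pos w u \<and> pos w m < pos w u \<or> pos w v < pos w k \<and> pos w v < pos w m" "t = pos w \<circ> transpose u v"
    using assms by (auto simp: vswap_def)
  let ?p = "inv w u"
  have V: "u \<in> {1..n+1}" "v \<in> {1..n+1}" "inv w u < inv w v" using *(1) by (auto simp: adj_def pos_def)
  have pV: "inv w u \<in> {1..n+1}" "inv w v \<in> {1..n+1}"
    using permutes_in_image[OF permutes_inv[OF w]] V by blast+
  have next_pos: "inv w v = ?p + 1"
  proof (rule ccontr)
    assume "inv w v \<noteq> ?p + 1"
    then have lt: "?p + 1 < inv w v" using V by simp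
    then have "w (?p + 1) \<in> {1..n+1}" using permutes_in_image[OF w] pV by auto
    moreover have "inv w (w (?p + 1)) = ?p + 1" using permutes_inverses(2)[OF w] .
    then have "pos w u < pos w (w (?p + 1)) \<and> pos w (w (?p + 1)) < pos w v" using lt by (simp add: pos_def)
    ultimately show False using *(1) unfolding adj_def by blast
  qed
  have wp: "w ?p = u" "w (?p + 1) = v" using permutes_inverses(1)[OF w] next_pos by metis+
  have mm: "{w ?p, w (?p + 1)} = {min u v, max u v}" unfolding wp by (auto simp: min_def max_def)
  have tr: "transpose (min u v) (max u v) = transpose u v"
    by (metis max_def min_def transpose_commute)
  have p: "?p \<in> {1..n}" using pV next_pos by auto
  have side: "inv w k < ?p \<and> inv w m < ?p \<or> inv w k > ?p + 1 \<and> inv w m > ?p + 1"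
    using *(6) next_pos by (auto simp: pos_def)
  have "valid_swap n w (transpose (min u v) (max u v) \<circ> w)"
    unfolding valid_swap_def using w p mm *(2-5) side by blast
  then show ?thesis using pos_swap[OF w] *(7) tr by metis
qed

text \<open>Stands in for the equivalence: valid swaps preserve it, and it separates class
  minima.\<close>

definition class_eq :: "nat \<Rightarrow> (nat \<Rightarrow> int) \<Rightarrow> (nat \<Rightarrow> int) \<Rightarrow> bool" where
  "class_eq n s t \<longleftrightarrow> (\<forall>a b e. 1 \<le> a \<longrightarrow> b \<le> n + 1 \<longrightarrow> (above_arc s a b e \<longleftrightarrow> above_arc t a b e) \<and>
     (above_arc (neg s) a b e \<longleftrightarrow> above_arc (neg t) a b e))"

lemma class_eqD:
  assumes "class_eq n s t" "1 \<le> a" "b \<le> n + 1"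
  shows "above_arc s a b e \<longleftrightarrow> above_arc t a b e" "above_arc (neg s) a b e \<longleftrightarrow> above_arc (neg t) a b e"
  using assms unfolding class_eq_def by blast+

lemma class_eq_sym: "class_eq n s t \<Longrightarrow> class_eq n t s"
  unfolding class_eq_def by blast

lemma class_eq_trans: "class_eq n s t \<Longrightarrow> class_eq n t u \<Longrightarrow> class_eq n s u"
  unfolding class_eq_def by blast

lemma biCambrian_equiv_vswaps:
  assumes "biCambrian_equiv n w v" "w permutes {1..n+1}"
  shows "v permutes {1..n+1} \<and> (vswap n)\<^sup>*\<^sup>* (pos w) (pos v)"
  using assms(1) unfolding biCambrian_equiv_def
proof induction
  case (step u v)
  then show ?case using valid_swap_vswap[OF step(2)] by (meson rtranclp.rtrancl_into_rtrancl)
qed (use assms in simp)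

lemma vswaps_class_eq:
  assumes "(vswap n)\<^sup>*\<^sup>* s t" "inj_on s {1..n+1}"
  shows "class_eq n s t"
proof -
  have "(vswap n)\<^sup>*\<^sup>* (neg s) (neg t)"
    using assms(1) by induction (use vswap_neg in \<open>auto intro: rtranclp.rtrancl_into_rtrancl\<close>)
  moreover have "inj_on (neg s) {1..n+1}" using assms(2) by (simp only: inj_on_neg)
  ultimately show ?thesis
    using vswaps_above_arc assms unfolding class_eq_def by blast
qed

lemma biCambrian_equiv_class_eq:
  assumes "biCambrian_equiv n w v" "w permutes {1..n+1}"
  shows "class_eq n (pos w) (pos v)"
  using biCambrian_equiv_vswaps[OF assms] vswaps_class_eq inj_on_pos[OF assms(2)] by blast

lemma vswaps_biCambrian_equiv:
  assumes "(vswap n)\<^sup>*\<^sup>* (pos w) t" "w permutes {1..n+1}"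
  shows "\<exists>v. biCambrian_equiv n w v \<and> pos v = t"
  using assms(1)
proof induction
  case base
  then show ?case by (auto simp: biCambrian_equiv_def)
next
  case (step t u)
  then obtain v where v: "biCambrian_equiv n w v" "pos v = t" by blast
  have "v permutes {1..n+1}" using biCambrian_equiv_vswaps[OF v(1) assms(2)] by blast
  then obtain v' where "valid_swap n v v'" "pos v' = u" using vswap_valid_swap step(2) v(2) by blast
  moreover have "biCambrian_equiv n w v'"
    using v(1) calculation(1) unfolding biCambrian_equiv_def by simp
  ultimately show ?case by blast
qed

section \<open>Class minima and maxima\<close>

definition bottoms :: "nat \<Rightarrow> (nat \<Rightarrow> nat) set" where
  "bottoms n = {w. w permutes {1..n+1} \<and> good n (pos w)}"

lemma bottomsD: "w \<in> bottoms n \<Longrightarrow> w permutes {1..n+1}" "w \<in> bottoms n \<Longrightarrow> good n (pos w)"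
  by (auto simp: bottoms_def)

lemma finite_bottoms: "finite (bottoms n)"
  by (rule finite_subset[OF _ finite_permutations[of "{1..n+1}"]]) (auto simp: bottoms_def)

lemma bottom_weak_le:
  assumes x: "x \<in> bottoms n" and "\<And>a b e. desc n (pos x) a b e \<Longrightarrow> above_arc t a b e"
  shows "weak_le n (pos x) t"
  using good_weak_le[OF bottomsD(2)[OF x] inj_on_pos[OF bottomsD(1)[OF x]]] assms(2) by blast

text \<open>Lying above a class minimum is decided by the arcs of its descents, and these are class
  invariants.\<close>

lemma bottom_weak_le_class:
  assumes x: "x \<in> bottoms n" and "class_eq n s t"
  shows "weak_le n (pos x) s \<longleftrightarrow> weak_le n (pos x) t"
proof -
  have *: "weak_le n (pos x) t" if "weak_le n (pos x) s" "class_eq n s t" for s t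
  proof (rule bottom_weak_le[OF x])
    fix a b e assume d: "desc n (pos x) a b e"
    note bd = desc_bounds[OF d]
    have "above_arc (pos x) a b e" using desc_above_arc[OF d inj_on_pos[OF bottomsD(1)[OF x]]] .
    then have "above_arc s a b e" using above_arc_mono[OF that(1)] bd by blast
    then show "above_arc t a b e" using class_eqD(1)[OF that(2)] bd by blast
  qed
  show ?thesis using * assms(2) class_eq_sym by blast
qed

lemma bottoms_eqI:
  assumes "x \<in> bottoms n" "y \<in> bottoms n" "class_eq n (pos x) (pos y)"
  shows "x = y"
proof -
  have "weak_le n (pos x) (pos x)" "weak_le n (pos y) (pos y)" by (simp_all add: weak_le_def)
  then have "weak_le n (pos x) (pos y)" "weak_le n (pos y) (pos x)"
    using bottom_weak_le_class assms class_eq_sym by blast+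
  then show ?thesis
    using permutes_eqI same_order_weak_le inj_on_pos bottomsD(1) assms(1,2) by metis
qed

text \<open>Removing descents leads to a good \<open>u\<close> in the class of \<open>w\<close>. The
  join-irreducibles of its descents lie below every member of the class, hence so does
  \<open>u\<close>.\<close>

lemma pi_down:
  assumes w: "w permutes {1..n+1}"
  shows "pi_down n w \<in> bottoms n" "class_eq n (pos w) (pos (pi_down n w))"
proof -
  obtain t where "(vswap n)\<^sup>*\<^sup>* (pos w) t" "good n t" using exists_good[OF inj_on_pos[OF w]] by blast
  then obtain u where u: "biCambrian_equiv n w u" "good n (pos u)"
    using vswaps_biCambrian_equiv[OF _ w] by blast
  have perm: "v permutes {1..n+1}" if "biCambrian_equiv n w v" for v
    using biCambrian_equiv_vswaps[OF that w] by blast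
  have uC: "u \<in> bottoms n" using u perm by (simp add: bottoms_def)
  have below: "weak_le n (pos u) (pos v)" if "biCambrian_equiv n w v" for v
  proof -
    have "class_eq n (pos u) (pos v)"
      using biCambrian_equiv_class_eq[OF _ w] that u(1) class_eq_sym class_eq_trans by blast
    moreover have "weak_le n (pos u) (pos u)" by (simp add: weak_le_def)
    ultimately show ?thesis using bottom_weak_le_class[OF uC] by blast
  qed
  have "least (weak_order n) u {v. biCambrian_equiv n w v}"
    using perm u(1) below inversions_subset_iff[OF perm[OF u(1)]] unfolding least_def weak_order_def by auto
  moreover have "v = u" if v: "least (weak_order n) v {v. biCambrian_equiv n w v}" for v
  proof -
    have ev: "biCambrian_equiv n w v" and "inversions v \<subseteq> inversions u"
      using v u(1) unfolding least_def weak_order_def by auto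
    then have "weak_le n (pos v) (pos u)" using inversions_subset_iff[OF perm[OF ev]] by blast
    then have "same_order n (pos v) (pos u)"
      using same_order_weak_le below[OF ev] inj_on_pos[OF perm[OF ev]] inj_on_pos[OF perm[OF u(1)]] by blast
    then show ?thesis using permutes_eqI[OF perm[OF ev] perm[OF u(1)]] by blast
  qed
  ultimately have "pi_down n w = u" unfolding pi_down_def by (rule the_equality)
  then show "pi_down n w \<in> bottoms n" "class_eq n (pos w) (pos (pi_down n w))"
    using uC biCambrian_equiv_class_eq[OF u(1) w] by simp_all
qed

lemma pi_down_bottom: "x \<in> bottoms n \<Longrightarrow> pi_down n x = x"
  using bottoms_eqI pi_down[of x n] class_eq_sym bottomsD(1) by metis

text \<open>The search for a good element, carried out in the reversed order.\<close>

lemma exists_top: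
  assumes w: "w permutes {1..n+1}"
  shows "\<exists>t. t permutes {1..n+1} \<and> class_eq n (pos w) (pos t) \<and> good n (neg (pos t))"
proof -
  have "inj_on (neg (pos w)) {1..n+1}" unfolding inj_on_neg using inj_on_pos[OF w] .
  then obtain t where t: "(vswap n)\<^sup>*\<^sup>* (neg (pos w)) t" "good n t" using exists_good by blast
  have "(vswap n)\<^sup>*\<^sup>* (neg (neg (pos w))) (neg t)"
    using t(1) by induction (use vswap_neg in \<open>auto intro: rtranclp.rtrancl_into_rtrancl\<close>)
  then obtain v where v: "biCambrian_equiv n w v" "pos v = neg t"
    using vswaps_biCambrian_equiv[OF _ w] by auto
  then show ?thesis
    using biCambrian_equiv_vswaps[OF v(1) w] biCambrian_equiv_class_eq[OF v(1) w] t(2) by auto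
qed

lemma carrier_biCambrian: "carrier (biCambrian_lattice n) = bottoms n"
  using pi_down pi_down_bottom bottomsD(1)
  by (force simp: biCambrian_lattice_def weak_order_def)

lemma le_biCambrian:
  "x \<in> bottoms n \<Longrightarrow> le (biCambrian_lattice n) x y \<longleftrightarrow> weak_le n (pos x) (pos y)"
  using inversions_subset_iff[OF bottomsD(1)] by (simp add: biCambrian_lattice_def weak_order_def)

lemma eq_biCambrian: "eq (biCambrian_lattice n) x y \<longleftrightarrow> x = y"
  by (simp add: biCambrian_lattice_def)

section \<open>Labels of cover relations\<close>

lemma weak_le_refl: "weak_le n s s"
  by (simp add: weak_le_def)

lemma permutes_weak_le_antisym:
  assumes "w permutes {1..n+1}" "v permutes {1..n+1}" "weak_le n (pos w) (pos v)" "weak_le n (pos v) (pos w)"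
  shows "w = v"
  using permutes_eqI[OF assms(1,2)] same_order_weak_le[OF assms(3,4)] inj_on_pos assms(1,2) by blast

lemma weak_le_pi_down:
  assumes "x \<in> bottoms n" "w permutes {1..n+1}"
  shows "weak_le n (pos x) (pos (pi_down n w)) \<longleftrightarrow> weak_le n (pos x) (pos w)"
  using bottom_weak_le_class[OF assms(1) pi_down(2)[OF assms(2)]] by blast

lemma pi_down_weak_le:
  assumes "w permutes {1..n+1}"
  shows "weak_le n (pos (pi_down n w)) (pos w)"
  using weak_le_pi_down[OF pi_down(1)[OF assms] assms] weak_le_refl by blast

lemma above_arc_pi_down:
  assumes "w permutes {1..n+1}" "1 \<le> a" "b \<le> n + 1"
  shows "above_arc (pos (pi_down n w)) a b e \<longleftrightarrow> above_arc (pos w) a b e"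
    "above_arc (neg (pos (pi_down n w))) a b e \<longleftrightarrow> above_arc (neg (pos w)) a b e"
  using class_eqD[OF pi_down(2)[OF assms(1)] assms(2,3)] by blast+

lemma above_arc_neg_mono:
  assumes "weak_le n (pos x) (pos y)" "x permutes {1..n+1}" "y permutes {1..n+1}"
    "1 \<le> a" "b \<le> n + 1" "above_arc (neg (pos y)) a b e"
  shows "above_arc (neg (pos x)) a b e"
proof -
  have "weak_le n (neg (pos y)) (neg (pos x))"
    using weak_le_neg inj_on_pos assms(1-3) by blast
  then show ?thesis using above_arc_mono assms(4-6) by blast
qed

lemma not_above_arc_swap:
  assumes "adj n s b a" "a < b"
  shows "\<not> above_arc (s \<circ> transpose b a) a b e"
proof
  assume "above_arc (s \<circ> transpose b a) a b e"
  from above_arcD[OF this, of a b] show False using assms by (simp add: adj_def)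
qed

lemma swap_permutes:
  assumes "y permutes {1..n+1}" "adj n s b a"
  shows "transpose b a \<circ> y permutes {1..n+1}"
  using assms by (intro permutes_compose permutes_swap_id) (auto simp: adj_def)

text \<open>Candidates for lower covers: undo one descent, then return to the class minimum.\<close>

definition swap_down :: "nat \<Rightarrow> (nat \<Rightarrow> nat) \<Rightarrow> nat \<Rightarrow> nat \<Rightarrow> nat \<Rightarrow> nat" where
  "swap_down n y a b = pi_down n (transpose b a \<circ> y)"

context
  fixes n :: nat and y :: "nat \<Rightarrow> nat"
  assumes y: "y \<in> bottoms n"
begin

lemma
  assumes ba: "adj n (pos y) b a" "a < b"
  shows swap_down_bottoms: "swap_down n y a b \<in> bottoms n"
    and swap_down_weak_le: "weak_le n (pos (swap_down n y a b)) (pos y)"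
    and swap_down_not_above: "\<not> above_arc (pos (swap_down n y a b)) a b e"
    and swap_down_neq: "swap_down n y a b \<noteq> y"
    and above_arc_swap_down: "1 \<le> c \<Longrightarrow> d \<le> n + 1 \<Longrightarrow> above_arc (pos (swap_down n y a b)) c d f \<longleftrightarrow> above_arc (pos y \<circ> transpose b a) c d f"
    and above_arc_neg_swap_down: "1 \<le> c \<Longrightarrow> d \<le> n + 1 \<Longrightarrow> above_arc (neg (pos (swap_down n y a b))) c d f \<longleftrightarrow> above_arc (neg (pos y \<circ> transpose b a)) c d f"
proof -
  note p = bottomsD(1)[OF y]
  note q = swap_permutes[OF p ba(1)]
  note ps = pos_swap[OF p, of b a]
  show 1: "swap_down n y a b \<in> bottoms n" unfolding swap_down_def using pi_down(1)[OF q] .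
  have "weak_le n (pos (swap_down n y a b)) (pos y \<circ> transpose b a)"
    unfolding swap_down_def using pi_down_weak_le[OF q] ps by simp
  then show "weak_le n (pos (swap_down n y a b)) (pos y)"
    using weak_le_swap_same[OF ba inj_on_pos[OF p]] weak_le_trans by blast
  show 2: "1 \<le> c \<Longrightarrow> d \<le> n + 1 \<Longrightarrow> above_arc (pos (swap_down n y a b)) c d f \<longleftrightarrow> above_arc (pos y \<circ> transpose b a) c d f" for c d f
    unfolding swap_down_def using above_arc_pi_down(1)[OF q] ps by simp
  show "1 \<le> c \<Longrightarrow> d \<le> n + 1 \<Longrightarrow> above_arc (neg (pos (swap_down n y a b))) c d f \<longleftrightarrow> above_arc (neg (pos y \<circ> transpose b a)) c d f"
    unfolding swap_down_def using above_arc_pi_down(2)[OF q] ps by simp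
  have bd: "1 \<le> a" "b \<le> n + 1" using ba by (auto simp: adj_def)
  show 3: "\<not> above_arc (pos (swap_down n y a b)) a b e" for e
    using 2[OF bd] not_above_arc_swap[OF ba] by blast
  obtain e where "desc n (pos y) a b e" using good_desc[OF bottomsD(2)[OF y] ba] by blast
  then have "above_arc (pos y) a b e" using desc_above_arc inj_on_pos[OF p] by blast
  then show "swap_down n y a b \<noteq> y" using 3 by metis
qed

text \<open>Some descent of \<open>y\<close> is not an inversion of \<open>x\<close>; undoing it
  stays above \<open>x\<close>, and projecting does too since \<open>x\<close> is a class
  minimum.\<close>

lemma below_swap_down:
  assumes x: "x \<in> bottoms n" and le: "weak_le n (pos x) (pos y)" and ne: "x \<noteq> y"
  shows "\<exists>a b e. desc n (pos y) a b e \<and> weak_le n (pos x) (pos (swap_down n y a b))"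
proof -
  note p = bottomsD(1)[OF y] and px = bottomsD(1)[OF x]
  have "\<not> weak_le n (pos y) (pos x)" using permutes_weak_le_antisym[OF px p le] ne by blast
  then obtain a b where ab: "a < b" "adj n (pos y) b a" "pos x a < pos x b"
    using exists_descent[OF le _ inj_on_pos[OF p] inj_on_pos[OF px]] by blast
  obtain e where e: "desc n (pos y) a b e" using good_desc[OF bottomsD(2)[OF y] ab(2,1)] by blast
  have "weak_le n (pos x) (pos y \<circ> transpose b a)"
    using weak_le_swap[OF le ab(2) inj_on_pos[OF p] ab(3)] .
  then have "weak_le n (pos x) (pos (swap_down n y a b))"
    unfolding swap_down_def using weak_le_pi_down[OF x swap_permutes[OF p ab(2)]] pos_swap[OF p] by simp
  then show ?thesis using e by blast
qed

lemma above_arc_swap_down_other: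
  assumes d: "desc n (pos y) a b e" and "adj n (pos y) d c" "c < d" "(a, b) \<noteq> (c, d)"
  shows "above_arc (pos (swap_down n y c d)) a b e"
  using above_arc_swap_other[OF d assms(2-4) inj_on_pos[OF bottomsD(1)[OF y]]]
    above_arc_swap_down[OF assms(2,3)] desc_bounds[OF d] by blast

end

abbreviation (input) "BL \<equiv> biCambrian_lattice"

section \<open>Cover relations and irreducible elements\<close>

lemma covers_BL:
  "covers (BL n) x y \<longleftrightarrow> x \<in> bottoms n \<and> y \<in> bottoms n \<and> weak_le n (pos x) (pos y) \<and> x \<noteq> y \<and>
     \<not> (\<exists>z\<in>bottoms n. weak_le n (pos x) (pos z) \<and> x \<noteq> z \<and> weak_le n (pos z) (pos y) \<and> z \<noteq> y)"
  unfolding covers_def lless_def carrier_biCambrian eq_biCambrian using le_biCambrian by blast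

text \<open>Everything strictly below \<open>y\<close> lies below some \<open>swap_down\<close>.
  Those of different descents are incomparable: undoing one descent keeps the join-irreducible of
  the other below, while undoing that other one loses it.\<close>

lemma covers_iff:
  "covers (BL n) x y \<longleftrightarrow> y \<in> bottoms n \<and> (\<exists>a b e. desc n (pos y) a b e \<and> x = swap_down n y a b)"
proof
  assume c: "covers (BL n) x y"
  then have x: "x \<in> bottoms n" and y: "y \<in> bottoms n" and le: "weak_le n (pos x) (pos y)" "x \<noteq> y"
    unfolding covers_BL by blast+
  obtain a b e where d: "desc n (pos y) a b e" "weak_le n (pos x) (pos (swap_down n y a b))"
    using below_swap_down[OF y x le] by blast
  then have ba: "adj n (pos y) b a" "a < b" by (auto simp: desc_def)
  then have "x = swap_down n y a b"
    using c d(2) swap_down_bottoms[OF y ba] swap_down_weak_le[OF y ba] swap_down_neq[OF y ba] unfolding covers_BL by blast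
  then show "y \<in> bottoms n \<and> (\<exists>a b e. desc n (pos y) a b e \<and> x = swap_down n y a b)" using y d by blast
next
  assume "y \<in> bottoms n \<and> (\<exists>a b e. desc n (pos y) a b e \<and> x = swap_down n y a b)"
  then obtain a b e where y: "y \<in> bottoms n" and d: "desc n (pos y) a b e" and x: "x = swap_down n y a b" by blast
  then have ba: "adj n (pos y) b a" "a < b" by (auto simp: desc_def)
  have *: "z = x" if z: "z \<in> bottoms n" "weak_le n (pos x) (pos z)" "weak_le n (pos z) (pos y)" "z \<noteq> y" for z
  proof -
    obtain c d' f where cd: "desc n (pos y) c d' f" "weak_le n (pos z) (pos (swap_down n y c d'))"
      using below_swap_down[OF y z(1,3,4)] by blast
    then have dc: "adj n (pos y) d' c" "c < d'" by (auto simp: desc_def)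
    have "(c, d') = (a, b)"
    proof (rule ccontr)
      assume ne: "(c, d') \<noteq> (a, b)"
      then have "above_arc (pos x) c d' f" using above_arc_swap_down_other[OF y cd(1) ba] x by simp
      moreover have "weak_le n (pos x) (pos (swap_down n y c d'))" using z(2) cd(2) weak_le_trans by blast
      ultimately have "above_arc (pos (swap_down n y c d')) c d' f"
        using above_arc_mono desc_bounds[OF cd(1)] by blast
      then show False using swap_down_not_above[OF y dc] by blast
    qed
    then have "weak_le n (pos z) (pos x)" using cd(2) x by simp
    then show ?thesis
      using permutes_weak_le_antisym z(1,2) swap_down_bottoms[OF y ba] x bottomsD(1) by metis
  qed
  have "x \<in> bottoms n" "weak_le n (pos x) (pos y)" "x \<noteq> y"
    unfolding x using swap_down_bottoms[OF y ba] swap_down_weak_le[OF y ba] swap_down_neq[OF y ba] by simp_all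
  then show "covers (BL n) x y" unfolding covers_BL using y * by metis
qed

definition jirr :: "nat \<Rightarrow> nat \<Rightarrow> nat \<Rightarrow> bool \<Rightarrow> nat \<Rightarrow> nat" where
  "jirr n a b e = perm_of n (jrep n a b e)"

text \<open>The permutation of \<open>mrep\<close> need not be a class minimum, while
  \<open>kappa\<close> takes values in the carrier; hence the projection.\<close>

definition mirr :: "nat \<Rightarrow> nat \<Rightarrow> nat \<Rightarrow> bool \<Rightarrow> nat \<Rightarrow> nat" where
  "mirr n a b e = pi_down n (perm_of n (mrep n a b e))"

context
  fixes n a b :: nat and e :: bool
  assumes ab: "1 \<le> a" "a < b" "b \<le> n + 1"
begin

lemma jirr_perm: "jirr n a b e permutes {1..n+1}" "same_order n (pos (jirr n a b e)) (jrep n a b e)"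
  using perm_of[OF inj_on_jrep[OF ab(2)]] unfolding jirr_def by blast+

lemma mirr_perm: "perm_of n (mrep n a b e) permutes {1..n+1}"
    "same_order n (pos (perm_of n (mrep n a b e))) (mrep n a b e)"
  using perm_of[OF inj_on_mrep[OF ab(2)]] by blast+

lemma jirr_bottoms: "jirr n a b e \<in> bottoms n"
  using jirr_perm good_same_order good_jrep[OF ab] unfolding bottoms_def by blast

lemma desc_jirr: "desc n (pos (jirr n a b e)) c d f \<longleftrightarrow> c = a \<and> d = b \<and> (b = Suc a \<or> e = f)"
  by (simp only: desc_same_order[OF jirr_perm(2)] desc_jrep_iff[OF ab])

lemma jirr_weak_le: "weak_le n (pos (jirr n a b e)) s \<longleftrightarrow> above_arc s a b e"
  by (simp only: weak_le_same_order(1)[OF jirr_perm(2)] jrep_weak_le[OF ab])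

lemma mirr_bottoms: "mirr n a b e \<in> bottoms n"
  unfolding mirr_def using pi_down(1)[OF mirr_perm(1)] .

lemma weak_le_mirr:
  assumes "x \<in> bottoms n"
  shows "weak_le n (pos x) (pos (mirr n a b e)) \<longleftrightarrow> above_arc (neg (pos x)) a b (\<not> e)"
  by (simp only: mirr_def weak_le_pi_down[OF assms mirr_perm(1)] weak_le_same_order(2)[OF mirr_perm(2)]
    weak_le_mrep[OF ab inj_on_pos[OF bottomsD(1)[OF assms]]])

lemma adj_jirr: "adj n (pos (jirr n a b e)) b a"
  using desc_jirr unfolding desc_def by blast

lemma covers_jirr: "covers (BL n) x (jirr n a b e) \<longleftrightarrow> x = swap_down n (jirr n a b e) a b"
  unfolding covers_iff desc_jirr using jirr_bottoms by blast

lemma lower_cover_jirr: "lower_cover (BL n) (jirr n a b e) = swap_down n (jirr n a b e) a b"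
  unfolding lower_cover_def covers_jirr by simp

lemma weak_le_jirr_cases:
  assumes "x \<in> bottoms n" "weak_le n (pos x) (pos (jirr n a b e))" "x \<noteq> jirr n a b e"
  shows "weak_le n (pos x) (pos (swap_down n (jirr n a b e) a b))"
  using below_swap_down[OF jirr_bottoms assms] unfolding desc_jirr by blast

end

text \<open>Lower covers correspond to descents, so a join-irreducible has a single arc and, being
  determined by its descents, is the element of that arc.\<close>

lemma join_irreducible_iff:
  "join_irreducible (BL n) j \<longleftrightarrow> (\<exists>a b e. 1 \<le> a \<and> a < b \<and> b \<le> n + 1 \<and> j = jirr n a b e)"
proof
  assume j: "join_irreducible (BL n) j"
  then obtain x where x: "covers (BL n) x j" "\<And>z. covers (BL n) z j \<Longrightarrow> z = x"
    unfolding join_irreducible_def by blast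
  then obtain a b e where y: "j \<in> bottoms n" and d: "desc n (pos j) a b e" "x = swap_down n j a b"
    unfolding covers_iff by blast
  note bd = desc_bounds[OF d(1)]
  then have bd': "1 \<le> a" "a < b" "b \<le> n + 1" by auto
  have only: "c = a \<and> d' = b" if "desc n (pos j) c d' f" for c d' f
  proof (rule ccontr)
    assume *: "\<not> (c = a \<and> d' = b)"
    have dc: "adj n (pos j) d' c" "c < d'" using that by (auto simp: desc_def)
    have "swap_down n j c d' = x" using x(2) that y unfolding covers_iff by blast
    moreover have "above_arc (pos (swap_down n j c d')) a b e"
      using above_arc_swap_down_other[OF y d(1) dc] * by auto
    moreover have "\<not> above_arc (pos x) a b e"
      using swap_down_not_above[OF y] d unfolding desc_def by blast
    ultimately show False by metis
  qed
  have ae: "above_arc (pos j) a b e" using desc_above_arc[OF d(1)] inj_on_pos[OF bottomsD(1)[OF y]] by blast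
  have "weak_le n (pos (jirr n a b e)) (pos j)" using jirr_weak_le[OF bd'] ae by blast
  moreover have "weak_le n (pos j) (pos (jirr n a b e))"
  proof (rule bottom_weak_le[OF y])
    fix c d' f assume cd: "desc n (pos j) c d' f"
    then have "c = a" "d' = b" "b = Suc a \<or> f = e"
      using only desc_parity_unique[OF d(1)] by blast+
    then have "desc n (pos (jirr n a b e)) c d' f" using desc_jirr[OF bd'] by blast
    then show "above_arc (pos (jirr n a b e)) c d' f"
      using desc_above_arc inj_on_pos[OF jirr_perm(1)[OF bd']] by blast
  qed
  ultimately have "j = jirr n a b e"
    using permutes_weak_le_antisym bottomsD(1)[OF y] jirr_perm(1)[OF bd'] by blast
  then show "\<exists>a b e. 1 \<le> a \<and> a < b \<and> b \<le> n + 1 \<and> j = jirr n a b e" using bd' by blast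
next
  assume "\<exists>a b e. 1 \<le> a \<and> a < b \<and> b \<le> n + 1 \<and> j = jirr n a b e"
  then obtain a b e where ab: "1 \<le> a" "a < b" "b \<le> n + 1" and j: "j = jirr n a b e" by blast
  then show "join_irreducible (BL n) j"
    by (simp add: join_irreducible_def carrier_biCambrian jirr_bottoms covers_jirr)
qed

text \<open>The join in the reversed order, followed by the projection, which does not change the
  set of class minima below.\<close>

lemma exists_meet:
  assumes x: "x \<in> bottoms n" and y: "y \<in> bottoms n"
  shows "\<exists>m\<in>bottoms n. weak_le n (pos m) (pos x) \<and> weak_le n (pos m) (pos y) \<and>
    (\<forall>z\<in>bottoms n. weak_le n (pos z) (pos x) \<longrightarrow> weak_le n (pos z) (pos y) \<longrightarrow> weak_le n (pos z) (pos m))"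
proof -
  let ?F = "{neg (pos x), neg (pos y)}"
  have inj: "inj_on (pos x) {1..n+1}" "inj_on (pos y) {1..n+1}"
    using inj_on_pos bottomsD(1) x y by blast+
  have "inj_on s {1..n+1}" if "s \<in> ?F" for s
    using that inj inj_on_neg by blast
  then obtain t where t: "is_join n ?F t" using exists_join by blast
  note tj = is_joinD[OF t]
  have injt: "inj_on (neg t) {1..n+1}" unfolding inj_on_neg using tj(1) .
  let ?m = "perm_of n (neg t)"
  note m = perm_of[OF injt]
  have "weak_le n (neg t) s" if "neg s \<in> ?F" "inj_on s {1..n+1}" for s
  proof -
    have "weak_le n (neg s) (neg (neg t))" using tj(2)[OF that(1)] by simp
    then show ?thesis using weak_le_neg[OF that(2) injt] by blast
  qed
  then have below: "weak_le n (pos ?m) (pos x)" "weak_le n (pos ?m) (pos y)"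
    using weak_le_same_order(1)[OF m(2)] inj by blast+
  have "weak_le n (pos z) (pos (pi_down n ?m))"
    if z: "z \<in> bottoms n" "weak_le n (pos z) (pos x)" "weak_le n (pos z) (pos y)" for z
  proof -
    have injz: "inj_on (pos z) {1..n+1}" using inj_on_pos bottomsD(1) z by blast
    then have injnz: "inj_on (neg (pos z)) {1..n+1}" unfolding inj_on_neg .
    have "weak_le n s (neg (pos z))" if "s \<in> ?F" for s
      using that z weak_le_neg[OF inj(1) injz] weak_le_neg[OF inj(2) injz] by blast
    then have "weak_le n t (neg (pos z))" using tj(3)[OF injnz] by blast
    then have "weak_le n (neg (neg t)) (neg (pos z))" by simp
    then have "weak_le n (pos z) (neg t)" using weak_le_neg[OF injt injz] by blast
    then have "weak_le n (pos z) (pos ?m)" using weak_le_same_order(2)[OF m(2)] by blast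
    then show ?thesis using weak_le_pi_down[OF z(1) m(1)] by blast
  qed
  then show ?thesis
    using pi_down(1)[OF m(1)] pi_down_weak_le[OF m(1)] below weak_le_trans by blast
qed

lemma meet_BL:
  assumes x: "x \<in> bottoms n" and y: "y \<in> bottoms n"
  shows "m = meet (BL n) x y \<longleftrightarrow> m \<in> bottoms n \<and> weak_le n (pos m) (pos x) \<and> weak_le n (pos m) (pos y) \<and>
    (\<forall>z\<in>bottoms n. weak_le n (pos z) (pos x) \<longrightarrow> weak_le n (pos z) (pos y) \<longrightarrow> weak_le n (pos z) (pos m))"
proof -
  define G where "G m \<longleftrightarrow> m \<in> bottoms n \<and> weak_le n (pos m) (pos x) \<and> weak_le n (pos m) (pos y) \<and>
    (\<forall>z\<in>bottoms n. weak_le n (pos z) (pos x) \<longrightarrow> weak_le n (pos z) (pos y) \<longrightarrow> weak_le n (pos z) (pos m))" for m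
  have G: "greatest (BL n) m (Lower (BL n) {x, y}) \<longleftrightarrow> G m" for m
  proof -
    have "Lower (BL n) {x, y} = {z \<in> bottoms n. weak_le n (pos z) (pos x) \<and> weak_le n (pos z) (pos y)}"
      unfolding Lower_def carrier_biCambrian using le_biCambrian x y by blast
    then show ?thesis unfolding greatest_def carrier_biCambrian G_def using le_biCambrian by auto
  qed
  have "\<exists>m. G m" using exists_meet[OF x y] unfolding G_def by blast
  then have "G (meet (BL n) x y)" unfolding meet_def inf_def G by (rule someI_ex)
  moreover have "m = m'" if "G m" "G m'" for m m'
    using that permutes_weak_le_antisym bottomsD(1) unfolding G_def by blast
  ultimately show ?thesis unfolding G_def[symmetric] by blast
qed

text \<open>The set that defines \<open>kappa\<close> consists of the elements above the lower cover
  of \<open>j\<close> but not above \<open>j\<close>. Such an element has all inversions of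
  \<open>j\<close> except \<open>(a, b)\<close>: \<open>a\<close> stands before \<open>b\<close>,
  the numbers left of the arc before \<open>a\<close>, those right of it after \<open>b\<close>.
  This is what lying below the meet-irreducible requires.\<close>

lemma kappa_jirr:
  assumes ab: "1 \<le> a" "a < b" "b \<le> n + 1"
  shows "kappa (BL n) (jirr n a b e) = mirr n a b e"
proof -
  let ?j = "jirr n a b e" and ?m = "mirr n a b e"
  let ?l = "swap_down n ?j a b"
  let ?S = "{z \<in> carrier (BL n). meet (BL n) z ?j = lower_cover (BL n) ?j}"
  note jB = jirr_bottoms[OF ab, of e] and mB = mirr_bottoms[OF ab, of e] and ad = adj_jirr[OF ab, of e]
  note lB = swap_down_bottoms[OF jB ad ab(2)] and lj = swap_down_weak_le[OF jB ad ab(2)] and lne = swap_down_neq[OF jB ad ab(2)]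
  have S: "z \<in> ?S \<longleftrightarrow> z \<in> bottoms n \<and> weak_le n (pos ?l) (pos z) \<and> \<not> weak_le n (pos ?j) (pos z)" for z
  proof (cases "z \<in> bottoms n")
    case True
    have "?l = meet (BL n) z ?j \<longleftrightarrow> weak_le n (pos ?l) (pos z) \<and> \<not> weak_le n (pos ?j) (pos z)"
      unfolding meet_BL[OF True jB]
    proof (intro iffI conjI ballI impI; (elim conjE)?)
      assume *: "\<forall>w\<in>bottoms n. weak_le n (pos w) (pos z) \<longrightarrow> weak_le n (pos w) (pos ?j) \<longrightarrow> weak_le n (pos w) (pos ?l)"
      show "\<not> weak_le n (pos ?j) (pos z)"
      proof
        assume "weak_le n (pos ?j) (pos z)"
        then have "weak_le n (pos ?j) (pos ?l)" using * jB weak_le_refl by blast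
        then show False using lj lne permutes_weak_le_antisym bottomsD(1) jB lB by blast
      qed
    next
      fix w assume "weak_le n (pos ?l) (pos z)" "\<not> weak_le n (pos ?j) (pos z)"
        "w \<in> bottoms n" "weak_le n (pos w) (pos z)" "weak_le n (pos w) (pos ?j)"
      then show "weak_le n (pos w) (pos ?l)" using weak_le_jirr_cases[OF ab] by metis
    qed (use lB lj in simp_all)
    then show ?thesis using True lower_cover_jirr[OF ab] carrier_biCambrian by auto
  qed (simp add: carrier_biCambrian)
  \<comment> \<open>The projection may lose single inversions of the swapped \<open>j\<close>, but
    it respects arcs; so the inversion \<open>(x, y)\<close> is recovered through the sub-arc
    \<open>(x, y, e)\<close>.\<close>
  have above_l: "above_arc (pos z) x y e"
    if z: "z \<in> bottoms n" "weak_le n (pos ?l) (pos z)" and xy: "a \<le> x" "x < y" "y \<le> b" "x = a \<or> even x \<noteq> e"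
      "y = b \<or> even y = e" "(x, y) \<noteq> (a, b)" for z x y
  proof -
    have "above_arc (pos ?j \<circ> transpose b a) x y e"
      unfolding above_arc_def
    proof (intro allI impI)
      fix u v assume *: "x \<le> u \<and> u < v \<and> v \<le> y \<and> (u = x \<or> even u \<noteq> e) \<and> (v = y \<or> even v = e)"
      have V: "u \<in> {1..n+1}" "v \<in> {1..n+1}" using * xy ab by auto
      have "above_arc (pos ?j) a b e" using jirr_weak_le[OF ab] weak_le_refl by blast
      then have "pos ?j v < pos ?j u" using above_arcD[of "pos ?j" a b e u v] * xy by auto
      moreover have "{v, u} \<noteq> {b, a}" using * xy by (auto simp: doubleton_eq_iff)
      ultimately show "(pos ?j \<circ> transpose b a) v < (pos ?j \<circ> transpose b a) u"
        using swap_less[OF ad inj_on_pos[OF bottomsD(1)[OF jB]] V(2,1)] by simp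
    qed
    then have "above_arc (pos ?l) x y e" using above_arc_swap_down[OF jB ad ab(2)] xy ab by auto
    then show ?thesis using above_arc_mono[OF z(2)] xy ab by auto
  qed
  have below_m: "weak_le n (pos z) (pos ?m)"
    if z: "z \<in> bottoms n" "weak_le n (pos ?l) (pos z)" "\<not> weak_le n (pos ?j) (pos z)" for z
  proof -
    have lt: "pos z y < pos z x" if "a \<le> x" "x < y" "y \<le> b" "x = a \<or> even x \<noteq> e"
      "y = b \<or> even y = e" "(x, y) \<noteq> (a, b)" for x y
      using above_arcD[OF above_l[OF z(1,2) that], of x y] that(2) by auto
    have "\<not> above_arc (pos z) a b e" using z(3) jirr_weak_le[OF ab] by blast
    then have "\<not> pos z b < pos z a"
      using lt unfolding above_arc_def by blast
    moreover have "pos z a \<noteq> pos z b"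
      using inj_ne[OF inj_on_pos[OF bottomsD(1)[OF z(1)]], of a UNIV b] ab by simp
    ultimately have lt_ab: "pos z a < pos z b" by simp
    have "above_arc (neg (pos z)) a b (\<not> e)"
      unfolding above_arc_def
    proof (intro allI impI)
      fix x y assume *: "a \<le> x \<and> x < y \<and> y \<le> b \<and> (x = a \<or> even x \<noteq> (\<not> e)) \<and> (y = b \<or> even y = (\<not> e))"
      have "pos z x \<le> pos z a" using lt[of a x] * by (cases "x = a") auto
      moreover have "pos z b \<le> pos z y" using lt[of y b] * by (cases "y = b") auto
      ultimately show "neg (pos z) y < neg (pos z) x" using lt_ab by (simp add: neg_def)
    qed
    then show ?thesis using weak_le_mirr[OF ab z(1)] by blast
  qed
  have mS: "?m \<in> ?S"
  proof -
    have "desc n (pos ?j) a b e" using desc_jirr[OF ab] by blast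
    then have "desc n (neg (pos ?j \<circ> transpose b a)) a b (\<not> e)"
      using desc_swap_neg inj_on_pos[OF bottomsD(1)[OF jB]] by blast
    moreover have "inj_on (neg (pos ?j \<circ> transpose b a)) {1..n+1}"
      unfolding inj_on_neg using inj_on_swap[of b n a] inj_on_pos[OF bottomsD(1)[OF jB]] ab by auto
    ultimately have "above_arc (neg (pos ?j \<circ> transpose b a)) a b (\<not> e)" using desc_above_arc by blast
    then have "above_arc (neg (pos ?l)) a b (\<not> e)" using above_arc_neg_swap_down[OF jB ad ab(2)] ab by blast
    then have "weak_le n (pos ?l) (pos ?m)" using weak_le_mirr[OF ab lB] by blast
    moreover have "\<not> weak_le n (pos ?j) (pos ?m)"
    proof
      assume "weak_le n (pos ?j) (pos ?m)"
      then have "above_arc (neg (pos ?j)) a b (\<not> e)" using weak_le_mirr[OF ab jB] by blast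
      from above_arcD[OF this, of a b] show False using ad ab by (simp add: adj_def neg_def)
    qed
    ultimately show ?thesis unfolding S using mB by blast
  qed
  have sub: "?S \<subseteq> carrier (BL n)" by blast
  have "le (BL n) z ?m" if "z \<in> ?S" for z
  proof -
    have z: "z \<in> bottoms n" "weak_le n (pos ?l) (pos z)" "\<not> weak_le n (pos ?j) (pos z)"
      using that unfolding S by blast+
    show ?thesis using le_biCambrian[OF z(1)] below_m[OF z] by blast
  qed
  then have g: "greatest (BL n) ?m ?S"
    unfolding greatest_def using mS sub by blast
  moreover have "m' = ?m" if g': "greatest (BL n) m' ?S" for m'
  proof -
    have "m' \<in> ?S" using g' unfolding greatest_def by blast
    then have "le (BL n) m' ?m" "le (BL n) ?m m'" "m' \<in> bottoms n"
      using g g' mS carrier_biCambrian unfolding greatest_def by blast+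
    then show ?thesis using le_biCambrian mB permutes_weak_le_antisym bottomsD(1) by blast
  qed
  ultimately show ?thesis unfolding kappa_def by (rule the_equality)
qed

text \<open>The ends of the label arc are inverted in \<open>y\<close> but not after undoing the
  descent \<open>(p, q)\<close> that leads to \<open>x\<close>, so they are \<open>p\<close> and
  \<open>q\<close>. The side of \<open>p + 1\<close> fixes the parity, and for a unit arc both
  parities give the same element.\<close>

lemma cover_label_eq:
  assumes c: "covers (BL n) x y" and ab: "1 \<le> a" "a < b" "b \<le> n + 1"
    and jy: "weak_le n (pos (jirr n a b e)) (pos y)" and xm: "weak_le n (pos x) (pos (mirr n a b e))"
  shows "cover_label (BL n) x y = jirr n a b e"
proof -
  obtain p q f where y: "y \<in> bottoms n" and d: "desc n (pos y) p q f" and x: "x = swap_down n y p q"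
    using c unfolding covers_iff by blast
  have qp: "adj n (pos y) q p" "p < q" using d by (auto simp: desc_def)
  note pq = desc_bounds[OF d]
  have V: "p \<in> {1..n+1}" "q \<in> {1..n+1}" using qp by (auto simp: adj_def)
  have xB: "x \<in> bottoms n" using swap_down_bottoms[OF y qp] x by simp
  note inj = inj_on_pos[OF bottomsD(1)[OF y]]
  have key: "c = p \<and> d' = q \<and> (q = Suc p \<or> g = f)"
    if cd: "1 \<le> c" "c < d'" "d' \<le> n + 1" and J: "weak_le n (pos (jirr n c d' g)) (pos y)"
      and M: "weak_le n (pos x) (pos (mirr n c d' g))" for c d' g
  proof -
    let ?s = "pos y \<circ> transpose q p"
    have Jy: "above_arc (pos y) c d' g" using jirr_weak_le[OF cd] J by blast
    have "above_arc (neg (pos x)) c d' (\<not> g)" using weak_le_mirr[OF cd xB] M by blast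
    then have Ms: "above_arc (neg ?s) c d' (\<not> g)" using above_arc_neg_swap_down[OF y qp] cd x by blast
    have "pos y d' < pos y c" using above_arcD[OF Jy, of c d'] cd by blast
    moreover have "neg ?s d' < neg ?s c" using above_arcD[OF Ms, of c d'] cd by blast
    then have "\<not> ?s d' < ?s c" by (simp add: neg_def)
    ultimately have "{d', c} = {q, p}"
      using swap_less[OF qp(1) inj, of d' c] cd by auto
    then have eq: "c = p" "d' = q" using cd qp by (auto simp: doubleton_eq_iff)
    moreover have "q = Suc p \<or> g = f"
    proof (rule ccontr)
      assume *: "\<not> (q = Suc p \<or> g = f)"
      then have r: "p < Suc p" "Suc p < q" using qp by auto
      show False
      proof (cases "even (Suc p) = g")
        case True
        then have "pos y (Suc p) < pos y p" using above_arcD[OF Jy, of p "Suc p"] eq r by auto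
        moreover have "pos y p < pos y (Suc p)" using desc_right[OF d inj r] True * by auto
        ultimately show False by simp
      next
        case False
        then have "pos y q < pos y (Suc p)" using above_arcD[OF Jy, of "Suc p" q] eq r by auto
        moreover have "pos y (Suc p) < pos y q" using desc_left[OF d r] False * by auto
        ultimately show False by simp
      qed
    qed
    ultimately show ?thesis by blast
  qed
  have eq: "jirr n c d' g = jirr n a b e" if "1 \<le> c" "c < d'" "d' \<le> n + 1" "weak_le n (pos (jirr n c d' g)) (pos y)"
      "weak_le n (pos x) (pos (mirr n c d' g))" for c d' g
  proof -
    have k: "c = a" "d' = b" "b = Suc a \<or> g = e" using key[OF that] key[OF ab jy xm] by blast+
    have "above_arc s c d' g \<longleftrightarrow> above_arc s a b e" for s
      using k by (cases "b = Suc a") (auto simp: above_arc_short)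
    then have "weak_le n (pos (jirr n c d' g)) s \<longleftrightarrow> weak_le n (pos (jirr n a b e)) s" for s
      unfolding jirr_weak_le[OF that(1-3)] jirr_weak_le[OF ab] .
    then have "weak_le n (pos (jirr n c d' g)) (pos (jirr n a b e))"
      "weak_le n (pos (jirr n a b e)) (pos (jirr n c d' g))"
      using weak_le_refl by blast+
    then show ?thesis using permutes_weak_le_antisym jirr_perm(1)[OF ab] jirr_perm(1)[OF that(1-3)] by blast
  qed
  show ?thesis
    unfolding cover_label_def
  proof (rule the_equality)
    show "join_irreducible (BL n) (jirr n a b e) \<and> le (BL n) (jirr n a b e) y \<and> le (BL n) x (kappa (BL n) (jirr n a b e))"
      using join_irreducible_iff ab le_biCambrian[OF jirr_bottoms[OF ab]] jy le_biCambrian[OF xB]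
        kappa_jirr[OF ab] xm by auto
  next
    fix j assume j: "join_irreducible (BL n) j \<and> le (BL n) j y \<and> le (BL n) x (kappa (BL n) j)"
    then obtain c d' g where cd: "1 \<le> c" "c < d'" "d' \<le> n + 1" "j = jirr n c d' g"
      using join_irreducible_iff by blast
    then have "weak_le n (pos (jirr n c d' g)) (pos y)" "weak_le n (pos x) (pos (mirr n c d' g))"
      using j le_biCambrian[OF jirr_bottoms[OF cd(1-3)]] le_biCambrian[OF xB] kappa_jirr[OF cd(1-3)] by auto
    then show "j = jirr n a b e" using eq[OF cd(1-3)] cd(4) by simp
  qed
qed

lemma down_labels_BL:
  assumes y: "y \<in> bottoms n"
  shows "down_labels (BL n) y = {jirr n a b e | a b e. desc n (pos y) a b e}"
proof -
  have lab: "covers (BL n) (swap_down n y a b) y \<and> cover_label (BL n) (swap_down n y a b) y = jirr n a b e"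
    if d: "desc n (pos y) a b e" for a b e
  proof -
    have c: "covers (BL n) (swap_down n y a b) y" unfolding covers_iff using y d by blast
    have ba: "adj n (pos y) b a" "a < b" using d by (auto simp: desc_def)
    have bd: "1 \<le> a" "a < b" "b \<le> n + 1" using desc_bounds[OF d] by auto
    note inj = inj_on_pos[OF bottomsD(1)[OF y]]
    have j: "weak_le n (pos (jirr n a b e)) (pos y)"
      using jirr_weak_le[OF bd] desc_above_arc[OF d inj] by blast
    have "inj_on (neg (pos y \<circ> transpose b a)) {1..n+1}"
      unfolding inj_on_neg using inj_on_swap[of b n a] inj bd by auto
    then have "above_arc (neg (pos y \<circ> transpose b a)) a b (\<not> e)"
      using desc_above_arc[OF desc_swap_neg[OF d inj]] by blast
    then have "above_arc (neg (pos (swap_down n y a b))) a b (\<not> e)"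
      using above_arc_neg_swap_down[OF y ba] bd by blast
    then have "weak_le n (pos (swap_down n y a b)) (pos (mirr n a b e))"
      using weak_le_mirr[OF bd swap_down_bottoms[OF y ba]] by blast
    then show ?thesis using cover_label_eq[OF c bd j] c by blast
  qed
  show ?thesis
    unfolding down_labels_def
  proof (intro subset_antisym subsetI)
    fix l assume "l \<in> {cover_label (BL n) x y | x. covers (BL n) x y}"
    then obtain x where x: "covers (BL n) x y" "l = cover_label (BL n) x y" by blast
    then obtain a b e where "desc n (pos y) a b e" "x = swap_down n y a b" unfolding covers_iff by blast
    then show "l \<in> {jirr n a b e | a b e. desc n (pos y) a b e}" using lab x by blast
  next
    fix l assume "l \<in> {jirr n a b e | a b e. desc n (pos y) a b e}"
    then show "l \<in> {cover_label (BL n) x y | x. covers (BL n) x y}" using lab by force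
  qed
qed

text \<open>The upper covers are found from the class maximum \<open>t\<close>: exchange an ascent
  of \<open>t\<close> and project. An element above \<open>x\<close> has a class maximum strictly
  above \<open>t\<close>, which puts it above one of these.\<close>

lemma up_labels_BL:
  assumes x: "x \<in> bottoms n" and t: "t permutes {1..n+1}" "class_eq n (pos x) (pos t)" "good n (neg (pos t))"
  shows "up_labels (BL n) x = {jirr n a b e | a b e. desc n (neg (pos t)) a b (\<not> e)}"
proof -
  let ?up = "\<lambda>a b. pi_down n (transpose b a \<circ> t)"
  note injt = inj_on_pos[OF t(1)]
  have injnt: "inj_on (neg (pos t)) {1..n+1}" unfolding inj_on_neg using injt .
  have up: "?up a b \<in> bottoms n" "weak_le n (pos x) (pos (?up a b))" "?up a b \<noteq> x"
      "weak_le n (pos (jirr n a b e)) (pos (?up a b))" "weak_le n (pos x) (pos (mirr n a b e))"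
    if d: "desc n (neg (pos t)) a b (\<not> e)" for a b e
  proof -
    have ba: "adj n (neg (pos t)) b a" "a < b" using d by (auto simp: desc_def)
    have bd: "1 \<le> a" "a < b" "b \<le> n + 1" using desc_bounds[OF d] by auto
    have adt: "adj n (pos t) a b" using ba(1) unfolding adj_neg .
    have q: "transpose b a \<circ> t permutes {1..n+1}" using swap_permutes[OF t(1) ba(1)] .
    have ps: "pos (transpose b a \<circ> t) = pos t \<circ> transpose b a" using pos_swap[OF t(1)] .
    have injs: "inj_on (pos t \<circ> transpose b a) {1..n+1}" using inj_on_pos[OF q] ps by simp
    show "?up a b \<in> bottoms n" using pi_down(1)[OF q] .
    have "desc n (neg (neg (pos t) \<circ> transpose b a)) a b (\<not> \<not> e)"
      using desc_swap_neg[OF d injnt] .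
    moreover have ns: "neg (pos t) \<circ> transpose b a = neg (pos t \<circ> transpose b a)" by (simp add: neg_def comp_def)
    ultimately have "desc n (pos t \<circ> transpose b a) a b e" by simp
    then have J: "above_arc (pos t \<circ> transpose b a) a b e" using desc_above_arc injs by blast
    then have "above_arc (pos (?up a b)) a b e" using above_arc_pi_down(1)[OF q bd(1,3)] ps by simp
    then show "weak_le n (pos (jirr n a b e)) (pos (?up a b))" using jirr_weak_le[OF bd] by blast
    have Mt: "above_arc (neg (pos t)) a b (\<not> e)" using desc_above_arc[OF d injnt] .
    then have Mx: "above_arc (neg (pos x)) a b (\<not> e)" using class_eqD(2)[OF t(2)] bd by blast
    then show "weak_le n (pos x) (pos (mirr n a b e))" using weak_le_mirr[OF bd x] by blast
    have "weak_le n (pos x) (pos t)" using bottom_weak_le_class[OF x t(2)] weak_le_refl by blast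
    moreover have "weak_le n (pos t) (pos t \<circ> transpose b a)"
    proof -
      have "weak_le n (neg (pos t \<circ> transpose b a)) (neg (pos t))"
        using weak_le_swap_same[OF ba injnt] ns by simp
      then show ?thesis using weak_le_neg[OF injs injt] by blast
    qed
    ultimately have "weak_le n (pos x) (pos (transpose b a \<circ> t))" unfolding ps by (rule weak_le_trans)
    then show "weak_le n (pos x) (pos (?up a b))" using weak_le_pi_down[OF x q] by blast
    show "?up a b \<noteq> x"
    proof
      assume "?up a b = x"
      then have "above_arc (neg (pos t \<circ> transpose b a)) a b (\<not> e)"
        using Mx above_arc_pi_down(2)[OF q bd(1,3)] ps by simp
      then show False using not_above_arc_swap[OF ba] ns by simp
    qed
  qed
  have above: "\<exists>a b e. desc n (neg (pos t)) a b (\<not> e) \<and> weak_le n (pos (?up a b)) (pos z)"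
    if z: "z \<in> bottoms n" "weak_le n (pos x) (pos z)" "z \<noteq> x" for z
  proof -
    note pz = bottomsD(1)[OF z(1)] and px = bottomsD(1)[OF x]
    obtain u where u: "u permutes {1..n+1}" "class_eq n (pos z) (pos u)" "good n (neg (pos u))"
      using exists_top[OF pz] by blast
    note inju = inj_on_pos[OF u(1)]
    have injnu: "inj_on (neg (pos u)) {1..n+1}" unfolding inj_on_neg using inju .
    have "weak_le n (neg (pos u)) (neg (pos t))"
    proof (rule good_weak_le[OF u(3) injnu])
      fix a b e assume d: "desc n (neg (pos u)) a b e"
      note bd = desc_bounds[OF d]
      have "above_arc (neg (pos u)) a b e" using desc_above_arc[OF d injnu] .
      then have "above_arc (neg (pos z)) a b e" using class_eqD(2)[OF u(2)] bd by blast
      then have "above_arc (neg (pos x)) a b e" using above_arc_neg_mono[OF z(2) px pz] bd by blast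
      then show "above_arc (neg (pos t)) a b e" using class_eqD(2)[OF t(2)] bd by blast
    qed
    moreover have "\<not> weak_le n (neg (pos t)) (neg (pos u))"
    proof
      assume "weak_le n (neg (pos t)) (neg (pos u))"
      then have "weak_le n (pos u) (pos t)" "weak_le n (pos t) (pos u)"
        using weak_le_neg[OF injt inju] weak_le_neg[OF inju injt] calculation by blast+
      then have "u = t" using permutes_weak_le_antisym u(1) t(1) by blast
      then have "class_eq n (pos z) (pos x)" using u(2) t(2) class_eq_sym class_eq_trans by blast
      then show False using bottoms_eqI z(1,3) x by blast
    qed
    ultimately obtain a b where ab: "a < b" "adj n (neg (pos t)) b a" "neg (pos u) a < neg (pos u) b"
      using exists_descent[OF _ _ injnt injnu] by blast
    obtain e where e: "desc n (neg (pos t)) a b e" using good_desc[OF t(3) ab(2,1)] by blast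
    have q: "transpose b a \<circ> t permutes {1..n+1}" using swap_permutes[OF t(1) ab(2)] .
    have ps: "pos (transpose b a \<circ> t) = pos t \<circ> transpose b a" using pos_swap[OF t(1)] .
    have injs: "inj_on (pos t \<circ> transpose b a) {1..n+1}" using inj_on_pos[OF q] ps by simp
    have ns: "neg (pos t) \<circ> transpose b a = neg (pos t \<circ> transpose b a)" by (simp add: neg_def comp_def)
    have "weak_le n (neg (pos u)) (neg (pos t \<circ> transpose b a))"
      using weak_le_swap[OF \<open>weak_le n (neg (pos u)) (neg (pos t))\<close> ab(2) injnt ab(3)] ns by simp
    then have "weak_le n (pos t \<circ> transpose b a) (pos u)" using weak_le_neg[OF inju injs] by blast
    then have "weak_le n (pos (?up a b)) (pos u)" using pi_down_weak_le[OF q] ps weak_le_trans by metis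
    then have "weak_le n (pos (?up a b)) (pos z)"
      using bottom_weak_le_class[OF pi_down(1)[OF q] u(2)] by blast
    then show ?thesis using e by (intro exI[of _ a] exI[of _ b] exI[of _ "\<not> e"]) simp
  qed
  have cov: "covers (BL n) x (?up a b)" if d: "desc n (neg (pos t)) a b (\<not> e)" for a b e
  proof -
    have ba: "adj n (neg (pos t)) b a" "a < b" using d by (auto simp: desc_def)
    have q: "transpose b a \<circ> t permutes {1..n+1}" using swap_permutes[OF t(1) ba(1)] .
    have ps: "pos (transpose b a \<circ> t) = pos t \<circ> transpose b a" using pos_swap[OF t(1)] .
    have ns: "neg (pos t) \<circ> transpose b a = neg (pos t \<circ> transpose b a)" for a b by (simp add: neg_def comp_def)
    have *: "z = ?up a b" if z: "z \<in> bottoms n" "weak_le n (pos x) (pos z)" "z \<noteq> x" "weak_le n (pos z) (pos (?up a b))" for z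
    proof -
      obtain c d' f where cd: "desc n (neg (pos t)) c d' (\<not> f)" "weak_le n (pos (?up c d')) (pos z)"
        using above[OF z(1-3)] by blast
      have dc: "adj n (neg (pos t)) d' c" "c < d'" using cd by (auto simp: desc_def)
      have bd: "1 \<le> c" "d' \<le> n + 1" using desc_bounds[OF cd(1)] by auto
      have q': "transpose d' c \<circ> t permutes {1..n+1}" using swap_permutes[OF t(1) dc(1)] .
      have ps': "pos (transpose d' c \<circ> t) = pos t \<circ> transpose d' c" using pos_swap[OF t(1)] .
      have "(c, d') = (a, b)"
      proof (rule ccontr)
        assume ne: "(c, d') \<noteq> (a, b)"
        have "above_arc (neg (pos t \<circ> transpose b a)) c d' (\<not> f)"
          using above_arc_swap_other[OF cd(1) ba ne injnt] ns by simp
        then have "above_arc (neg (pos (?up a b))) c d' (\<not> f)"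
          using above_arc_pi_down(2)[OF q bd] ps by simp
        moreover have "weak_le n (pos (?up c d')) (pos (?up a b))" using cd(2) z(4) weak_le_trans by blast
        ultimately have "above_arc (neg (pos (?up c d'))) c d' (\<not> f)"
          using above_arc_neg_mono bottomsD(1) pi_down(1)[OF q] pi_down(1)[OF q'] bd by blast
        then have "above_arc (neg (pos t \<circ> transpose d' c)) c d' (\<not> f)"
          using above_arc_pi_down(2)[OF q' bd] ps' by simp
        then show False using not_above_arc_swap[OF dc] ns by simp
      qed
      then have "weak_le n (pos (?up a b)) (pos z)" using cd(2) by simp
      then show ?thesis using permutes_weak_le_antisym z(1,4) bottomsD(1) pi_down(1)[OF q] by blast
    qed
    show ?thesis unfolding covers_BL using x up(1-3)[OF d] * by metis
  qed
  have lab: "covers (BL n) x (?up a b) \<and> cover_label (BL n) x (?up a b) = jirr n a b e"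
    if d: "desc n (neg (pos t)) a b (\<not> e)" for a b e
    using cover_label_eq[OF cov[OF d]] desc_bounds[OF d] up(4,5)[OF d] cov[OF d] by blast
  show ?thesis
    unfolding up_labels_def
  proof (intro subset_antisym subsetI)
    fix l assume "l \<in> {cover_label (BL n) x y | y. covers (BL n) x y}"
    then obtain y where y: "covers (BL n) x y" "l = cover_label (BL n) x y" by blast
    then obtain a b e where d: "desc n (neg (pos t)) a b (\<not> e)" "weak_le n (pos (?up a b)) (pos y)"
      using above unfolding covers_BL by blast
    then have "y = ?up a b" using y(1) up(1-3)[OF d(1)] unfolding covers_BL by blast
    then show "l \<in> {jirr n a b e | a b e. desc n (neg (pos t)) a b (\<not> e)}" using lab d(1) y(2) by blast
  next
    fix l assume "l \<in> {jirr n a b e | a b e. desc n (neg (pos t)) a b (\<not> e)}"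
    then show "l \<in> {cover_label (BL n) x y | y. covers (BL n) x y}" using lab by force
  qed
qed

section \<open>Rowmotion on the biCambrian lattice\<close>

lemma exists_bottom:
  assumes "arc_diagram n D"
  shows "\<exists>y\<in>bottoms n. desc n (pos y) = D"
proof -
  obtain s where s: "inj_on s {1..n+1}" "good n s" "desc n s = D" using exists_desc_eq[OF assms] by blast
  note p = perm_of[OF s(1)]
  have "good n (pos (perm_of n s))" using good_same_order[OF p(2)] s(2) by simp
  moreover have "desc n (pos (perm_of n s)) = D"
    using s(3) by (intro ext) (simp add: desc_same_order[OF p(2)])
  ultimately show ?thesis using p(1) by (auto simp: bottoms_def)
qed

lemma bottoms_desc_inj:
  assumes x: "x \<in> bottoms n" and y: "y \<in> bottoms n" and "desc n (pos x) = desc n (pos y)"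
  shows "x = y"
proof -
  note inj = inj_on_pos[OF bottomsD(1)[OF x]] inj_on_pos[OF bottomsD(1)[OF y]]
  have "weak_le n (pos x) (pos y)" "weak_le n (pos y) (pos x)"
    using good_desc_eq_weak_le[OF bottomsD(2)[OF x] inj assms(3)]
      good_desc_eq_weak_le[OF bottomsD(2)[OF y] inj(2,1) assms(3)[symmetric]] .
  then show ?thesis using permutes_weak_le_antisym bottomsD(1) x y by blast
qed

lemma top_eqI:
  assumes t: "t permutes {1..n+1}" "good n (neg (pos t))" and u: "u permutes {1..n+1}" "good n (neg (pos u))"
    and "class_eq n (pos t) (pos u)"
  shows "t = u"
proof -
  have le: "weak_le n (neg (pos t)) (neg (pos u))"
    if t: "t permutes {1..n+1}" "good n (neg (pos t))" and "class_eq n (pos t) (pos u)" for t u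
  proof -
    have inj: "inj_on (neg (pos t)) {1..n+1}" unfolding inj_on_neg using inj_on_pos[OF t(1)] .
    show ?thesis
    proof (rule good_weak_le[OF t(2) inj])
      fix a b e assume d: "desc n (neg (pos t)) a b e"
      show "above_arc (neg (pos u)) a b e"
        using desc_above_arc[OF d inj] class_eqD(2)[OF that(3)] desc_bounds[OF d] by blast
    qed
  qed
  have "weak_le n (pos u) (pos t)" "weak_le n (pos t) (pos u)"
    using le[OF t assms(5)] le[OF u class_eq_sym[OF assms(5)]]
      weak_le_neg[OF inj_on_pos[OF t(1)] inj_on_pos[OF u(1)]]
      weak_le_neg[OF inj_on_pos[OF u(1)] inj_on_pos[OF t(1)]] by blast+
  then show ?thesis using permutes_weak_le_antisym t(1) u(1) by blast
qed

lemma jirr_inj: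
  assumes "1 \<le> a" "a < b" "b \<le> n + 1" "1 \<le> c" "c < d" "d \<le> n + 1" "jirr n a b e = jirr n c d f"
  shows "a = c \<and> b = d \<and> (b = Suc a \<or> e = f)"
proof -
  have "desc n (pos (jirr n c d f)) a b e" using desc_jirr[OF assms(1-3), of e a b e] assms(7) by simp
  then show ?thesis using desc_jirr[OF assms(4-6)] by auto
qed

text \<open>A join-irreducible determines its arc up to the two encodings of a unit arc, and a
  diagram contains both of these or neither.\<close>

lemma labels_eqD:
  assumes "arc_diagram n D" "arc_diagram n E"
    and eq: "{jirr n a b e | a b e. D a b e} = {jirr n a b e | a b e. E a b e}"
  shows "D = E"
proof -
  have *: "E a b e" if D: "arc_diagram n D" and E: "arc_diagram n E"
    and eq: "{jirr n a b e | a b e. D a b e} \<subseteq> {jirr n a b e | a b e. E a b e}" and "D a b e" for a b e D E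
  proof -
    obtain c d f where cd: "E c d f" "jirr n a b e = jirr n c d f" using eq \<open>D a b e\<close> by blast
    have "1 \<le> a" "a < b" "b \<le> n + 1" "1 \<le> c" "c < d" "d \<le> n + 1"
      using arc_diagram_bounds[OF D \<open>D a b e\<close>] arc_diagram_bounds[OF E cd(1)] by auto
    then have k: "a = c" "b = d" "b = Suc a \<or> e = f" using jirr_inj[OF _ _ _ _ _ _ cd(2)] by blast+
    show ?thesis
    proof (cases "e = f")
      case True
      then show ?thesis using cd(1) k by simp
    next
      case False
      then have "E a (Suc a) f" using cd(1) k by simp
      then show ?thesis using E False k unfolding arc_diagram_def by blast
    qed
  qed
  show ?thesis
    using *[OF assms(1,2)] *[OF assms(2,1)] eq by (intro ext) blast
qed

text \<open>The image is built from above: the mirrored arcs of \<open>x\<close> are the descents of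
  some good \<open>u\<close>, whose reversal \<open>t\<close> is a class maximum with the arcs of
  \<open>x\<close> as ascents, and the image is the minimum of its class. It is unique because the
  labels determine the ascents, hence the maximum.\<close>

lemma lattice_row_BL:
  assumes x: "x \<in> bottoms n"
  shows "lattice_row (BL n) x \<in> bottoms n \<and> (\<exists>t. t permutes {1..n+1} \<and>
    class_eq n (pos (lattice_row (BL n) x)) (pos t) \<and> good n (neg (pos t)) \<and>
    (\<forall>a b e. desc n (neg (pos t)) a b e \<longleftrightarrow> desc n (pos x) a b (\<not> e)))"
proof -
  let ?D = "desc n (pos x)"
  have D: "arc_diagram n ?D" using arc_diagram_desc inj_on_pos[OF bottomsD(1)[OF x]] by blast
  obtain u where u: "inj_on u {1..n+1}" "good n u" "desc n u = (\<lambda>a b e. ?D a b (\<not> e))"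
    using exists_desc_eq[OF arc_diagram_mirror[OF D]] by blast
  have inj: "inj_on (neg u) {1..n+1}" unfolding inj_on_neg using u(1) .
  define t where "t = perm_of n (neg u)"
  note t = perm_of[OF inj, folded t_def]
  have so: "same_order n (neg (pos t)) u" using same_order_neg[OF t(2)] by simp
  have gt: "good n (neg (pos t))" using good_same_order[OF so] u(2) by simp
  have dt: "desc n (neg (pos t)) a b e \<longleftrightarrow> ?D a b (\<not> e)" for a b e
    using desc_same_order[OF so] u(3) by simp
  define y where "y = pi_down n t"
  have y: "y \<in> bottoms n" "class_eq n (pos y) (pos t)"
    unfolding y_def using pi_down[OF t(1)] class_eq_sym by blast+
  have "up_labels (BL n) y = down_labels (BL n) x"
    unfolding up_labels_BL[OF y(1) t(1) y(2) gt] down_labels_BL[OF x] dt by simp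
  moreover have "z = y" if z: "z \<in> bottoms n" "up_labels (BL n) z = down_labels (BL n) x" for z
  proof -
    obtain v where v: "v permutes {1..n+1}" "class_eq n (pos z) (pos v)" "good n (neg (pos v))"
      using exists_top[OF bottomsD(1)[OF z(1)]] by blast
    have injv: "inj_on (neg (pos v)) {1..n+1}" and injt: "inj_on (neg (pos t)) {1..n+1}"
      unfolding inj_on_neg using inj_on_pos v(1) t(1) by blast+
    have "{jirr n a b e | a b e. desc n (neg (pos v)) a b (\<not> e)} = {jirr n a b e | a b e. ?D a b e}"
      using z(2) unfolding up_labels_BL[OF z(1) v] down_labels_BL[OF x] .
    from labels_eqD[OF arc_diagram_mirror[OF arc_diagram_desc[OF injv]] D this]
    have dv: "desc n (neg (pos v)) a b (\<not> e) \<longleftrightarrow> ?D a b e" for a b e by (metis (full_types))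
    have deq: "desc n (neg (pos v)) = desc n (neg (pos t))"
    proof (intro ext)
      fix a b e
      show "desc n (neg (pos v)) a b e = desc n (neg (pos t)) a b e" using dv[of a b "\<not> e"] dt[of a b e] by simp
    qed
    have "weak_le n (neg (pos v)) (neg (pos t))" "weak_le n (neg (pos t)) (neg (pos v))"
      using good_desc_eq_weak_le[OF v(3) injv injt deq] good_desc_eq_weak_le[OF gt injt injv deq[symmetric]] .
    then have "weak_le n (pos v) (pos t)" "weak_le n (pos t) (pos v)"
      using weak_le_neg[OF inj_on_pos[OF t(1)] inj_on_pos[OF v(1)]]
        weak_le_neg[OF inj_on_pos[OF v(1)] inj_on_pos[OF t(1)]] by blast+
    then have "v = t" using permutes_weak_le_antisym t(1) v(1) by blast
    then have "class_eq n (pos z) (pos y)" using v(2) y(2) class_eq_sym class_eq_trans by blast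
    then show ?thesis using bottoms_eqI z(1) y(1) by blast
  qed
  ultimately have "lattice_row (BL n) x = y"
    unfolding lattice_row_def carrier_biCambrian using y(1) by (intro the_equality) blast+
  then show ?thesis using y t(1) gt dt by auto
qed

lemma bij_betw_lattice_row: "bij_betw (lattice_row (BL n)) (bottoms n) (bottoms n)"
proof -
  have "inj_on (lattice_row (BL n)) (bottoms n)"
  proof (rule inj_onI)
    fix x y assume x: "x \<in> bottoms n" and y: "y \<in> bottoms n" and eq: "lattice_row (BL n) x = lattice_row (BL n) y"
    obtain t where t: "t permutes {1..n+1}" "class_eq n (pos (lattice_row (BL n) x)) (pos t)" "good n (neg (pos t))"
        "\<And>a b e. desc n (neg (pos t)) a b e \<longleftrightarrow> desc n (pos x) a b (\<not> e)"
      using lattice_row_BL[OF x] by blast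
    obtain u where u: "u permutes {1..n+1}" "class_eq n (pos (lattice_row (BL n) y)) (pos u)" "good n (neg (pos u))"
        "\<And>a b e. desc n (neg (pos u)) a b e \<longleftrightarrow> desc n (pos y) a b (\<not> e)"
      using lattice_row_BL[OF y] by blast
    have "class_eq n (pos t) (pos u)" using t(2) u(2) eq class_eq_sym class_eq_trans by metis
    then have "t = u" using top_eqI t(1,3) u(1,3) by blast
    have "desc n (pos x) = desc n (pos y)"
    proof (intro ext)
      fix a b e show "desc n (pos x) a b e = desc n (pos y) a b e"
        using t(4)[of a b "\<not> e"] u(4)[of a b "\<not> e"] \<open>t = u\<close> by simp
    qed
    then show "x = y" using bottoms_desc_inj x y by blast
  qed
  moreover have "lattice_row (BL n) ` bottoms n \<subseteq> bottoms n" using lattice_row_BL by blast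
  ultimately show ?thesis using endo_inj_surj[OF finite_bottoms] by (simp add: bij_betw_def)
qed

section \<open>Words of class minima\<close>

definition bottom_word :: "nat \<Rightarrow> (nat \<Rightarrow> nat) \<Rightarrow> nat set" where
  "bottom_word n x = diagram_word n (desc n (pos x))"

definition toggle_bottom :: "nat \<Rightarrow> (nat \<Rightarrow> nat) \<Rightarrow> nat \<Rightarrow> nat" where
  "toggle_bottom n x = (THE y. y \<in> bottoms n \<and> desc n (pos y) = toggle_first (desc n (pos x)))"

lemma bottom_word_row:
  assumes "n \<ge> 1" "x \<in> bottoms n"
  shows "bottom_word n (lattice_row (BL n) x) = rot (2 * n) (bottom_word n x)"
proof -
  let ?y = "lattice_row (BL n) x"
  have y: "?y \<in> bottoms n" using lattice_row_BL[OF assms(2)] by blast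
  obtain t where t: "t permutes {1..n+1}" "class_eq n (pos ?y) (pos t)" "good n (neg (pos t))"
      "\<And>a b e. desc n (neg (pos t)) a b e \<longleftrightarrow> desc n (pos x) a b (\<not> e)"
    using lattice_row_BL[OF assms(2)] by blast
  show ?thesis
    unfolding bottom_word_def
    by (rule diagram_word_rot[OF assms(1) bottomsD(2)[OF y] t(3) inj_on_pos[OF bottomsD(1)[OF y]] inj_on_pos[OF t(1)]
        class_eqD(1)[OF t(2)] class_eqD(2)[OF t(2)] t(4)])
qed

lemma bij_betw_bottom_word:
  assumes n: "n \<ge> 1"
  shows "bij_betw (bottom_word n) (bottoms n) {A. A \<subseteq> {..<2 * n} \<and> card A = n}"
proof -
  let ?E = "{i. i < 2 * n \<and> even i}"
  have D: "arc_diagram n (desc n (pos x))" if "x \<in> bottoms n" for x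
    using arc_diagram_desc inj_on_pos[OF bottomsD(1)[OF that]] by blast
  have sub: "bottom_word n x \<subseteq> {..<2 * n}" for x by (auto simp: bottom_word_def diagram_word_def)
  have the: "toggle_bottom n x = y" if "y \<in> bottoms n" "desc n (pos y) = toggle_first (desc n (pos x))" for x y
    unfolding toggle_bottom_def using that bottoms_desc_inj by (intro the_equality) auto
  have tog: "toggle_bottom n x \<in> bottoms n \<and> bottom_word n (toggle_bottom n x) = flip2 0 (2 * n - 1) (bottom_word n x) \<and>
      toggle_bottom n (toggle_bottom n x) = x"
    if x: "x \<in> bottoms n" and ne: "(0 \<in> bottom_word n x) \<noteq> (2 * n - 1 \<in> bottom_word n x)" for x
  proof -
    note T = toggle_first[OF n D[OF x] ne[unfolded bottom_word_def]]
    obtain y where y: "y \<in> bottoms n" "desc n (pos y) = toggle_first (desc n (pos x))"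
      using exists_bottom[OF T(1)] by blast
    have "toggle_bottom n y = x" using the[OF x] y(2) toggle_first_toggle_first by simp
    then show ?thesis using the[OF y] y T(2) by (simp add: bottom_word_def)
  qed
  have no_desc: "\<not> desc n (pos id) a b e" for a b e
    by (auto simp: desc_def adj_def pos_def)
  \<comment> \<open>The base point has the empty diagram; since even positions are negated, its word
    consists of them.\<close>
  have id: "id \<in> bottoms n"
    by (auto simp: bottoms_def permutes_id good_def adj_def pos_def)
  have id_word: "bottom_word n id = ?E"
    using no_desc by (auto simp: bottom_word_def diagram_word_def touches_right_def touches_left_def)
  have base: "x = id" if x: "x \<in> bottoms n" and "bottom_word n x \<subseteq> ?E \<or> ?E \<subseteq> bottom_word n x" for x
  proof -
    have "\<not> desc n (pos x) a b e" for a b e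
      using diagram_word_base[OF D[OF x]] that(2) unfolding bottom_word_def by blast
    then have "desc n (pos x) = desc n (pos id)" using no_desc by (intro ext) blast
    then show ?thesis using bottoms_desc_inj x id by blast
  qed
  have "?E = (\<lambda>k. 2 * k) ` {..<n}" by (auto elim!: evenE)
  then have "card ?E = n" by (simp add: card_image inj_on_def)
  moreover have "bij_betw (bottom_word n) (bottoms n) {A. A \<subseteq> {..<2 * n} \<and> card A = card ?E}"
    by (rule bij_betw_words[OF finite_bottoms bij_betw_lattice_row _ sub bottom_word_row[OF n] tog id id_word base])
      (use n in simp_all)
  ultimately show ?thesis by simp
qed

theorem proposition7p15:
  fixes n :: nat
  assumes "n \<ge> 1"
  shows "orbit_structure (lattice_row (biCambrian_lattice n)) (carrier (biCambrian_lattice n)) =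
         orbit_structure (ideal_row (square_poset n)) (order_ideals (square_poset n))"
proof -
  let ?W = "{A. A \<subseteq> {..<2 * n} \<and> card A = n}"
  have "orbit_structure (lattice_row (BL n)) (bottoms n) = orbit_structure (rot (2 * n)) ?W"
    using bij_betw_bottom_word[OF assms] lattice_row_BL bottom_word_row[OF assms]
    by (intro orbit_structure_conj) auto
  also have "\<dots> = orbit_structure (ideal_row (square_poset n)) (order_ideals (square_poset n))"
    using bij_betw_ideal_word(1)[OF assms] ideal_row_in_order_ideals bij_betw_ideal_word(2)[OF assms]
    by (intro orbit_structure_conj[symmetric]) auto
  finally show ?thesis by (simp only: carrier_biCambrian)
qed

end
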